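(* Let $X=\pi$, $a=1$, and let the stability condition $\tau^2\leq(1-\tfrac{\varepsilon_0^2}{2})h^2$ hold with some $0<\varepsilon_0\leq1$. Let $l\in\{0,1\}$. There exist $h_0>0$ and $c_1>0$ (independent of $h,\tau$) such that, for $h\leq h_0$, the following lower error bounds with respect to $u_0$, $u_1$ and $f$ hold: $$\sup_{u_j(x)=\sin kx,\ k\in\mathbb N}\ \frac{\|\bar\delta_x^l(u-v_{\mathbf h})[\mathbf d^{(j)}]\|_{L^1_{\mathbf h}(Q_T)}}{\|u_j\|_{C_{(0)}^{\lambda-j}(\bar I_\pi)}}\ \geq\ c_1h^{4(\lambda-l)/5},\qquad j=0,1,$$ $$\sup_{f(x,t)=(\sin kx)\sin(k-1)t,\ k\in\mathbb N,\ k\geq2}\ \frac{\|\bar\delta_x^l(u-v_{\mathbf h})[\mathbf d^{(2)}]\|_{L^1_{\mathbf h}(Q_T)}}{\|f\|_{C_{(0)}^{\lambda-1}(\bar Q_T)}}\ \geq\ c_1h^{4(\lambda-l)/5},$$ for any $l\leq\lambda\leq5+l$, where, for $l=0$, additionally $\lambda\geq1$ in the first bound with $j=1$ and in the second bound. Here $\mathbf d^{(0)}=(u_0,0,0)$, $\mathbf d^{(1)}=(0,u_1,0)$, $\mathbf d^{(2)}=(0,0,f)$.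
   Context: Problem. $I_\pi=(0,\pi)$, $I_T=(0,T)$, $Q_T=I_\pi\times I_T$. For data $\mathbf d=(u_0,u_1,f)$, $u$ is the solution of $\partial_t^2u-\partial_x^2u=f$ in $Q_T$, $u|_{x=0,\pi}=0$, $u|_{t=0}=u_0$, $\partial_tu|_{t=0}=u_1$. Meshes and operators. $h=\pi/N$, $\tau=T/M$, $x_i=ih$ ($0\leq i\leq N$), $t_m=m\tau$ ($0\leq m\leq M$), $\bar\omega_h=\{x_i\}_{i=0}^N$, $\omega_h=\{x_i\}_{i=1}^{N-1}$, $\omega^\tau=\{t_m\}_{m=1}^{M-1}$, $\mathbf h=(h,\tau)$. $\Lambda_xw_i=\frac{w_{i-1}-2w_i+w_{i+1}}{h^2}$, $s_Nw_i=\frac1{12}(w_{i-1}+10w_i+w_{i+1})$, $\bar\delta_xw_i=\frac{w_i-w_{i-1}}h$ ($\bar\delta_x^0$ is the identity, $\bar\delta_x^1=\bar\delta_x$), $\delta_ty^m=\frac{y^{m+1}-y^m}\tau$, $\Lambda_ty^m=\frac{y^{m+1}-2y^m+y^{m-1}}{\tau^2}$. Averages: $q_hw_i=\frac1h\int_{x_{i-1}}^{x_{i+1}}w(x)\max\{1-|\frac xh-i|,0\}\,dx$ ($1\leq i\leq N-1$), $q_\tau z^0=\frac2\tau\int_0^\tau z(t)(1-\frac t\tau)\,dt$, $q_\tau z^m=\frac1\tau\int_{t_{m-1}}^{t_{m+1}}z(t)\max\{1-|\frac t\tau-m|,0\}\,dt$ ($1\leq m\leq M-1$). Compact scheme. $v=v_{\mathbf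 h}$ solves $(s_N-\frac1{12}\tau^2\Lambda_x)\Lambda_tv-\Lambda_xv=f_{\mathbf h}$ on $\omega_h\times\omega^\tau$; $(s_N-\frac1{12}\tau^2\Lambda_x)\delta_tv^0-\frac\tau2\Lambda_xv^0=u_{1\mathbf h}+\frac\tau2f_{\mathbf h}^0$ on $\omega_h$; $v^0=u_0$ on $\bar\omega_h$; $v_i^m|_{i=0,N}=0$ for $1\leq m\leq M$; with $f_{\mathbf h}=q_hq_\tau f$ (for $0\leq m\leq M-1$), and with $u_{1\mathbf h}$ depending linearly on $u_1$ such that for $u_1=\sin kx$, $1\leq k\leq N-1$, $u_{1\mathbf h}=a_{1k}\sin kx$ with $a_{1k}=1+\mathcal O((kh)^2)$ uniformly in $k,h,\tau$. This includes the choices $u_{1\mathbf h}=s_Nu_1+\frac{\tau^2}{12}\Lambda_xu_1$, $u_{1\mathbf h}=q_hu_1+\frac{\tau^2}{12}\Lambda_xu_1$, and $u_{1\mathbf h}=(\mathbf I+\frac{\tau^2}{12}\Lambda_x)q_hu_1$ with $q_hu_1|_{i=0,N}:=0$. $(u-v_{\mathbf h})[\mathbf d]$ denotes the scheme error $u-v$ on the mesh $\{x_i\}\times\{t_m\}$ for the data $\mathbf d$. Mesh norms. $\|w\|_{L_h^1(I_\pi)}=\sum_{i=1}^N\frac12(|w_{i-1}|+|w_i|)h$; for difference quotients, $\|\bar\delta_xw\|_{L_h^1(I_\pi)}=\sum_{i=1}^N|\bar\delta_xw_i|h$; $\|y\|_{L_\tau^1(I_T)}=\sum_{j=1}^M\frac12(|y_{j-1}|+|y_j|)\tau$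 with $y_j=y(t_j)$; $\|v\|_{L_{\mathbf h}^1(Q_T)}=\big\|\,\|v\|_{L_h^1(I_\pi)}\big\|_{L_\tau^1(I_T)}$. Hölder spaces. For real $\lambda\geq0$, $C^\lambda(\bar I_\pi)$ and $C^\lambda(\bar Q_T)$ are the usual Hölder spaces (for integer $\lambda=\ell$, the $\ell$ times continuously differentiable functions; continuous functions for $\ell=0$). $C_{(0)}^\lambda(\bar I_\pi)$ is the subspace (same norm) of $w$ with $\partial_x^{2k}w|_{x=0,\pi}=0$ for $0\leq2k\leq[\lambda]$. $C_{(0)}^\lambda(\bar Q_T)$ is the subspace (same norm) of $f$ with $\partial_x^{2k}f|_{x=0,\pi}=0$ and $\partial_t^{2k}f|_{t=0}=0$ for $0\leq2k\leq[\lambda]$. $[\lambda]$ is the integer part. *)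

theory Defs
  imports "HOL-Analysis.Analysis"
begin

section \<open>Hoelder spaces\<close>

text \<open>
  All derivatives are taken within the closed intervals \<open>[0, \<pi>]\<close> and \<open>[0, T]\<close>: they are the
  ordinary ones at interior points and one-sided ones at the end points.  Functions of
  \<open>(x, t)\<close> are curried.
\<close>

definition Dx1 :: "(real \<Rightarrow> real) \<Rightarrow> real \<Rightarrow> real" where
  "Dx1 w = (\<lambda>x. vector_derivative w (at x within {0..pi}))"

definition Dx :: "(real \<Rightarrow> real \<Rightarrow> real) \<Rightarrow> real \<Rightarrow> real \<Rightarrow> real" where
  "Dx f = (\<lambda>x t. vector_derivative (\<lambda>y. f y t) (at x within {0..pi}))"

definition Dt :: "real \<Rightarrow> (real \<Rightarrow> real \<Rightarrow> real) \<Rightarrow> real \<Rightarrow> real \<Rightarrow> real" where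
  "Dt T f = (\<lambda>x t. vector_derivative (f x) (at t within {0..T}))"

abbreviation QT :: "real \<Rightarrow> (real \<times> real) set" where
  "QT T \<equiv> {0..pi} \<times> {0..T}"

primrec cont_diff_I :: "nat \<Rightarrow> (real \<Rightarrow> real) \<Rightarrow> bool" where
  "cont_diff_I 0 w \<longleftrightarrow> continuous_on {0..pi} w"
| "cont_diff_I (Suc n) w \<longleftrightarrow> w differentiable_on {0..pi} \<and> cont_diff_I n (Dx1 w)"

primrec cont_diff_Q :: "real \<Rightarrow> nat \<Rightarrow> (real \<Rightarrow> real \<Rightarrow> real) \<Rightarrow> bool" where
  "cont_diff_Q T 0 f \<longleftrightarrow> continuous_on (QT T) (\<lambda>(x, t). f x t)"
| "cont_diff_Q T (Suc n) f \<longleftrightarrow>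
     continuous_on (QT T) (\<lambda>(x, t). f x t) \<and>
     (\<forall>t\<in>{0..T}. (\<lambda>x. f x t) differentiable_on {0..pi}) \<and>
     (\<forall>x\<in>{0..pi}. f x differentiable_on {0..T}) \<and>
     cont_diff_Q T n (Dx f) \<and> cont_diff_Q T n (Dt T f)"

definition sup_norm :: "'a set \<Rightarrow> ('a \<Rightarrow> real) \<Rightarrow> ennreal" where
  "sup_norm S g = (SUP p\<in>S. ennreal \<bar>g p\<bar>)"

definition holder_seminorm :: "real \<Rightarrow> 'a::metric_space set \<Rightarrow> ('a \<Rightarrow> real) \<Rightarrow> ennreal" where
  "holder_seminorm \<alpha> S g =
     (SUP (p, q)\<in>{(p, q). p \<in> S \<and> q \<in> S \<and> p \<noteq> q}. ennreal (\<bar>g p - g q\<bar> / dist p q powr \<alpha>))"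

abbreviation int_part :: "real \<Rightarrow> nat" where
  "int_part r \<equiv> nat \<lfloor>r\<rfloor>"

definition holder_norm_I :: "real \<Rightarrow> (real \<Rightarrow> real) \<Rightarrow> ennreal" where
  "holder_norm_I r w =
     (\<Sum>k\<le>int_part r. sup_norm {0..pi} ((Dx1 ^^ k) w)) +
     (if frac r = 0 then 0
      else holder_seminorm (frac r) {0..pi} ((Dx1 ^^ int_part r) w))"

definition holder_norm_Q :: "real \<Rightarrow> real \<Rightarrow> (real \<Rightarrow> real \<Rightarrow> real) \<Rightarrow> ennreal" where
  "holder_norm_Q T r f =
     (\<Sum>(i, j)\<in>{(i, j). i + j \<le> int_part r}.
        sup_norm (QT T) (\<lambda>(x, t). (Dx ^^ i) ((Dt T ^^ j) f) x t)) +
     (if frac r = 0 then 0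
      else (\<Sum>(i, j)\<in>{(i, j). i + j = int_part r}.
        holder_seminorm (frac r) (QT T) (\<lambda>(x, t). (Dx ^^ i) ((Dt T ^^ j) f) x t)))"

definition holder_space_I :: "real \<Rightarrow> (real \<Rightarrow> real) set" where
  "holder_space_I r = {w. cont_diff_I (int_part r) w \<and> holder_norm_I r w < \<infinity>}"

definition holder_space_Q :: "real \<Rightarrow> real \<Rightarrow> (real \<Rightarrow> real \<Rightarrow> real) set" where
  "holder_space_Q T r = {f. cont_diff_Q T (int_part r) f \<and> holder_norm_Q T r f < \<infinity>}"

definition holder0_space_I :: "real \<Rightarrow> (real \<Rightarrow> real) set" where
  "holder0_space_I r = {w \<in> holder_space_I r.
     \<forall>k. 2 * k \<le> int_part r \<longrightarrow> (\<forall>x\<in>{0, pi}. (Dx1 ^^ (2 * k)) w x = 0)}"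

definition holder0_space_Q :: "real \<Rightarrow> real \<Rightarrow> (real \<Rightarrow> real \<Rightarrow> real) set" where
  "holder0_space_Q T r = {f \<in> holder_space_Q T r.
     \<forall>k. 2 * k \<le> int_part r \<longrightarrow>
       (\<forall>x\<in>{0, pi}. \<forall>t\<in>{0..T}. (Dx ^^ (2 * k)) f x t = 0) \<and>
       (\<forall>x\<in>{0..pi}. (Dt T ^^ (2 * k)) f x 0 = 0)}"

text \<open>The norms of the subspaces, extended by \<open>\<infinity>\<close> to functions outside them.\<close>

definition holder0_norm_I :: "real \<Rightarrow> (real \<Rightarrow> real) \<Rightarrow> ennreal" where
  "holder0_norm_I r w = (if w \<in> holder0_space_I r then holder_norm_I r w else \<infinity>)"

definition holder0_norm_Q :: "real \<Rightarrow> real \<Rightarrow> (real \<Rightarrow> real \<Rightarrow> real) \<Rightarrow> ennreal" where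
  "holder0_norm_Q T r f = (if f \<in> holder0_space_Q T r then holder_norm_Q T r f else \<infinity>)"

section \<open>The initial-boundary value problem\<close>

definition is_wave_solution ::
  "real \<Rightarrow> (real \<Rightarrow> real) \<Rightarrow> (real \<Rightarrow> real) \<Rightarrow> (real \<Rightarrow> real \<Rightarrow> real) \<Rightarrow> (real \<Rightarrow> real \<Rightarrow> real) \<Rightarrow> bool"
where
  "is_wave_solution T u0 u1 f u \<longleftrightarrow>
     cont_diff_Q T 2 u \<and>
     (\<forall>x\<in>{0<..<pi}. \<forall>t\<in>{0<..<T}. (Dt T ^^ 2) u x t - (Dx ^^ 2) u x t = f x t) \<and>
     (\<forall>x\<in>{0, pi}. \<forall>t\<in>{0..T}. u x t = 0) \<and>
     (\<forall>x\<in>{0..pi}. u x 0 = u0 x \<and> Dt T u x 0 = u1 x)"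

text \<open>
  The solution is unique on the closed rectangle; the choice only affects irrelevant values
  outside of it.
\<close>

definition wave_solution ::
  "real \<Rightarrow> (real \<Rightarrow> real) \<Rightarrow> (real \<Rightarrow> real) \<Rightarrow> (real \<Rightarrow> real \<Rightarrow> real) \<Rightarrow> real \<Rightarrow> real \<Rightarrow> real" where
  "wave_solution T u0 u1 f = (SOME u. is_wave_solution T u0 u1 f u)"

section \<open>Mesh operators\<close>

text \<open>
  Mesh functions are indexed by natural numbers.  The operators using index \<open>i - 1\<close> are only
  applied at \<open>i \<ge> 1\<close>.
\<close>

definition Lambda_x :: "real \<Rightarrow> (nat \<Rightarrow> real) \<Rightarrow> nat \<Rightarrow> real" where
  "Lambda_x h w i = (w (i - 1) - 2 * w i + w (i + 1)) / h\<^sup>2"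

definition s_N :: "(nat \<Rightarrow> real) \<Rightarrow> nat \<Rightarrow> real" where
  "s_N w i = (w (i - 1) + 10 * w i + w (i + 1)) / 12"

definition bdelta_x :: "real \<Rightarrow> (nat \<Rightarrow> real) \<Rightarrow> nat \<Rightarrow> real" where
  "bdelta_x h w i = (w i - w (i - 1)) / h"

definition delta_t :: "real \<Rightarrow> (nat \<Rightarrow> real) \<Rightarrow> nat \<Rightarrow> real" where
  "delta_t \<tau> y m = (y (m + 1) - y m) / \<tau>"

definition Lambda_t :: "real \<Rightarrow> (nat \<Rightarrow> real) \<Rightarrow> nat \<Rightarrow> real" where
  "Lambda_t \<tau> y m = (y (m + 1) - 2 * y m + y (m - 1)) / \<tau>\<^sup>2"

definition q_h :: "real \<Rightarrow> (real \<Rightarrow> real) \<Rightarrow> nat \<Rightarrow> real" where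
  "q_h h w i = (1 / h) * integral {(real i - 1) * h .. (real i + 1) * h}
     (\<lambda>x. w x * max (1 - \<bar>x / h - real i\<bar>) 0)"

definition q_tau :: "real \<Rightarrow> (real \<Rightarrow> real) \<Rightarrow> nat \<Rightarrow> real" where
  "q_tau \<tau> z m =
     (if m = 0 then (2 / \<tau>) * integral {0..\<tau>} (\<lambda>t. z t * (1 - t / \<tau>))
      else (1 / \<tau>) * integral {(real m - 1) * \<tau> .. (real m + 1) * \<tau>}
        (\<lambda>t. z t * max (1 - \<bar>t / \<tau> - real m\<bar>) 0))"

section \<open>The compact scheme\<close>

text \<open>\<open>B_op h \<tau>\<close> is the operator \<open>s\<^sub>N - \<tau>\<^sup>2/12 \<Lambda>\<^sub>x\<close>.\<close>

definition B_op :: "real \<Rightarrow> real \<Rightarrow> (nat \<Rightarrow> real) \<Rightarrow> nat \<Rightarrow> real" where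
  "B_op h \<tau> w i = s_N w i - \<tau>\<^sup>2 / 12 * Lambda_x h w i"

definition f_mesh :: "real \<Rightarrow> real \<Rightarrow> (real \<Rightarrow> real \<Rightarrow> real) \<Rightarrow> nat \<Rightarrow> nat \<Rightarrow> real" where
  "f_mesh h \<tau> f i m = q_h h (\<lambda>x. q_tau \<tau> (f x) m) i"

text \<open>
  The third argument \<open>u1h\<close> is the mesh function approximating the second initial datum.
  In \<open>v i m\<close>, \<open>i\<close> is the space and \<open>m\<close> the time index.
\<close>

definition is_scheme_solution ::
  "real \<Rightarrow> nat \<Rightarrow> nat \<Rightarrow> (real \<Rightarrow> real) \<Rightarrow> (nat \<Rightarrow> real) \<Rightarrow> (real \<Rightarrow> real \<Rightarrow> real) \<Rightarrow>
   (nat \<Rightarrow> nat \<Rightarrow> real) \<Rightarrow> bool"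
where
  "is_scheme_solution T N M u0 u1h f v \<longleftrightarrow>
     (let h = pi / real N; \<tau> = T / real M in
       (\<forall>i\<in>{1..<N}. \<forall>m\<in>{1..<M}.
          B_op h \<tau> (\<lambda>j. Lambda_t \<tau> (v j) m) i - Lambda_x h (\<lambda>j. v j m) i = f_mesh h \<tau> f i m) \<and>
       (\<forall>i\<in>{1..<N}.
          B_op h \<tau> (\<lambda>j. delta_t \<tau> (v j) 0) i - \<tau> / 2 * Lambda_x h (\<lambda>j. v j 0) i
            = u1h i + \<tau> / 2 * f_mesh h \<tau> f i 0) \<and>
       (\<forall>i\<in>{0..N}. v i 0 = u0 (real i * h)) \<and>
       (\<forall>m\<in>{1..M}. v 0 m = 0 \<and> v N m = 0))"

text \<open>Unique at the indices \<open>i \<le> N\<close>, \<open>m \<le> M\<close> under the stability condition.\<close>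

definition scheme_solution ::
  "real \<Rightarrow> nat \<Rightarrow> nat \<Rightarrow> (real \<Rightarrow> real) \<Rightarrow> (nat \<Rightarrow> real) \<Rightarrow> (real \<Rightarrow> real \<Rightarrow> real) \<Rightarrow>
   nat \<Rightarrow> nat \<Rightarrow> real"
where
  "scheme_solution T N M u0 u1h f = (SOME v. is_scheme_solution T N M u0 u1h f v)"

definition stable_mesh :: "real \<Rightarrow> real \<Rightarrow> nat \<Rightarrow> nat \<Rightarrow> bool" where
  "stable_mesh T \<epsilon>\<^sub>0 N M \<longleftrightarrow>
     0 < N \<and> 0 < M \<and> (T / real M)\<^sup>2 \<le> (1 - \<epsilon>\<^sub>0\<^sup>2 / 2) * (pi / real N)\<^sup>2"

text \<open>
  The admissible families \<open>U N M\<close> of maps taking the initial velocity to its mesh approximation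
  on the interior nodes. Linearity is required on continuous functions only (averaging by
  \<open>q_h\<close> is not linear on non-integrable functions), and the bound on the symbol
  only on meshes satisfying the stability condition (it can fail when \<open>\<tau>/h\<close> is unbounded).
\<close>

definition admissible_u1h ::
  "real \<Rightarrow> real \<Rightarrow> (nat \<Rightarrow> nat \<Rightarrow> (real \<Rightarrow> real) \<Rightarrow> nat \<Rightarrow> real) \<Rightarrow> bool"
where
  "admissible_u1h T \<epsilon>\<^sub>0 U \<longleftrightarrow>
     (\<forall>N M. stable_mesh T \<epsilon>\<^sub>0 N M \<longrightarrow>
        (\<forall>w z a b. continuous_on {0..pi} w \<longrightarrow> continuous_on {0..pi} z \<longrightarrow>
          (\<forall>i\<in>{1..<N}. U N M (\<lambda>x. a * w x + b * z x) i = a * U N M w i + b * U N M z i))) \<and>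
     (\<exists>C. \<forall>N M. stable_mesh T \<epsilon>\<^sub>0 N M \<longrightarrow>
        (\<forall>k\<in>{1..<N}. \<exists>a. \<bar>a - 1\<bar> \<le> C * (real k * (pi / real N))\<^sup>2 \<and>
          (\<forall>i\<in>{1..<N}. U N M (\<lambda>x. sin (real k * x)) i
             = a * sin (real k * (real i * (pi / real N))))))"

section \<open>Error norms\<close>

text \<open>
  \<open>L1h_norm N h w\<close> uses the values of \<open>w\<close> at all the nodes; \<open>L1h_norm_diff N h w\<close> is for
  difference quotients, which live at the indices \<open>1, \<dots>, N\<close>.
\<close>

definition L1h_norm :: "nat \<Rightarrow> real \<Rightarrow> (nat \<Rightarrow> real) \<Rightarrow> real" where
  "L1h_norm N h w = (\<Sum>i=1..N. (\<bar>w (i - 1)\<bar> + \<bar>w i\<bar>) / 2 * h)"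

definition L1h_norm_diff :: "nat \<Rightarrow> real \<Rightarrow> (nat \<Rightarrow> real) \<Rightarrow> real" where
  "L1h_norm_diff N h w = (\<Sum>i=1..N. \<bar>w i\<bar> * h)"

text \<open>The \<open>L\<^sup>1\<close> mesh norm of the \<open>l\<close>-th backward difference quotient (\<open>l = 0, 1\<close>) in \<open>x\<close>;
  the time direction uses the same trapezoidal norm as the space direction.\<close>

definition L1_norm_bdelta ::
  "nat \<Rightarrow> real \<Rightarrow> nat \<Rightarrow> nat \<Rightarrow> (nat \<Rightarrow> nat \<Rightarrow> real) \<Rightarrow> real"
where
  "L1_norm_bdelta l T N M e =
     (let h = pi / real N; \<tau> = T / real M in
       L1h_norm M \<tau> (\<lambda>m.
         if l = 0 then L1h_norm N h (\<lambda>i. e i m)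
         else L1h_norm_diff N h (bdelta_x h (\<lambda>i. e i m))))"

definition scheme_error ::
  "real \<Rightarrow> (nat \<Rightarrow> nat \<Rightarrow> (real \<Rightarrow> real) \<Rightarrow> nat \<Rightarrow> real) \<Rightarrow> nat \<Rightarrow> nat \<Rightarrow>
   (real \<Rightarrow> real) \<Rightarrow> (real \<Rightarrow> real) \<Rightarrow> (real \<Rightarrow> real \<Rightarrow> real) \<Rightarrow> nat \<Rightarrow> nat \<Rightarrow> real"
where
  "scheme_error T U N M u0 u1 f i m =
     wave_solution T u0 u1 f (real i * (pi / real N)) (real m * (T / real M))
     - scheme_solution T N M u0 (U N M u1) f i m"

definition error_norm ::
  "nat \<Rightarrow> real \<Rightarrow> (nat \<Rightarrow> nat \<Rightarrow> (real \<Rightarrow> real) \<Rightarrow> nat \<Rightarrow> real) \<Rightarrow> nat \<Rightarrow> nat \<Rightarrow>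
   (real \<Rightarrow> real) \<Rightarrow> (real \<Rightarrow> real) \<Rightarrow> (real \<Rightarrow> real \<Rightarrow> real) \<Rightarrow> ennreal"
where
  "error_norm l T U N M u0 u1 f = ennreal (L1_norm_bdelta l T N M (scheme_error T U N M u0 u1 f))"

end

theory Submission
  imports Defs "HOL-Real_Asymp.Real_Asymp"
begin

text \<open>
  Both the equation and the scheme act diagonally on \<open>sin (k x)\<close>, so for a single mode the error is
  \<open>sin (k x)\<close> times the difference of two oscillations in time: one with the exact frequency
  \<open>k\<close> and one with a discrete frequency \<open>\<mu>\<close>.  With \<open>a = k h / 2\<close>, \<open>b = \<mu> \<tau> / 2\<close> the dispersion
  relation of the scheme is
  \<open>1 / sin\<^sup>2 b - 1 / 3 = (1 / sin\<^sup>2 a - 1 / 3) / (\<tau> / h)\<^sup>2\<close>; since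
  \<open>1 / sin\<^sup>2 x = 1 / x\<^sup>2 + 1 / 3 + x\<^sup>2 / 15 + O(x^4)\<close>, the first two terms agree for \<open>\<mu> = k\<close> (this is
  the fourth order of the scheme), and the third one makes the defect \<open>g = k - \<mu>\<close> comparable with
  \<open>(1 - (\<tau> / h)^4) k^5 h^4\<close>.  The stability condition bounds the first factor away from \<open>0\<close>.

  Take \<open>k\<close> of size \<open>h^(-4/5)\<close>.  Then \<open>k^5 h^4\<close> is about \<open>1\<close>, the defect lies between two positive
  constants, and the exact and discrete waves get out of phase by an amount of order one during
  \<open>(0, T)\<close>: the relative error does not tend to \<open>0\<close>.  The quotients in the theorem are therefore
  governed by the sizes alone: the error (of the \<open>l\<close>-th difference quotient) has size \<open>k^l\<close> against a
  Hoelder norm of size \<open>k^r\<close>, respectively \<open>k^(l-1)\<close> against \<open>k^(r-1)\<close>, and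
  \<open>k^(l-r)\<close> is at least \<open>h^(4 (r - l) / 5)\<close>.  This one mode serves every smoothness \<open>r\<close>.

  Three points need care.  (1) The formulas for the exact and the discrete solution require
  uniqueness; it is proved with the sine coefficients of a classical solution
  (\<open>wave_solution_unique\<close>) and with the diagonal dominance of the implicit operator
  (\<open>scheme_solution_unique\<close>).  (2) The \<open>L\<^sup>1\<close> norm in time is bounded below by testing with
  \<open>cos (k t)\<close> or \<open>sin (k t)\<close>: the product is a slow beat, at least \<open>g\<^sup>2 t\<^sup>2 / 12\<close>
  (\<open>slow_beat_ge\<close>), plus cosines of frequency at least \<open>k\<close>, whose mesh sums are \<open>O(1 / k)\<close>.
  (3) For the initial velocity and the forcing also the amplitudes of the discrete oscillations
  enter; they are computed in the limit of mesh refinement (\<open>mode_limit\<close>).  The forcing frequency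
  \<open>k - 1\<close> is at distance \<open>1\<close> from \<open>k\<close> but at distance \<open>1 - g\<close> from \<open>\<mu>\<close>, which rescales the discrete
  response by \<open>1 / (1 - g)\<close> and changes the beat to \<open>g (1 - cos t) - (1 - cos (g t))\<close>, still
  positive for small \<open>g\<close> and \<open>0 < t \<le> 1\<close>.
\<close>

section \<open>Completeness of the sine system\<close>

definition sine_orthogonal :: "(real \<Rightarrow> real) \<Rightarrow> bool" where
  "sine_orthogonal w \<longleftrightarrow> continuous_on {0..pi} w \<and>
     (\<forall>n::nat. integral {0..pi} (\<lambda>x. w x * sin (real n * x)) = 0)"

lemma sine_orthogonal_add:
  assumes "sine_orthogonal v" "sine_orthogonal w"
  shows "sine_orthogonal (\<lambda>x. v x + w x)"
proof -
  have cont: "continuous_on {0..pi} v" "continuous_on {0..pi} w"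
    using assms by (auto simp: sine_orthogonal_def)
  have "integral {0..pi} (\<lambda>x. (v x + w x) * sin (real n * x)) = 0" for n
  proof -
    have "integral {0..pi} (\<lambda>x. v x * sin (real n * x) + w x * sin (real n * x)) =
          integral {0..pi} (\<lambda>x. v x * sin (real n * x)) + integral {0..pi} (\<lambda>x. w x * sin (real n * x))"
      by (intro integral_add integrable_continuous_interval continuous_intros cont)
    then show ?thesis
      using assms by (simp add: sine_orthogonal_def distrib_right)
  qed
  then show ?thesis
    using cont by (auto simp: sine_orthogonal_def intro!: continuous_intros)
qed

lemma sine_orthogonal_scale:
  assumes "sine_orthogonal w"
  shows "sine_orthogonal (\<lambda>x. w x * c)"
proof -
  have "integral {0..pi} (\<lambda>x. (w x * c) * sin (real n * x)) = 0" for n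
    using assms integral_mult_right[of "{0..pi}" c "\<lambda>x. w x * sin (real n * x)"]
    by (simp add: sine_orthogonal_def mult_ac)
  then show ?thesis
    using assms by (auto simp: sine_orthogonal_def intro!: continuous_intros)
qed

text \<open>
  \<open>2 sin (n x) cos x = sin ((n + 1) x) + sin ((n - 1) x)\<close>, so the class is invariant under
  multiplication by \<open>cos\<close>, hence under polynomials in \<open>cos\<close>.
\<close>

lemma sine_orthogonal_mult_cos:
  assumes "sine_orthogonal w"
  shows "sine_orthogonal (\<lambda>x. w x * cos x)"
proof -
  have cont: "continuous_on {0..pi} w"
    and orth: "\<And>n::nat. integral {0..pi} (\<lambda>x. w x * sin (real n * x)) = 0"
    using assms by (auto simp: sine_orthogonal_def)
  have "integral {0..pi} (\<lambda>x. w x * cos x * sin (real n * x)) = 0" for n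
  proof (cases n)
    case (Suc m)
    have eq: "w x * cos x * sin (real n * x) =
          (w x * sin (real (Suc n) * x) + w x * sin (real m * x)) * (1/2)" for x
    proof -
      have "sin (real (Suc n) * x) = sin (real n * x) * cos x + cos (real n * x) * sin x"
        using sin_add[of "real n * x" x] by (simp add: algebra_simps)
      moreover have "sin (real m * x) = sin (real n * x) * cos x - cos (real n * x) * sin x"
        using sin_diff[of "real n * x" x] by (simp add: Suc algebra_simps)
      ultimately have sum: "sin (real (Suc n) * x) + sin (real m * x) = 2 * (sin (real n * x) * cos x)"
        by linarith
      show ?thesis
        unfolding distrib_left [symmetric] sum by (simp add: mult.assoc mult.commute)
    qed
    have "integral {0..pi} (\<lambda>x. w x * sin (real (Suc n) * x) + w x * sin (real m * x)) = 0"
      using orth[of "Suc n"] orth[of m]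
      by (subst integral_add) (auto intro!: integrable_continuous_interval continuous_intros cont)
    then show ?thesis
      unfolding eq integral_mult_left by simp
  qed auto
  then show ?thesis
    using cont by (auto simp: sine_orthogonal_def intro!: continuous_intros)
qed

lemma sine_orthogonal_mult_poly_cos:
  assumes "real_polynomial_function p" "sine_orthogonal w"
  shows "sine_orthogonal (\<lambda>x. w x * p (cos x))"
  using assms
proof (induction arbitrary: w)
  case (linear f)
  obtain c where "f = (\<lambda>x. x * c)"
    using real_bounded_linear[THEN iffD1, OF linear.hyps] by blast
  then show ?case
    using sine_orthogonal_scale[OF sine_orthogonal_mult_cos[OF linear.prems], of c]
    by (simp add: mult_ac)
next
  case (const c)
  then show ?case by (simp add: sine_orthogonal_scale)
next
  case (add f g)
  then show ?case
    using sine_orthogonal_add[OF add.IH(1)[OF add.prems] add.IH(2)[OF add.prems]]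
    by (simp add: distrib_left)
next
  case (mult f g)
  then show ?case
    using mult.IH(2)[OF mult.IH(1)[OF mult.prems]] by (simp add: mult_ac)
qed

text \<open>
  \<open>w sin\<close> is orthogonal to all polynomials in \<open>cos\<close>.  On \<open>[0, \<pi>]\<close> these are dense in the
  continuous functions, because \<open>cos\<close> is injective there; so \<open>w sin\<close> is orthogonal to itself.
\<close>

lemma sine_orthogonal_eq_0:
  assumes w: "sine_orthogonal w" and x: "0 < x" "x < pi"
  shows "w x = 0"
proof -
  define g where "g = (\<lambda>x. w x * sin x)"
  have cont: "continuous_on {0..pi} w"
    using w by (simp add: sine_orthogonal_def)
  have gcont: "continuous_on {0..pi} g"
    unfolding g_def by (intro continuous_intros cont)
  have gint: "(\<lambda>x. g x * h x) integrable_on {0..pi}" if "continuous_on {0..pi} h" for h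
    by (intro integrable_continuous_interval continuous_intros gcont that)
  have poly: "integral {0..pi} (\<lambda>x. g x * p (cos x)) = 0" if "real_polynomial_function p" for p
  proof -
    have "integral {0..pi} (\<lambda>x. (w x * p (cos x)) * sin (real 1 * x)) = 0"
      using sine_orthogonal_mult_poly_cos[OF that w] unfolding sine_orthogonal_def by blast
    then show ?thesis by (simp add: g_def mult_ac)
  qed
  have acos: "continuous_on {-1..1} (\<lambda>y. g (arccos y))"
    by (rule continuous_on_compose2[OF gcont continuous_on_arccos'])
       (auto simp: arccos_lbound arccos_ubound)
  define I where "I = integral {0..pi} (\<lambda>x. \<bar>g x\<bar>)"
  have bound: "integral {0..pi} (\<lambda>x. g x * g x) \<le> e * I" if e: "0 < e" for e
  proof -
    obtain p where p: "real_polynomial_function p"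
      and close: "\<And>y. y \<in> {-1..1} \<Longrightarrow> \<bar>g (arccos y) - p y\<bar> < e"
      using Stone_Weierstrass_real_polynomial_function[OF compact_Icc acos e] by blast
    have pc: "continuous_on {0..pi} (\<lambda>x. p (cos x))"
    proof (rule continuous_on_compose2[of UNIV p])
      show "continuous_on UNIV p"
        using p by (simp add: continuous_on_polymonial_function real_polynomial_function_eq)
    qed (auto intro!: continuous_intros)
    have "integral {0..pi} (\<lambda>x. g x * g x) =
          integral {0..pi} (\<lambda>x. g x * g x - g x * p (cos x))"
      using integral_diff[OF gint[OF gcont] gint[OF pc]] by (simp add: poly[OF p])
    also have "\<dots> \<le> integral {0..pi} (\<lambda>x. \<bar>g x\<bar> * e)"
    proof (rule integral_le)
      show "(\<lambda>x. g x * g x - g x * p (cos x)) integrable_on {0..pi}"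
        by (rule integrable_diff[OF gint[OF gcont] gint[OF pc]])
      show "(\<lambda>x. \<bar>g x\<bar> * e) integrable_on {0..pi}"
        by (intro integrable_continuous_interval continuous_intros gcont)
      fix y assume y: "y \<in> {0..pi}"
      have "\<bar>g y - p (cos y)\<bar> < e"
        using close[of "cos y"] y by (simp add: arccos_cos)
      then have "\<bar>g y\<bar> * \<bar>g y - p (cos y)\<bar> \<le> \<bar>g y\<bar> * e"
        by (intro mult_left_mono) auto
      then show "g y * g y - g y * p (cos y) \<le> \<bar>g y\<bar> * e"
        unfolding abs_mult [symmetric] right_diff_distrib by linarith
    qed
    also have "\<dots> = e * I"
      by (simp add: I_def mult.commute)
    finally show ?thesis .
  qed
  have I0: "I \<ge> 0"
    unfolding I_def
    by (intro integral_nonneg integrable_continuous_interval continuous_intros gcont) auto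
  have "integral {0..pi} (\<lambda>x. g x * g x) \<le> 0"
  proof (rule field_le_epsilon)
    fix e :: real assume "0 < e"
    then have "e / (I + 1) > 0" "I / (I + 1) \<le> 1" using I0 by auto
    then have "e * (I / (I + 1)) \<le> e * 1"
      using \<open>0 < e\<close> by (intro mult_left_mono) auto
    then show "integral {0..pi} (\<lambda>x. g x * g x) \<le> 0 + e"
      using bound[OF \<open>e / (I + 1) > 0\<close>] by simp
  qed
  moreover have "integral {0..pi} (\<lambda>x. g x * g x) \<ge> 0"
    by (rule integral_nonneg[OF gint[OF gcont]]) simp
  ultimately have "integral {0..pi} (\<lambda>x. g x * g x) = 0" by simp
  then have "g x * g x = 0"
    using integral_eq_0_iff[of 0 pi "\<lambda>x. g x * g x"] x continuous_on_mult[OF gcont gcont]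
    by simp
  moreover have "sin x \<noteq> 0"
    using sin_gt_zero[OF x] by simp
  ultimately show ?thesis
    by (simp add: g_def)
qed

section \<open>Uniqueness for the wave equation\<close>

lemma has_derivative_Dt:
  assumes "f x differentiable_on {0..T}" "t \<in> {0..T}"
  shows "((\<lambda>s. f x s) has_real_derivative Dt T f x t) (at t within {0..T})"
  using assms vector_derivative_works[of "f x" "at t within {0..T}"]
  by (simp add: differentiable_on_def Dt_def has_real_derivative_iff_has_vector_derivative)

lemma has_derivative_Dx:
  assumes "(\<lambda>x. f x t) differentiable_on {0..pi}" "x \<in> {0..pi}"
  shows "((\<lambda>y. f y t) has_real_derivative Dx f x t) (at x within {0..pi})"
  using assms vector_derivative_works[of "\<lambda>y. f y t" "at x within {0..pi}"]
  by (simp add: differentiable_on_def Dx_def has_real_derivative_iff_has_vector_derivative)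

lemma continuous_on_slice_x:
  assumes "continuous_on (QT T) (\<lambda>(x, t). f x t)" "t \<in> {0..T}"
  shows "continuous_on {0..pi} (\<lambda>x. f x t)"
proof -
  have "continuous_on {0..pi} (\<lambda>x. (\<lambda>(x, t). f x t) (x, t))"
    by (rule continuous_on_compose2[OF assms(1)]) (use assms(2) in \<open>auto intro!: continuous_intros\<close>)
  then show ?thesis by simp
qed

lemma sine_coefficient_derivative:
  assumes "continuous_on (QT T) (\<lambda>(x, t). f x t)"
    and "\<forall>x\<in>{0..pi}. f x differentiable_on {0..T}"
    and "continuous_on (QT T) (\<lambda>(x, t). Dt T f x t)"
    and "t \<in> {0..T}"
  shows "((\<lambda>s. integral {0..pi} (\<lambda>x. f x s * sin (n * x))) has_real_derivative
           integral {0..pi} (\<lambda>x. Dt T f x t * sin (n * x))) (at t within {0..T})"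
proof -
  have "((\<lambda>s. integral (cbox 0 pi) (\<lambda>x. f x s * sin (n * x))) has_field_derivative
         integral (cbox 0 pi) (\<lambda>x. Dt T f x t * sin (n * x))) (at t within {0..T})"
  proof (rule leibniz_rule_field_derivative)
    fix s x assume "s \<in> {0..T}" "x \<in> cbox 0 pi"
    then show "((\<lambda>s. f x s * sin (n * x)) has_real_derivative Dt T f x s * sin (n * x)) (at s within {0..T})"
      using assms(2) by (intro DERIV_cmult_right has_derivative_Dt) auto
  next
    fix s assume "s \<in> {0..T}"
    then show "(\<lambda>x. f x s * sin (n * x)) integrable_on cbox 0 pi"
      unfolding box_real
      by (intro integrable_continuous_interval continuous_intros continuous_on_slice_x[OF assms(1)])
  next
    have "continuous_on ({0..T} \<times> {0..pi}) (\<lambda>p. (\<lambda>(x, t). Dt T f x t) (snd p, fst p))"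
      by (rule continuous_on_compose2[OF assms(3)]) (auto intro!: continuous_intros)
    then have "continuous_on ({0..T} \<times> {0..pi}) (\<lambda>p. Dt T f (snd p) (fst p))"
      by simp
    then show "continuous_on ({0..T} \<times> cbox 0 pi) (\<lambda>(s, x). Dt T f x s * sin (n * x))"
      unfolding box_real case_prod_beta by (intro continuous_intros)
  qed (use assms(4) in auto)
  then show ?thesis by simp
qed

text \<open>
  Two integrations by parts, written as one application of the fundamental theorem to
  \<open>P = g' sin (n x) - n g cos (n x)\<close>.
\<close>

lemma sine_coefficient_Dxx:
  fixes g :: "real \<Rightarrow> real"
  assumes g: "\<And>x. x \<in> {0..pi} \<Longrightarrow> (g has_real_derivative g' x) (at x within {0..pi})"
    and g': "\<And>x. x \<in> {0..pi} \<Longrightarrow> (g' has_real_derivative g'' x) (at x within {0..pi})"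
    and bc: "g 0 = 0" "g pi = 0"
  shows "((\<lambda>x. g'' x * sin (real n * x)) has_integral
            - (real n)\<^sup>2 * integral {0..pi} (\<lambda>x. g x * sin (real n * x))) {0..pi}"
proof -
  define P where "P x = g' x * sin (real n * x) - real n * g x * cos (real n * x)" for x
  have sp: "sin (real n * pi) = 0" by simp
  have total: "((\<lambda>x. g'' x * sin (real n * x) + (real n)\<^sup>2 * (g x * sin (real n * x))) has_integral P pi - P 0) {0..pi}"
  proof (rule fundamental_theorem_of_calculus)
    fix x assume x: "x \<in> {0..pi}"
    have "(P has_real_derivative g'' x * sin (real n * x) + (real n)\<^sup>2 * (g x * sin (real n * x))) (at x within {0..pi})"
      unfolding P_def
      by (rule derivative_eq_intros g[OF x] g'[OF x] refl | simp add: power2_eq_square algebra_simps)+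
    then show "(P has_vector_derivative g'' x * sin (real n * x) + (real n)\<^sup>2 * (g x * sin (real n * x))) (at x within {0..pi})"
      by (simp add: has_real_derivative_iff_has_vector_derivative)
  qed simp
  have ends: "P pi - P 0 = 0"
    by (simp add: P_def bc sp)
  have lower: "((\<lambda>x. (real n)\<^sup>2 * (g x * sin (real n * x))) has_integral
        (real n)\<^sup>2 * integral {0..pi} (\<lambda>x. g x * sin (real n * x))) {0..pi}"
  proof -
    have "continuous_on {0..pi} g"
      by (rule DERIV_continuous_on) (rule g)
    then show ?thesis
      by (intro has_integral_mult_right integrable_integral integrable_continuous_interval continuous_intros)
  qed
  show ?thesis
    using has_integral_diff[OF total lower] by (simp add: ends)
qed

text \<open>
  Passing to sine coefficients turns the equation into \<open>c'' + n\<^sup>2 c = \<integral> f sin (n x) dx\<close>; the second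
  derivatives in \<open>x\<close> and \<open>t\<close> are treated separately and no mixed derivative occurs.  The equation is
  available at interior points only, which suffices under the integral.
\<close>

lemma wave_solution_sine_coefficient:
  fixes n :: nat
  assumes "is_wave_solution T u0 u1 f u"
  defines "c \<equiv> \<lambda>t. integral {0..pi} (\<lambda>x. u x t * sin (real n * x))"
    and "c' \<equiv> \<lambda>t. integral {0..pi} (\<lambda>x. Dt T u x t * sin (real n * x))"
  shows "\<And>t. t \<in> {0..T} \<Longrightarrow> (c has_real_derivative c' t) (at t within {0..T})"
    and "continuous_on {0..T} c'"
    and "\<And>t. t \<in> {0<..<T} \<Longrightarrow>
           (c' has_real_derivative
             - (real n)\<^sup>2 * c t + integral {0..pi} (\<lambda>x. f x t * sin (real n * x))) (at t)"
proof -
  have u: "cont_diff_Q T 2 u"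
    and eq: "\<And>x t. x \<in> {0<..<pi} \<Longrightarrow> t \<in> {0<..<T} \<Longrightarrow>
               Dt T (Dt T u) x t - Dx (Dx u) x t = f x t"
    and bc: "\<And>t. t \<in> {0..T} \<Longrightarrow> u 0 t = 0 \<and> u pi t = 0"
    using assms(1) by (auto simp: is_wave_solution_def numeral_2_eq_2)
  note u = u[unfolded numeral_2_eq_2 cont_diff_Q.simps]
  have c': "(c' has_real_derivative integral {0..pi} (\<lambda>x. Dt T (Dt T u) x t * sin (real n * x)))
              (at t within {0..T})" if "t \<in> {0..T}" for t
    unfolding c'_def using u that by (intro sine_coefficient_derivative) auto
  show "(c has_real_derivative c' t) (at t within {0..T})" if "t \<in> {0..T}" for t
    unfolding c_def c'_def using u that by (intro sine_coefficient_derivative) auto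
  show "continuous_on {0..T} c'"
    by (rule DERIV_continuous_on) (rule c')
  fix t assume t: "t \<in> {0<..<T}"
  then have t': "t \<in> {0..T}" by auto
  have xx: "((\<lambda>x. Dx (Dx u) x t * sin (real n * x)) has_integral - (real n)\<^sup>2 * c t) {0..pi}"
    unfolding c_def
    by (rule sine_coefficient_Dxx[where g' = "\<lambda>x. Dx u x t"])
       (use u t' bc[OF t'] in \<open>auto intro!: has_derivative_Dx\<close>)
  have tt: "((\<lambda>x. Dt T (Dt T u) x t * sin (real n * x)) has_integral
              integral {0..pi} (\<lambda>x. Dt T (Dt T u) x t * sin (real n * x))) {0..pi}"
    using u t' by (intro integrable_integral integrable_continuous_interval continuous_on_mult
        continuous_on_slice_x[of T "Dt T (Dt T u)"]) (auto intro!: continuous_intros)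
  have "integral {0..pi} (\<lambda>x. f x t * sin (real n * x)) =
        integral {0..pi} (\<lambda>x. Dt T (Dt T u) x t * sin (real n * x) - Dx (Dx u) x t * sin (real n * x))"
    by (rule integral_spike[of "{0, pi}"]) (use eq[OF _ t] in \<open>auto simp flip: left_diff_distrib\<close>)
  also have "\<dots> = integral {0..pi} (\<lambda>x. Dt T (Dt T u) x t * sin (real n * x)) + (real n)\<^sup>2 * c t"
    using integral_unique[OF has_integral_diff[OF tt xx]] by simp
  finally have "integral {0..pi} (\<lambda>x. Dt T (Dt T u) x t * sin (real n * x)) =
     - (real n)\<^sup>2 * c t + integral {0..pi} (\<lambda>x. f x t * sin (real n * x))" by simp
  moreover have "at t within {0..T} = at t"
    using t by (intro at_within_interior) (simp add: interior_atLeastAtMost_real)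
  ultimately show "(c' has_real_derivative
             - (real n)\<^sup>2 * c t + integral {0..pi} (\<lambda>x. f x t * sin (real n * x))) (at t)"
    using c'[OF t'] by simp
qed

text \<open>
  The energy \<open>d'\<^sup>2 + n\<^sup>2 d\<^sup>2\<close> is conserved.
\<close>

lemma harmonic_oscillator_zero:
  fixes d d' :: "real \<Rightarrow> real"
  assumes d: "\<And>t. t \<in> {0..T} \<Longrightarrow> (d has_real_derivative d' t) (at t within {0..T})"
    and d'c: "continuous_on {0..T} d'"
    and d': "\<And>t. t \<in> {0<..<T} \<Longrightarrow> (d' has_real_derivative - n\<^sup>2 * d t) (at t)"
    and init: "d 0 = 0" "d' 0 = 0" and "n \<noteq> 0" and t: "t \<in> {0..T}"
  shows "d t = 0"
proof (cases "t = 0")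
  case False
  then have t0: "0 < t" "t \<le> T" using t by auto
  define E where "E t = (d' t)\<^sup>2 + n\<^sup>2 * (d t)\<^sup>2" for t
  have dc: "continuous_on {0..T} d"
    by (rule DERIV_continuous_on) (rule d)
  have Ec: "continuous_on {0..t} E"
    unfolding E_def using t0
    by (intro continuous_intros continuous_on_subset[OF dc] continuous_on_subset[OF d'c]) auto
  have "(E has_real_derivative 0) (at s)" if "0 < s" "s < t" for s
  proof -
    have s: "s \<in> {0<..<T}" "s \<in> {0..T}" using that t0 by auto
    have "at s within {0..T} = at s"
      using s by (intro at_within_interior) (simp add: interior_atLeastAtMost_real)
    then have "(d has_real_derivative d' s) (at s)"
      using d[OF s(2)] by simp
    then show ?thesis
      unfolding E_def
      by (auto intro!: derivative_eq_intros d'[OF s(1)] simp: algebra_simps power2_eq_square)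
  qed
  then have "E t = E 0"
    using DERIV_isconst_end[OF t0(1) Ec] by blast
  then have "(d' t)\<^sup>2 + n\<^sup>2 * (d t)\<^sup>2 = 0"
    by (simp add: E_def init)
  then have "n\<^sup>2 * (d t)\<^sup>2 = 0"
    by (metis add_nonneg_eq_0_iff mult_nonneg_nonneg zero_le_power2)
  then show ?thesis using \<open>n \<noteq> 0\<close> by simp
qed (simp add: init)

lemma wave_solution_unique:
  assumes u: "is_wave_solution T u0 u1 f u" and v: "is_wave_solution T u0 u1 f v"
    and x: "x \<in> {0..pi}" and t: "t \<in> {0..T}"
  shows "u x t = v x t"
proof (cases "x = 0 \<or> x = pi")
  case True
  then show ?thesis using u v t by (auto simp: is_wave_solution_def)
next
  case False
  define w where "w x = u x t - v x t" for x
  have cont: "continuous_on {0..pi} (\<lambda>x. h x s)" "continuous_on {0..pi} (\<lambda>x. Dt T h x s)"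
    if "is_wave_solution T u0 u1 f h" "s \<in> {0..T}" for h s
    using that continuous_on_slice_x[of T h s] continuous_on_slice_x[of T "Dt T h" s]
    by (simp_all add: is_wave_solution_def numeral_2_eq_2)
  have "sine_orthogonal w"
    unfolding sine_orthogonal_def
  proof (intro conjI allI)
    show "continuous_on {0..pi} w"
      unfolding w_def by (intro continuous_intros cont u v t)
    fix n :: nat
    let ?c = "\<lambda>h t. integral {0..pi} (\<lambda>x. h x t * sin (real n * x))"
    have T: "0 \<in> {0..T}" using t by auto
    have "integral {0..pi} (\<lambda>x. w x * sin (real n * x)) = ?c u t - ?c v t"
      unfolding w_def left_diff_distrib
      by (intro integral_diff integrable_continuous_interval continuous_intros cont u v t)
    also have "\<dots> = 0"
    proof (cases "n = 0")
      case False
      show ?thesis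
      proof (rule harmonic_oscillator_zero[where n = "real n" and T = T
            and d' = "\<lambda>t. ?c (Dt T u) t - ?c (Dt T v) t" and d = "\<lambda>t. ?c u t - ?c v t"])
        show "continuous_on {0..T} (\<lambda>t. ?c (Dt T u) t - ?c (Dt T v) t)"
          by (intro continuous_intros wave_solution_sine_coefficient(2)[OF u]
              wave_solution_sine_coefficient(2)[OF v])
        show "((\<lambda>t. ?c u t - ?c v t) has_real_derivative (?c (Dt T u) s - ?c (Dt T v) s)) (at s within {0..T})"
          if "s \<in> {0..T}" for s
          using that by (intro DERIV_diff wave_solution_sine_coefficient(1)[OF u]
              wave_solution_sine_coefficient(1)[OF v])
        show "((\<lambda>t. ?c (Dt T u) t - ?c (Dt T v) t) has_real_derivative - (real n)\<^sup>2 * (?c u s - ?c v s)) (at s)"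
          if "s \<in> {0<..<T}" for s
          using DERIV_diff[OF wave_solution_sine_coefficient(3)[OF u that, of n]
              wave_solution_sine_coefficient(3)[OF v that, of n]]
          by (simp add: algebra_simps)
        have same: "u x 0 = v x 0" "Dt T u x 0 = Dt T v x 0" if "x \<in> {0..pi}" for x
          using u v that by (simp_all add: is_wave_solution_def)
        have "?c u 0 = ?c v 0"
          by (rule integral_cong) (simp add: same)
        then show "?c u 0 - ?c v 0 = 0" by simp
        have "?c (Dt T u) 0 = ?c (Dt T v) 0"
          by (rule integral_cong) (simp add: same)
        then show "?c (Dt T u) 0 - ?c (Dt T v) 0 = 0" by simp
      qed (use False t in auto)
    qed simp
    finally show "integral {0..pi} (\<lambda>x. w x * sin (real n * x)) = 0" .
  qed
  then have "w x = 0"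
    using False x by (intro sine_orthogonal_eq_0) auto
  then show ?thesis by (simp add: w_def)
qed

section \<open>Hoelder norms of trigonometric modes\<close>

text \<open>
  The derivatives on the closed interval only see the values there, so a function is only required
  to agree with the mode on the interval; this makes the formulas for iterated derivatives
  provable by induction.
\<close>

lemma Dx1_sine:
  assumes g: "\<And>y. y \<in> {0..pi} \<Longrightarrow> g y = A * sin (k * y + \<phi>)" and x: "x \<in> {0..pi}"
  shows "(g has_vector_derivative k * A * sin (k * x + (\<phi> + pi / 2))) (at x within {0..pi})"
    and "Dx1 g x = k * A * sin (k * x + (\<phi> + pi / 2))"
proof -
  have "((\<lambda>y. A * sin (k * y + \<phi>)) has_real_derivative k * A * cos (k * x + \<phi>)) (at x within {0..pi})"
    by (auto intro!: derivative_eq_intros)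
  moreover have "cos (k * x + \<phi>) = sin (k * x + (\<phi> + pi / 2))"
    by (simp add: sin_add flip: add.assoc)
  ultimately have "((\<lambda>y. A * sin (k * y + \<phi>)) has_vector_derivative k * A * sin (k * x + (\<phi> + pi / 2)))
      (at x within {0..pi})"
    by (simp add: has_real_derivative_iff_has_vector_derivative)
  then show *: "(g has_vector_derivative k * A * sin (k * x + (\<phi> + pi / 2))) (at x within {0..pi})"
    by (rule has_vector_derivative_transform[OF x, rotated]) (simp add: g)
  show "Dx1 g x = k * A * sin (k * x + (\<phi> + pi / 2))"
    unfolding Dx1_def by (rule vector_derivative_within_closed_interval[OF pi_gt_zero x *])
qed

lemma Dx1_iterate_sine:
  assumes "x \<in> {0..pi}"
  shows "(Dx1 ^^ n) (\<lambda>x. sin (k * x)) x = k ^ n * sin (k * x + real n * (pi / 2))"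
  using assms
proof (induction n arbitrary: x)
  case (Suc n)
  have "Dx1 ((Dx1 ^^ n) (\<lambda>x. sin (k * x))) x = k * k ^ n * sin (k * x + (real n * (pi / 2) + pi / 2))"
    by (rule Dx1_sine(2)) (use Suc in auto)
  then show ?case by (simp add: algebra_simps add_divide_distrib)
qed simp

lemma cont_diff_I_sine:
  assumes "\<And>y. y \<in> {0..pi} \<Longrightarrow> g y = A * sin (k * y + \<phi>)"
  shows "cont_diff_I n g"
  using assms
proof (induction n arbitrary: g A \<phi>)
  case 0
  have "continuous_on {0..pi} (\<lambda>y. A * sin (k * y + \<phi>))"
    by (intro continuous_intros)
  then show ?case
    by (simp, subst continuous_on_cong[OF refl, where g = "\<lambda>y. A * sin (k * y + \<phi>)"]) (use 0 in auto)
next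
  case (Suc n)
  have "g differentiable_on {0..pi}"
    unfolding differentiable_on_def
    using Dx1_sine(1)[OF Suc.prems] differentiableI_vector by blast
  then show ?case
    using Suc.IH[of "Dx1 g" "k * A" "\<phi> + pi / 2"] Dx1_sine(2)[OF Suc.prems] by simp
qed

lemma sup_norm_le:
  assumes "\<And>p. p \<in> S \<Longrightarrow> \<bar>g p\<bar> \<le> A"
  shows "sup_norm S g \<le> ennreal A"
  unfolding sup_norm_def using assms by (intro SUP_least ennreal_leI)

text \<open>
  Interpolation between the sup bound (for distances above \<open>1 / K\<close>) and the Lipschitz bound (below).
  Applied to \<open>n\<close>-th derivatives of modes with \<open>A = k^n\<close>, \<open>K\<close> of size \<open>k\<close>, it gives \<open>k^(n + \<alpha>)\<close>.
\<close>

lemma holder_seminorm_le: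
  fixes g :: "'a::metric_space \<Rightarrow> real"
  assumes \<alpha>: "0 \<le> \<alpha>" "\<alpha> \<le> 1" and "0 < K" and "0 \<le> A"
    and bound: "\<And>p. p \<in> S \<Longrightarrow> \<bar>g p\<bar> \<le> A"
    and lip: "\<And>p q. p \<in> S \<Longrightarrow> q \<in> S \<Longrightarrow> \<bar>g p - g q\<bar> \<le> A * (K * dist p q)"
  shows "holder_seminorm \<alpha> S g \<le> ennreal (2 * A * K powr \<alpha>)"
  unfolding holder_seminorm_def
proof (intro SUP_least, clarify)
  fix p q assume pq: "p \<in> S" "q \<in> S" "p \<noteq> q"
  define y where "y = K * dist p q"
  have y: "0 < y" using pq \<open>0 < K\<close> by (simp add: y_def)
  have "\<bar>g p - g q\<bar> \<le> 2 * A * y powr \<alpha>"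
  proof (cases "y \<le> 1")
    case True
    have "y powr 1 \<le> y powr \<alpha>"
      using True y \<alpha> by (intro powr_mono') auto
    then have "A * y \<le> A * y powr \<alpha>" using y \<open>0 \<le> A\<close> by (intro mult_left_mono) auto
    moreover have "\<bar>g p - g q\<bar> \<le> A * y" using lip[OF pq(1,2)] by (simp add: y_def)
    moreover have "0 \<le> A * y powr \<alpha>" using \<open>0 \<le> A\<close> by simp
    ultimately show ?thesis by linarith
  next
    case False
    then have "1 \<le> y powr \<alpha>" using \<alpha> by (intro ge_one_powr_ge_zero) auto
    then have "2 * A * 1 \<le> 2 * A * y powr \<alpha>" using \<open>0 \<le> A\<close> by (intro mult_left_mono) auto
    moreover have "\<bar>g p - g q\<bar> \<le> 2 * A" using bound[OF pq(1)] bound[OF pq(2)] by linarith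
    ultimately show ?thesis by linarith
  qed
  also have "\<dots> = 2 * A * K powr \<alpha> * dist p q powr \<alpha>"
    using \<open>0 < K\<close> by (simp add: y_def powr_mult)
  finally show "ennreal (\<bar>g p - g q\<bar> / dist p q powr \<alpha>) \<le> ennreal (2 * A * K powr \<alpha>)"
    using pq by (intro ennreal_leI) (simp add: divide_le_eq)
qed

lemma abs_sin_diff_le: "\<bar>sin a - sin b\<bar> \<le> \<bar>a - b\<bar>" for a b :: real
proof -
  have "\<bar>sin a - sin b\<bar> = 2 * \<bar>sin ((a - b) / 2)\<bar> * \<bar>cos ((a + b) / 2)\<bar>"
    by (simp add: sin_diff_sin abs_mult)
  also have "\<dots> \<le> 2 * \<bar>(a - b) / 2\<bar> * 1"
    by (intro mult_mono abs_sin_x_le_abs_x abs_cos_le_one mult_nonneg_nonneg) auto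
  finally show ?thesis by simp
qed

lemma power_int_part_le_powr:
  assumes "0 \<le> r" "1 \<le> k" "i \<le> int_part r"
  shows "k ^ i \<le> k powr r"
proof -
  have "real i \<le> r" using assms(1,3) by linarith
  then have "k powr real i \<le> k powr r" using assms by (intro powr_mono) auto
  then show ?thesis using assms by (simp add: powr_realpow)
qed

lemma power_int_part_powr_frac:
  assumes "0 \<le> r" "1 \<le> k"
  shows "k ^ int_part r * k powr frac r = k powr r"
proof -
  have "real (int_part r) + frac r = r" using assms(1) by (simp add: frac_def)
  then show ?thesis using assms by (simp flip: powr_realpow powr_add)
qed

lemma sin_nat_pi_boundary:
  assumes "x \<in> {0, pi}"
  shows "sin (real k * x + real (2 * j) * (pi / 2)) = 0"
proof -
  have "sin (real k * pi + real j * pi) = 0"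
    using sin_npi[of "k + j"] by (simp add: algebra_simps)
  then show ?thesis using assms by auto
qed

lemma holder0_norm_I_sine_le:
  assumes k: "1 \<le> k" and r: "0 \<le> r" "r \<le> 6"
  shows "holder0_norm_I r (\<lambda>x. sin (real k * x)) \<le> ennreal (9 * real k powr r)"
proof -
  let ?w = "\<lambda>x. sin (real k * x)" and ?n = "int_part r"
  have k1: "1 \<le> real k" using k by simp
  have n: "?n \<le> 6" using r by linarith
  have bound: "\<bar>(Dx1 ^^ j) ?w x\<bar> \<le> real k ^ j" if "x \<in> {0..pi}" for j x
    using that mult_left_mono[OF abs_sin_le_one, of "real k ^ j"]
    by (simp add: Dx1_iterate_sine abs_mult)
  have "holder_norm_I r ?w \<le> (\<Sum>j\<le>?n. ennreal (real k powr r)) + ennreal (2 * real k powr r)"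
    unfolding holder_norm_I_def
  proof (intro add_mono sum_mono)
    fix j assume j: "j \<in> {..?n}"
    have "real k ^ j \<le> real k powr r"
      using power_int_part_le_powr[OF r(1) k1, of j] j by simp
    then show "sup_norm {0..pi} ((Dx1 ^^ j) ?w) \<le> ennreal (real k powr r)"
      using bound by (intro sup_norm_le) (meson order_trans)
  next
    have "holder_seminorm (frac r) {0..pi} ((Dx1 ^^ ?n) ?w) \<le> ennreal (2 * real k ^ ?n * real k powr frac r)"
    proof (rule holder_seminorm_le)
      fix p q :: real assume pq: "p \<in> {0..pi}" "q \<in> {0..pi}"
      have "\<bar>(Dx1 ^^ ?n) ?w p - (Dx1 ^^ ?n) ?w q\<bar> =
            real k ^ ?n * \<bar>sin (real k * p + real ?n * (pi / 2)) - sin (real k * q + real ?n * (pi / 2))\<bar>"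
        using pq by (simp add: Dx1_iterate_sine abs_mult flip: right_diff_distrib)
      also have "\<dots> \<le> real k ^ ?n * \<bar>(real k * p + real ?n * (pi / 2)) - (real k * q + real ?n * (pi / 2))\<bar>"
        by (intro mult_left_mono abs_sin_diff_le) auto
      also have "\<dots> = real k ^ ?n * (real k * dist p q)"
        by (simp add: dist_real_def abs_mult flip: right_diff_distrib)
      finally show "\<bar>(Dx1 ^^ ?n) ?w p - (Dx1 ^^ ?n) ?w q\<bar> \<le> real k ^ ?n * (real k * dist p q)" .
    qed (use bound k1 in \<open>auto intro: frac_lt_1 less_imp_le\<close>)
    then show "(if frac r = 0 then 0 else holder_seminorm (frac r) {0..pi} ((Dx1 ^^ ?n) ?w))
        \<le> ennreal (2 * real k powr r)"
      using power_int_part_powr_frac[OF r(1) k1] by (simp add: mult.assoc)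
  qed
  also have "\<dots> = ennreal (real (Suc ?n) * real k powr r + 2 * real k powr r)"
    by (simp add: ennreal_plus ennreal_mult ennreal_of_nat_eq_real_of_nat del: of_nat_Suc)
  also have "\<dots> \<le> ennreal (9 * real k powr r)"
    using mult_right_mono[of "real (Suc ?n)" 7 "real k powr r"] n
    by (intro ennreal_leI) simp
  finally have le: "holder_norm_I r ?w \<le> ennreal (9 * real k powr r)" .
  have "?w \<in> holder0_space_I r"
    unfolding holder0_space_I_def holder_space_I_def mem_Collect_eq
  proof (intro conjI allI impI ballI)
    show "cont_diff_I ?n ?w"
      by (rule cont_diff_I_sine[of ?w 1 "real k" 0]) simp
    show "holder_norm_I r ?w < \<infinity>"
      using le by (simp add: order_le_less_trans)
    show "(Dx1 ^^ (2 * j)) ?w x = 0" if "x \<in> {0, pi}" for j x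
    proof -
      have "x \<in> {0..pi}" using that by auto
      then show ?thesis
        unfolding Dx1_iterate_sine[OF \<open>x \<in> {0..pi}\<close>] sin_nat_pi_boundary[OF that] by simp
    qed
  qed
  then show ?thesis using le by (simp add: holder0_norm_I_def)
qed

text \<open>
  Two time harmonics over the same space harmonic.  Phases are kept as parameters because
  differentiation shifts a phase by \<open>\<pi> / 2\<close>: the family is closed under both derivatives, and it
  contains the solutions for all three kinds of data.
\<close>

definition mode ::
  "real \<Rightarrow> real \<Rightarrow> real \<Rightarrow> real \<Rightarrow> real \<Rightarrow> real \<Rightarrow> real \<Rightarrow> real \<Rightarrow> real \<Rightarrow> real \<Rightarrow> real" where
  "mode k \<phi> B c \<psi> D d \<xi> = (\<lambda>x t. sin (k * x + \<phi>) * (B * sin (c * t + \<psi>) + D * sin (d * t + \<xi>)))"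

lemma Dx_mode:
  assumes g: "\<And>y. y \<in> {0..pi} \<Longrightarrow> g y t = mode k \<phi> B c \<psi> D d \<xi> y t" and x: "x \<in> {0..pi}"
  shows "((\<lambda>y. g y t) has_vector_derivative mode k (\<phi> + pi / 2) (k * B) c \<psi> (k * D) d \<xi> x t) (at x within {0..pi})"
    and "Dx g x t = mode k (\<phi> + pi / 2) (k * B) c \<psi> (k * D) d \<xi> x t"
proof -
  let ?A = "B * sin (c * t + \<psi>) + D * sin (d * t + \<xi>)"
  have eq: "k * ?A * sin (k * x + (\<phi> + pi / 2)) = mode k (\<phi> + pi / 2) (k * B) c \<psi> (k * D) d \<xi> x t"
    by (simp add: mode_def algebra_simps)
  have g': "g y t = ?A * sin (k * y + \<phi>)" if "y \<in> {0..pi}" for y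
    using g[OF that] by (simp add: mode_def)
  show "((\<lambda>y. g y t) has_vector_derivative mode k (\<phi> + pi / 2) (k * B) c \<psi> (k * D) d \<xi> x t) (at x within {0..pi})"
    using Dx1_sine(1)[of "\<lambda>y. g y t", OF g' x] unfolding eq by blast
  show "Dx g x t = mode k (\<phi> + pi / 2) (k * B) c \<psi> (k * D) d \<xi> x t"
    using Dx1_sine(2)[of "\<lambda>y. g y t", OF g' x] unfolding eq by (simp add: Dx1_def Dx_def)
qed

lemma Dt_mode:
  assumes g: "\<And>s. s \<in> {0..T} \<Longrightarrow> g x s = mode k \<phi> B c \<psi> D d \<xi> x s" and t: "t \<in> {0..T}" and "0 < T"
  shows "(g x has_vector_derivative mode k \<phi> (c * B) c (\<psi> + pi / 2) (d * D) d (\<xi> + pi / 2) x t) (at t within {0..T})"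
    and "Dt T g x t = mode k \<phi> (c * B) c (\<psi> + pi / 2) (d * D) d (\<xi> + pi / 2) x t"
proof -
  have shift: "cos z = sin (z + pi / 2)" for z by (simp add: sin_add)
  have "(mode k \<phi> B c \<psi> D d \<xi> x has_real_derivative
           sin (k * x + \<phi>) * (c * B * cos (c * t + \<psi>) + d * D * cos (d * t + \<xi>))) (at t within {0..T})"
    unfolding mode_def by (auto intro!: derivative_eq_intros)
  then have "(mode k \<phi> B c \<psi> D d \<xi> x has_vector_derivative
           mode k \<phi> (c * B) c (\<psi> + pi / 2) (d * D) d (\<xi> + pi / 2) x t) (at t within {0..T})"
    by (simp add: mode_def has_real_derivative_iff_has_vector_derivative shift add.assoc)
  then show *: "(g x has_vector_derivative mode k \<phi> (c * B) c (\<psi> + pi / 2) (d * D) d (\<xi> + pi / 2) x t) (at t within {0..T})"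
    by (rule has_vector_derivative_transform[OF t, rotated]) (simp add: g)
  show "Dt T g x t = mode k \<phi> (c * B) c (\<psi> + pi / 2) (d * D) d (\<xi> + pi / 2) x t"
    unfolding Dt_def by (rule vector_derivative_within_closed_interval[OF \<open>0 < T\<close> t *])
qed

lemma Dt_iterate_mode:
  assumes "t \<in> {0..T}" "0 < T"
  shows "(Dt T ^^ j) (mode k \<phi> B c \<psi> D d \<xi>) x t =
    mode k \<phi> (c ^ j * B) c (\<psi> + real j * (pi / 2)) (d ^ j * D) d (\<xi> + real j * (pi / 2)) x t"
  using assms(1)
proof (induction j arbitrary: t)
  case (Suc j)
  have "Dt T ((Dt T ^^ j) (mode k \<phi> B c \<psi> D d \<xi>)) x t =
    mode k \<phi> (c * (c ^ j * B)) c (\<psi> + real j * (pi / 2) + pi / 2) (d * (d ^ j * D)) d (\<xi> + real j * (pi / 2) + pi / 2) x t"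
    by (rule Dt_mode(2)) (use Suc assms in auto)
  then show ?case by (simp add: algebra_simps add_divide_distrib)
qed simp

lemma Dx_Dt_iterate_mode:
  assumes "x \<in> {0..pi}" "t \<in> {0..T}" "0 < T"
  shows "(Dx ^^ i) ((Dt T ^^ j) (mode k \<phi> B c \<psi> D d \<xi>)) x t =
    mode k (\<phi> + real i * (pi / 2)) (k ^ i * (c ^ j * B)) c (\<psi> + real j * (pi / 2))
      (k ^ i * (d ^ j * D)) d (\<xi> + real j * (pi / 2)) x t"
  using assms(1)
proof (induction i arbitrary: x)
  case 0
  then show ?case using Dt_iterate_mode[OF assms(2,3)] by simp
next
  case (Suc i)
  have "Dx ((Dx ^^ i) ((Dt T ^^ j) (mode k \<phi> B c \<psi> D d \<xi>))) x t =
    mode k (\<phi> + real i * (pi / 2) + pi / 2) (k * (k ^ i * (c ^ j * B))) c (\<psi> + real j * (pi / 2))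
      (k * (k ^ i * (d ^ j * D))) d (\<xi> + real j * (pi / 2)) x t"
    by (rule Dx_mode(2)) (use Suc in auto)
  then show ?case by (simp add: algebra_simps add_divide_distrib)
qed

lemma cont_diff_Q_mode:
  assumes "0 < T" and "\<And>x t. x \<in> {0..pi} \<Longrightarrow> t \<in> {0..T} \<Longrightarrow> g x t = mode k \<phi> B c \<psi> D d \<xi> x t"
  shows "cont_diff_Q T n g"
  using assms(2)
proof (induction n arbitrary: g \<phi> B \<psi> D \<xi>)
  case (0 g \<phi> B \<psi> D \<xi>)
  have "continuous_on (QT T) (\<lambda>(x, t). mode k \<phi> B c \<psi> D d \<xi> x t)"
    unfolding mode_def case_prod_beta by (intro continuous_intros)
  then show ?case
    by (simp, subst continuous_on_cong[OF refl, where g = "\<lambda>(x, t). mode k \<phi> B c \<psi> D d \<xi> x t"])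
       (use 0 in auto)
next
  case (Suc n g \<phi> B \<psi> D \<xi>)
  have "continuous_on (QT T) (\<lambda>(x, t). mode k \<phi> B c \<psi> D d \<xi> x t)"
    unfolding mode_def case_prod_beta by (intro continuous_intros)
  then have "continuous_on (QT T) (\<lambda>(x, t). g x t)"
    by (subst continuous_on_cong[OF refl, where g = "\<lambda>(x, t). mode k \<phi> B c \<psi> D d \<xi> x t"])
       (use Suc.prems in auto)
  moreover have "(\<lambda>x. g x t) differentiable_on {0..pi}" if "t \<in> {0..T}" for t
    unfolding differentiable_on_def
    using Dx_mode(1)[of g t, OF Suc.prems[OF _ that]] differentiableI_vector by blast
  moreover have "g x differentiable_on {0..T}" if "x \<in> {0..pi}" for x
    unfolding differentiable_on_def
    using Dt_mode(1)[of T g x, OF Suc.prems[OF that] _ \<open>0 < T\<close>] differentiableI_vector by blast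
  moreover have "cont_diff_Q T n (Dx g)"
    by (rule Suc.IH, rule Dx_mode(2)) (use Suc.prems in auto)
  moreover have "cont_diff_Q T n (Dt T g)"
    by (rule Suc.IH, rule Dt_mode(2)) (use Suc.prems \<open>0 < T\<close> in auto)
  ultimately show ?case by simp
qed

lemma holder0_norm_Q_sine_le:
  assumes k: "2 \<le> k" and r: "0 \<le> r" "r \<le> 6" and T: "0 < T"
  shows "holder0_norm_Q T r (\<lambda>x t. sin (real k * x) * sin (real (k - 1) * t)) \<le> ennreal (245 * real k powr r)"
proof -
  define c where "c = real (k - 1)"
  define f where "f = (\<lambda>x t. sin (real k * x) * sin (c * t))"
  let ?n = "int_part r"
  have k1: "1 \<le> real k" "0 \<le> c" "c \<le> real k" using k by (auto simp: c_def)
  have n: "?n \<le> 6" using r by linarith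
  have f: "f = mode (real k) 0 1 c 0 0 0 0"
    by (auto simp: f_def mode_def)
  have D: "(Dx ^^ i) ((Dt T ^^ j) f) x t =
      real k ^ i * c ^ j * (sin (real k * x + real i * (pi / 2)) * sin (c * t + real j * (pi / 2)))"
    if "x \<in> {0..pi}" "t \<in> {0..T}" for i j x t
    unfolding f Dx_Dt_iterate_mode[OF that T] by (simp add: mode_def)
  have coef: "0 \<le> real k ^ i * c ^ j" "real k ^ i * c ^ j \<le> real k ^ (i + j)" for i j
    using k1 by (auto simp: power_add intro!: mult_left_mono power_mono)
  have coef_mult: "real k ^ i * c ^ j * y \<le> real k ^ (i + j) * z" if "0 \<le> y" "y \<le> z" for i j y z
    using coef that k1 by (intro mult_mono) auto
  have ss: "\<bar>sin a * sin b\<bar> \<le> 1" for a b :: real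
    using mult_mono[OF abs_sin_le_one[of a] abs_sin_le_one[of b]] by (simp add: abs_mult)
  have bound: "\<bar>(Dx ^^ i) ((Dt T ^^ j) f) x t\<bar> \<le> real k ^ (i + j)" if "x \<in> {0..pi}" "t \<in> {0..T}" for i j x t
    using coef_mult[OF _ ss, of _ _ i j] coef[of i j] unfolding D[OF that] by (subst abs_mult) simp
  have lip: "\<bar>(Dx ^^ i) ((Dt T ^^ j) f) x t - (Dx ^^ i) ((Dt T ^^ j) f) y s\<bar>
      \<le> real k ^ (i + j) * (2 * real k * dist (x, t) (y, s))"
    if "x \<in> {0..pi}" "t \<in> {0..T}" "y \<in> {0..pi}" "s \<in> {0..T}" for i j x t y s
  proof -
    define a b a' b' where ab: "a = real k * x + real i * (pi / 2)" "b = c * t + real j * (pi / 2)"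
      "a' = real k * y + real i * (pi / 2)" "b' = c * s + real j * (pi / 2)"
    have d: "\<bar>x - y\<bar> \<le> dist (x, t) (y, s)" "\<bar>t - s\<bar> \<le> dist (x, t) (y, s)"
      using dist_fst_le[of "(x, t)" "(y, s)"] dist_snd_le[of "(x, t)" "(y, s)"] by (auto simp: dist_real_def)
    have "\<bar>sin a * sin b - sin a' * sin b'\<bar> = \<bar>(sin a - sin a') * sin b + sin a' * (sin b - sin b')\<bar>"
      by (simp add: algebra_simps)
    also have "\<dots> \<le> \<bar>sin a - sin a'\<bar> * \<bar>sin b\<bar> + \<bar>sin a'\<bar> * \<bar>sin b - sin b'\<bar>"
      by (rule order_trans[OF abs_triangle_ineq]) (simp add: abs_mult)
    also have "\<dots> \<le> \<bar>a - a'\<bar> * 1 + 1 * \<bar>b - b'\<bar>"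
      by (intro add_mono mult_mono abs_sin_diff_le abs_sin_le_one) auto
    also have "\<dots> = real k * \<bar>x - y\<bar> + c * \<bar>t - s\<bar>"
      using k1 by (simp add: ab abs_mult flip: right_diff_distrib)
    also have "\<dots> \<le> real k * dist (x, t) (y, s) + real k * dist (x, t) (y, s)"
      using k1 d by (intro add_mono mult_mono) auto
    finally have "\<bar>sin a * sin b - sin a' * sin b'\<bar> \<le> 2 * real k * dist (x, t) (y, s)" by simp
    then show ?thesis
      using coef[of i j] coef_mult[of "\<bar>sin a * sin b - sin a' * sin b'\<bar>" _ i j]
      unfolding D[OF that(1,2)] D[OF that(3,4)] ab[symmetric] right_diff_distrib[symmetric]
      by (subst abs_mult) simp
  qed
  define I where "I = {(i, j). i + j \<le> ?n}"
  define J where "J = {(i, j). i + j = ?n}"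
  have IJ: "I \<subseteq> {..?n} \<times> {..?n}" "J \<subseteq> {..?n} \<times> {..?n}" by (auto simp: I_def J_def)
  have fin: "finite I" "finite J" by (auto intro: finite_subset[OF IJ(1)] finite_subset[OF IJ(2)])
  have c49: "card ({..?n} \<times> {..?n}) \<le> 49"
    using mult_mono[of "Suc ?n" 7 "Suc ?n" 7] n by simp
  have cI: "card I \<le> 49" and cJ: "card J \<le> 49"
    using card_mono[OF _ IJ(1)] card_mono[OF _ IJ(2)] c49 by auto
  have "holder_norm_Q T r f \<le> (\<Sum>p\<in>I. ennreal (real k powr r)) + (\<Sum>p\<in>J. ennreal (4 * real k powr r))"
    unfolding holder_norm_Q_def I_def[symmetric] J_def[symmetric]
  proof (intro add_mono sum_mono)
    fix p assume "p \<in> I"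
    then obtain i j where p: "p = (i, j)" "i + j \<le> ?n" by (auto simp: I_def)
    have "\<bar>(Dx ^^ i) ((Dt T ^^ j) f) x t\<bar> \<le> real k powr r" if "x \<in> {0..pi}" "t \<in> {0..T}" for x t
      using bound[OF that, of i j] power_int_part_le_powr[OF r(1) k1(1) p(2)] by linarith
    then show "(case p of (i, j) \<Rightarrow> sup_norm (QT T) (\<lambda>(x, t). (Dx ^^ i) ((Dt T ^^ j) f) x t))
        \<le> ennreal (real k powr r)"
      unfolding p prod.case by (intro sup_norm_le) auto
  next
    have *: "holder_seminorm (frac r) (QT T) (\<lambda>(x, t). (Dx ^^ i) ((Dt T ^^ j) f) x t)
        \<le> ennreal (4 * real k powr r)" if "i + j = ?n" for i j
    proof -
      have "holder_seminorm (frac r) (QT T) (\<lambda>(x, t). (Dx ^^ i) ((Dt T ^^ j) f) x t)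
          \<le> ennreal (2 * real k ^ (i + j) * (2 * real k) powr frac r)"
        by (rule holder_seminorm_le)
           (use bound lip k1 frac_lt_1[of r] in auto)
      also have "2 * real k ^ (i + j) * (2 * real k) powr frac r = 2 powr frac r * 2 * real k powr r"
        using k1 power_int_part_powr_frac[OF r(1) k1(1)] by (simp add: that powr_mult mult_ac)
      also have "ennreal \<dots> \<le> ennreal (4 * real k powr r)"
        using powr_mono[of "frac r" 1 "2::real"] frac_lt_1[of r]
        by (intro ennreal_leI mult_right_mono) auto
      finally show ?thesis .
    qed
    have "(\<Sum>(i, j)\<in>J. holder_seminorm (frac r) (QT T) (\<lambda>(x, t). (Dx ^^ i) ((Dt T ^^ j) f) x t))
        \<le> (\<Sum>p\<in>J. ennreal (4 * real k powr r))"
    proof (rule sum_mono, clarify)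
      fix i j assume "(i, j) \<in> J"
      then show "holder_seminorm (frac r) (QT T) (\<lambda>(x, t). (Dx ^^ i) ((Dt T ^^ j) f) x t)
        \<le> ennreal (4 * real k powr r)"
        by (intro *) (simp add: J_def)
    qed
    then show "(if frac r = 0 then 0
           else \<Sum>(i, j)\<in>J. holder_seminorm (frac r) (QT T) (\<lambda>(x, t). (Dx ^^ i) ((Dt T ^^ j) f) x t))
        \<le> (\<Sum>p\<in>J. ennreal (4 * real k powr r))"
      by simp
  qed
  also have "\<dots> = ennreal (real (card I) * real k powr r + real (card J) * (4 * real k powr r))"
    by (simp add: ennreal_plus ennreal_mult ennreal_of_nat_eq_real_of_nat)
  also have "\<dots> \<le> ennreal (245 * real k powr r)"
    using mult_right_mono[of "real (card I)" 49 "real k powr r"] cI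
      mult_right_mono[of "real (card J)" 49 "4 * real k powr r"] cJ
    by (intro ennreal_leI) simp
  finally have le: "holder_norm_Q T r f \<le> ennreal (245 * real k powr r)" .
  have "f \<in> holder0_space_Q T r"
    unfolding holder0_space_Q_def holder_space_Q_def mem_Collect_eq
  proof (intro conjI allI impI ballI)
    show "cont_diff_Q T ?n f"
      by (rule cont_diff_Q_mode[OF T]) (simp add: f)
    show "holder_norm_Q T r f < \<infinity>"
      using le by (simp add: order_le_less_trans)
    show "(Dx ^^ (2 * j)) f x t = 0" if "x \<in> {0, pi}" "t \<in> {0..T}" for j x t
    proof -
      have "x \<in> {0..pi}" using that by auto
      from D[OF this that(2), of "2 * j" 0] sin_nat_pi_boundary[OF that(1), of k j]
      show ?thesis by (simp del: of_nat_mult times_divide_eq_right)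
    qed
    show "(Dt T ^^ (2 * j)) f x 0 = 0" if "x \<in> {0..pi}" for j x
      using D[OF that, of 0 0 "2 * j"] sin_nat_pi_boundary[of 0 0 j] T
      by (simp del: of_nat_mult times_divide_eq_right)
  qed
  then show ?thesis using le by (simp add: holder0_norm_Q_def f_def c_def)
qed

section \<open>Exact solutions\<close>

lemma is_wave_solution_mode:
  fixes k :: nat
  assumes T: "0 < T"
  shows "is_wave_solution T
    (\<lambda>x. sin (real k * x) * (B * sin \<psi> + D * sin \<xi>))
    (\<lambda>x. sin (real k * x) * (c * B * cos \<psi> + d * D * cos \<xi>))
    (\<lambda>x t. sin (real k * x) * (((real k)\<^sup>2 - c\<^sup>2) * B * sin (c * t + \<psi>) + ((real k)\<^sup>2 - d\<^sup>2) * D * sin (d * t + \<xi>)))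
    (mode (real k) 0 B c \<psi> D d \<xi>)"
  unfolding is_wave_solution_def
proof (intro conjI ballI)
  show "cont_diff_Q T 2 (mode (real k) 0 B c \<psi> D d \<xi>)"
    by (rule cont_diff_Q_mode[OF T]) simp
  have shift: "sin (z + pi / 2) = cos z" "sin (z + pi) = - sin z" for z :: real by (simp_all add: sin_add)
  show "mode (real k) 0 B c \<psi> D d \<xi> x t = 0" if "x \<in> {0, pi}" for x t
    using that by (auto simp: mode_def)
  show "mode (real k) 0 B c \<psi> D d \<xi> x 0 = sin (real k * x) * (B * sin \<psi> + D * sin \<xi>)" for x
    by (simp add: mode_def)
  show "Dt T (mode (real k) 0 B c \<psi> D d \<xi>) x 0 = sin (real k * x) * (c * B * cos \<psi> + d * D * cos \<xi>)" for x
    using Dt_iterate_mode[of 0 T 1 "real k" 0 B c \<psi> D d \<xi> x] T by (simp add: mode_def shift)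
  fix x t assume "x \<in> {0<..<pi}" "t \<in> {0<..<T}"
  then show "(Dt T ^^ 2) (mode (real k) 0 B c \<psi> D d \<xi>) x t - (Dx ^^ 2) (mode (real k) 0 B c \<psi> D d \<xi>) x t =
    sin (real k * x) * (((real k)\<^sup>2 - c\<^sup>2) * B * sin (c * t + \<psi>) + ((real k)\<^sup>2 - d\<^sup>2) * D * sin (d * t + \<xi>))"
    using Dx_Dt_iterate_mode[of x t T 0 2 "real k" 0 B c \<psi> D d \<xi>]
      Dx_Dt_iterate_mode[of x t T 2 0 "real k" 0 B c \<psi> D d \<xi>] T
    by (simp add: mode_def shift flip: add.assoc) (simp add: algebra_simps)
qed

lemma wave_solution_eqI:
  assumes "is_wave_solution T u0 u1 f u" "x \<in> {0..pi}" "t \<in> {0..T}"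
  shows "wave_solution T u0 u1 f x t = u x t"
  unfolding wave_solution_def by (rule wave_solution_unique[OF someI[of "is_wave_solution T u0 u1 f"] assms]) (rule assms(1))

lemma wave_solution_initial_value:
  assumes "0 < T" "x \<in> {0..pi}" "t \<in> {0..T}"
  shows "wave_solution T (\<lambda>x. sin (real k * x)) (\<lambda>x. 0) (\<lambda>x t. 0) x t = sin (real k * x) * cos (real k * t)"
proof -
  have "is_wave_solution T (\<lambda>x. sin (real k * x)) (\<lambda>x. 0) (\<lambda>x t. 0) (mode (real k) 0 1 (real k) (pi / 2) 0 0 0)"
    using is_wave_solution_mode[OF assms(1), of k 1 "pi / 2" 0 0 "real k" 0] by simp
  from wave_solution_eqI[OF this assms(2,3)] show ?thesis
    by (simp add: mode_def sin_add)
qed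

lemma wave_solution_initial_velocity:
  assumes "0 < T" "x \<in> {0..pi}" "t \<in> {0..T}" "1 \<le> k"
  shows "wave_solution T (\<lambda>x. 0) (\<lambda>x. sin (real k * x)) (\<lambda>x t. 0) x t = sin (real k * x) * (sin (real k * t) / real k)"
proof -
  have "is_wave_solution T (\<lambda>x. 0) (\<lambda>x. sin (real k * x)) (\<lambda>x t. 0) (mode (real k) 0 (1 / real k) (real k) 0 0 0 0)"
    using is_wave_solution_mode[OF assms(1), of k "1 / real k" 0 0 0 "real k" 0] assms(4) by simp
  from wave_solution_eqI[OF this assms(2,3)] show ?thesis
    by (simp add: mode_def)
qed

lemma wave_solution_forcing:
  assumes "0 < T" "x \<in> {0..pi}" "t \<in> {0..T}" "2 \<le> k"
  shows "wave_solution T (\<lambda>x. 0) (\<lambda>x. 0) (\<lambda>x t. sin (real k * x) * sin (real (k - 1) * t)) x t =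
    sin (real k * x) * ((sin (real (k - 1) * t) - real (k - 1) / real k * sin (real k * t)) / (2 * real k - 1))"
proof -
  define c where "c = real (k - 1)"
  have c: "(real k)\<^sup>2 - c\<^sup>2 = 2 * real k - 1" "2 * real k - 1 \<noteq> 0"
    using assms(4) by (simp_all add: c_def of_nat_diff power2_eq_square algebra_simps)
  have "is_wave_solution T (\<lambda>x. 0) (\<lambda>x. 0) (\<lambda>x t. sin (real k * x) * sin (c * t))
      (mode (real k) 0 (1 / (2 * real k - 1)) c 0 (- (c / real k / (2 * real k - 1))) (real k) 0)"
    using is_wave_solution_mode[OF assms(1), of k "1 / (2 * real k - 1)" 0 "- (c / real k / (2 * real k - 1))" 0 c "real k"]
      assms(4) c by simp
  from wave_solution_eqI[OF this assms(2,3)] show ?thesis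
    unfolding c_def[symmetric] by (simp add: mode_def diff_divide_distrib)
qed

section \<open>Solvability of the compact scheme\<close>

text \<open>
  Up to the factor \<open>12\<close> the diagonal entry is \<open>10 + 2 q\<close> and the two neighbours have weight
  \<open>1 - q\<close>, where \<open>q = \<tau>\<^sup>2 / h\<^sup>2 \<in> [0, 1]\<close>; strict diagonal dominance at a point of maximal modulus
  gives injectivity.
\<close>

lemma B_op_eq_0_imp_eq_0:
  assumes h: "0 < h" and \<tau>: "\<tau>\<^sup>2 \<le> h\<^sup>2" and bc: "w 0 = 0" "w N = 0"
    and eq: "\<And>i. i \<in> {1..<N} \<Longrightarrow> B_op h \<tau> w i = 0" and j: "j \<le> N"
  shows "w j = (0::real)"
proof -
  define m where "m = Max ((\<lambda>i. \<bar>w i\<bar>) ` {0..N})"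
  have le: "\<bar>w i\<bar> \<le> m" if "i \<le> N" for i
    unfolding m_def using that by (intro Max_ge) auto
  have "m \<in> (\<lambda>i. \<bar>w i\<bar>) ` {0..N}"
    unfolding m_def by (rule Max_in) auto
  then obtain i where i: "i \<le> N" "m = \<bar>w i\<bar>" by auto
  have "m = 0"
  proof (cases "i = 0 \<or> i = N")
    case False
    then have i': "i \<in> {1..<N}" using i by auto
    define q where "q = \<tau>\<^sup>2 / h\<^sup>2"
    have q: "0 \<le> q" "q \<le> 1" using \<tau> h by (auto simp: q_def)
    have "(1 - q) * (w (i - 1) + w (i + 1)) + (10 + 2 * q) * w i = 12 * B_op h \<tau> w i"
      using h by (simp add: B_op_def s_N_def Lambda_x_def q_def field_simps)
    then have *: "(10 + 2 * q) * w i = - ((1 - q) * (w (i - 1) + w (i + 1)))"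
      using eq[OF i'] by simp
    have "(10 + 2 * q) * m = \<bar>(10 + 2 * q) * w i\<bar>"
      using q by (simp add: i abs_mult)
    also have "\<dots> = (1 - q) * \<bar>w (i - 1) + w (i + 1)\<bar>"
      unfolding * using q by (simp add: abs_mult)
    also have "\<dots> \<le> 1 * (2 * m)"
    proof (intro mult_mono)
      have "i - 1 \<le> N" "i + 1 \<le> N" using i' by auto
      then show "\<bar>w (i - 1) + w (i + 1)\<bar> \<le> 2 * m"
        using le[of "i - 1"] le[of "i + 1"] by linarith
    qed (use q in auto)
    finally have "(8 + 2 * q) * m \<le> 0" by (simp add: algebra_simps)
    moreover have "0 \<le> m" using i by simp
    ultimately show "m = 0" using q by (smt (verit) mult_pos_pos)
  qed (use i bc in auto)
  then show ?thesis using le[OF j] by simp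
qed

lemma B_op_diff: "B_op h \<tau> (\<lambda>i. v i - w i) i = B_op h \<tau> v i - B_op h \<tau> w i"
  by (simp add: B_op_def s_N_def Lambda_x_def diff_divide_distrib add_divide_distrib algebra_simps)

lemma Lambda_x_cong: "w i = v i \<Longrightarrow> w (i - 1) = v (i - 1) \<Longrightarrow> w (i + 1) = v (i + 1) \<Longrightarrow> Lambda_x h w i = Lambda_x h v i"
  by (simp add: Lambda_x_def)

lemma B_op_scale: "B_op h \<tau> (\<lambda>i. w i / c) i = B_op h \<tau> w i / c"
  by (simp only: B_op_def s_N_def Lambda_x_def divide_inverse) (simp only: algebra_simps)

text \<open>
  Each time level is determined by the previous two by inverting the implicit operator.
\<close>

lemma scheme_solution_unique:
  assumes v: "is_scheme_solution T N M u0 u1h f v" and w: "is_scheme_solution T N M u0 u1h f w"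
    and mesh: "0 < N" "0 < M" "0 < T" "(T / real M)\<^sup>2 \<le> (pi / real N)\<^sup>2"
    and i: "i \<le> N" and m: "m \<le> M"
  shows "v i m = w i m"
proof -
  define h \<tau> where "h = pi / real N" and "\<tau> = T / real M"
  have h: "0 < h" "0 < \<tau>" "\<tau>\<^sup>2 \<le> h\<^sup>2"
    using mesh by (auto simp: h_def \<tau>_def)
  note V = v[unfolded is_scheme_solution_def Let_def, folded h_def \<tau>_def]
  note W = w[unfolded is_scheme_solution_def Let_def, folded h_def \<tau>_def]
  have "\<forall>i\<le>N. v i m = w i m" using m
  proof (induction m rule: less_induct)
    case (less m)
    consider "m = 0" | "m = 1" | n where "m = n + 1" "1 \<le> n"
      by (metis Suc_eq_plus1 One_nat_def Suc_leI gr0_conv_Suc neq0_conv)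
    then show ?case
    proof cases
      case 1
      then show ?thesis using V W by auto
    next
      case 2
      have prev: "v i 0 = w i 0" if "i \<le> N" for i using less 2 that by auto
      have "v i 1 - w i 1 = 0" if "i \<le> N" for i
      proof (rule B_op_eq_0_imp_eq_0[where w = "\<lambda>i. v i 1 - w i 1", OF h(1,3) _ _ _ that])
        fix i assume i: "i \<in> {1..<N}"
        have "Lambda_x h (\<lambda>j. v j 0) i = Lambda_x h (\<lambda>j. w j 0) i"
          by (rule Lambda_x_cong) (use i prev in auto)
        moreover have "B_op h \<tau> (\<lambda>j. delta_t \<tau> (v j) 0) i - \<tau> / 2 * Lambda_x h (\<lambda>j. v j 0) i = u1h i + \<tau> / 2 * f_mesh h \<tau> f i 0"
          "B_op h \<tau> (\<lambda>j. delta_t \<tau> (w j) 0) i - \<tau> / 2 * Lambda_x h (\<lambda>j. w j 0) i = u1h i + \<tau> / 2 * f_mesh h \<tau> f i 0"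
          using V W i by blast+
        ultimately have "B_op h \<tau> (\<lambda>j. delta_t \<tau> (v j) 0 - delta_t \<tau> (w j) 0) i = 0"
          unfolding B_op_diff by simp
        also have "B_op h \<tau> (\<lambda>j. delta_t \<tau> (v j) 0 - delta_t \<tau> (w j) 0) i = B_op h \<tau> (\<lambda>j. (v j 1 - w j 1) / \<tau>) i"
        proof -
          have "i \<le> N" "i - 1 \<le> N" "i + 1 \<le> N" using i by auto
          then show ?thesis
            using prev[of i] prev[of "i - 1"] prev[of "i + 1"]
            by (simp add: B_op_def s_N_def Lambda_x_def delta_t_def diff_divide_distrib)
        qed
        finally show "B_op h \<tau> (\<lambda>i. v i 1 - w i 1) i = 0"
          unfolding B_op_scale using h by simp
      qed (use V W less.prems 2 in auto)
      then show ?thesis using 2 by simp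
    next
      case 3
      have prev: "v i n = w i n" "v i (n - 1) = w i (n - 1)" if "i \<le> N" for i using less 3 that by auto
      have "v i (n + 1) - w i (n + 1) = 0" if "i \<le> N" for i
      proof (rule B_op_eq_0_imp_eq_0[where w = "\<lambda>i. v i (n + 1) - w i (n + 1)", OF h(1,3) _ _ _ that])
        fix i assume i: "i \<in> {1..<N}"
        have n: "n \<in> {1..<M}" using less.prems 3 by auto
        have "Lambda_x h (\<lambda>j. v j n) i = Lambda_x h (\<lambda>j. w j n) i"
          by (rule Lambda_x_cong) (use i prev in auto)
        moreover have "B_op h \<tau> (\<lambda>j. Lambda_t \<tau> (v j) n) i - Lambda_x h (\<lambda>j. v j n) i = f_mesh h \<tau> f i n"
          "B_op h \<tau> (\<lambda>j. Lambda_t \<tau> (w j) n) i - Lambda_x h (\<lambda>j. w j n) i = f_mesh h \<tau> f i n"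
          using V W i n by blast+
        ultimately have "B_op h \<tau> (\<lambda>j. Lambda_t \<tau> (v j) n - Lambda_t \<tau> (w j) n) i = 0"
          unfolding B_op_diff by simp
        also have "B_op h \<tau> (\<lambda>j. Lambda_t \<tau> (v j) n - Lambda_t \<tau> (w j) n) i = B_op h \<tau> (\<lambda>j. (v j (n + 1) - w j (n + 1)) / \<tau>\<^sup>2) i"
        proof -
          have "i \<le> N" "i - 1 \<le> N" "i + 1 \<le> N" using i by auto
          then show ?thesis
            using prev[of i] prev[of "i - 1"] prev[of "i + 1"]
            by (simp add: B_op_def s_N_def Lambda_x_def Lambda_t_def diff_divide_distrib add_divide_distrib)
        qed
        finally show "B_op h \<tau> (\<lambda>i. v i (n + 1) - w i (n + 1)) i = 0"
          unfolding B_op_scale using h by simp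
      qed (use V W less.prems 3 in auto)
      then show ?thesis using 3 by simp
    qed
  qed
  then show ?thesis using i by blast
qed

lemma scheme_solution_eqI:
  assumes "is_scheme_solution T N M u0 u1h f v"
    and "0 < N" "0 < M" "0 < T" "(T / real M)\<^sup>2 \<le> (pi / real N)\<^sup>2" "i \<le> N" "m \<le> M"
  shows "scheme_solution T N M u0 u1h f i m = v i m"
  unfolding scheme_solution_def
  by (rule scheme_solution_unique[OF someI[of "is_scheme_solution T N M u0 u1h f"] assms]) (rule assms(1))

section \<open>Separation of variables in the scheme\<close>

text \<open>
  Eigenvalues on \<open>sin (k x)\<close> of \<open>- \<Lambda>\<^sub>x\<close>, of the implicit operator, and (for \<open>hat_symbol\<close> below, as
  a function of \<open>k h\<close> or of frequency times \<open>\<tau>\<close>) of averaging over a hat function.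
\<close>

definition lap_symbol :: "real \<Rightarrow> real \<Rightarrow> real" where
  "lap_symbol h k = (2 - 2 * cos (k * h)) / h\<^sup>2"

definition B_symbol :: "real \<Rightarrow> real \<Rightarrow> real \<Rightarrow> real" where
  "B_symbol h \<tau> k = 1 - (h\<^sup>2 - \<tau>\<^sup>2) / 12 * lap_symbol h k"

lemma divide_eq_neg_symbol:
  fixes x :: real
  assumes "x = - c * z"
  shows "x / d = - (c / d) * z"
  using assms by simp

lemma sine_neighbours:
  assumes "1 \<le> i"
  shows "sin (k * (real (i - 1) * h)) + sin (k * (real (i + 1) * h)) = 2 * cos (k * h) * sin (k * (real i * h))"
proof -
  have "k * (real (i - 1) * h) = k * (real i * h) - k * h" "k * (real (i + 1) * h) = k * (real i * h) + k * h"
    using assms by (simp_all add: of_nat_diff algebra_simps)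
  then show ?thesis by (simp add: sin_add sin_diff)
qed

lemma Lambda_x_sine:
  assumes "1 \<le> i" "0 < h"
  shows "Lambda_x h (\<lambda>j. sin (k * (real j * h)) * y) i = - lap_symbol h k * (sin (k * (real i * h)) * y)"
proof -
  let ?s = "\<lambda>j. sin (k * (real j * h))"
  have "?s (i - 1) * y - 2 * (?s i * y) + ?s (i + 1) * y = (?s (i - 1) + ?s (i + 1)) * y - 2 * (?s i * y)"
    by (simp add: algebra_simps)
  also have "\<dots> = - (2 - 2 * cos (k * h)) * (?s i * y)"
    unfolding sine_neighbours[OF assms(1)] by (simp add: algebra_simps)
  finally show ?thesis
    unfolding Lambda_x_def lap_symbol_def by (rule divide_eq_neg_symbol)
qed

lemma B_op_sine:
  assumes "1 \<le> i" "0 < h"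
  shows "B_op h \<tau> (\<lambda>j. sin (k * (real j * h)) * y) i = B_symbol h \<tau> k * (sin (k * (real i * h)) * y)"
proof -
  have "s_N w i = w i + h\<^sup>2 / 12 * Lambda_x h w i" for w
    using assms(2) by (simp add: s_N_def Lambda_x_def field_simps)
  then have *: "B_op h \<tau> w i = w i + (h\<^sup>2 - \<tau>\<^sup>2) / 12 * Lambda_x h w i" for w
    by (simp add: B_op_def algebra_simps diff_divide_distrib)
  show ?thesis
    by (simp only: * Lambda_x_sine[OF assms] B_symbol_def) (simp add: field_simps)
qed

lemma is_scheme_solution_separated:
  fixes k N M :: nat and T g1 :: real and y g :: "nat \<Rightarrow> real"
  defines "h \<equiv> pi / real N" and "\<tau> \<equiv> T / real M"
  assumes N: "0 < N"
    and u0: "\<And>i. u0 (real i * h) = y 0 * sin (real k * (real i * h))"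
    and u1: "\<And>i. i \<in> {1..<N} \<Longrightarrow> u1h i = g1 * sin (real k * (real i * h))"
    and f: "\<And>i m. i \<in> {1..<N} \<Longrightarrow> f_mesh h \<tau> f i m = g m * sin (real k * (real i * h))"
    and start: "B_symbol h \<tau> (real k) * ((y 1 - y 0) / \<tau>) + \<tau> / 2 * lap_symbol h (real k) * y 0 = g1 + \<tau> / 2 * g 0"
    and step: "\<And>m. 1 \<le> m \<Longrightarrow> B_symbol h \<tau> (real k) * Lambda_t \<tau> y m + lap_symbol h (real k) * y m = g m"
  shows "is_scheme_solution T N M u0 u1h f (\<lambda>i m. sin (real k * (real i * h)) * y m)"
  unfolding is_scheme_solution_def Let_def h_def[symmetric] \<tau>_def[symmetric]
proof (intro conjI ballI)
  let ?s = "\<lambda>i. sin (real k * (real i * h))"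
  have h: "0 < h" using N by (simp add: h_def)
  fix i assume "i \<in> {1..<N}"
  then have i: "1 \<le> i" "i \<in> {1..<N}" by auto
  show "B_op h \<tau> (\<lambda>j. Lambda_t \<tau> (\<lambda>m. ?s j * y m) m) i - Lambda_x h (\<lambda>j. ?s j * y m) i = f_mesh h \<tau> f i m"
    if "m \<in> {1..<M}" for m
  proof -
    have "Lambda_t \<tau> (\<lambda>m. ?s j * y m) m = ?s j * Lambda_t \<tau> y m" for j
      by (simp add: Lambda_t_def algebra_simps add_divide_distrib diff_divide_distrib)
    then have "B_op h \<tau> (\<lambda>j. Lambda_t \<tau> (\<lambda>m. ?s j * y m) m) i - Lambda_x h (\<lambda>j. ?s j * y m) i =
        ?s i * (B_symbol h \<tau> (real k) * Lambda_t \<tau> y m + lap_symbol h (real k) * y m)"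
      by (simp only: B_op_sine[OF i(1) h] Lambda_x_sine[OF i(1) h]) (simp add: algebra_simps)
    also have "\<dots> = f_mesh h \<tau> f i m"
      using step[of m] that f[OF i(2)] by simp
    finally show ?thesis .
  qed
  have "delta_t \<tau> (\<lambda>m. ?s j * y m) 0 = ?s j * ((y 1 - y 0) / \<tau>)" for j
    by (simp add: delta_t_def algebra_simps diff_divide_distrib)
  then have "B_op h \<tau> (\<lambda>j. delta_t \<tau> (\<lambda>m. ?s j * y m) 0) i - \<tau> / 2 * Lambda_x h (\<lambda>j. ?s j * y 0) i =
      ?s i * (B_symbol h \<tau> (real k) * ((y 1 - y 0) / \<tau>) + \<tau> / 2 * lap_symbol h (real k) * y 0)"
    by (simp only: B_op_sine[OF i(1) h] Lambda_x_sine[OF i(1) h]) (simp add: algebra_simps)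
  also have "\<dots> = u1h i + \<tau> / 2 * f_mesh h \<tau> f i 0"
    unfolding start using u1[OF i(2)] f[OF i(2)] by (simp add: algebra_simps)
  finally show "B_op h \<tau> (\<lambda>j. delta_t \<tau> (\<lambda>m. ?s j * y m) 0) i - \<tau> / 2 * Lambda_x h (\<lambda>j. ?s j * y 0) i =
      u1h i + \<tau> / 2 * f_mesh h \<tau> f i 0" .
next
  show "sin (real k * (real i * h)) * y 0 = u0 (real i * h)" for i
    using u0 by simp
  show "sin (real k * (real 0 * h)) * y m = 0" for m by simp
  show "sin (real k * (real N * h)) * y m = 0" for m
    using N by (simp add: h_def)
qed

section \<open>Averages of sines\<close>

definition hat_symbol :: "real \<Rightarrow> real" where
  "hat_symbol y = (2 - 2 * cos y) / y\<^sup>2"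

text \<open>
  On each half of the support the weight is \<open>1 + s (x / h - c)\<close> with slope sign \<open>s\<close>; \<open>P s\<close> is an
  antiderivative.
\<close>

lemma has_integral_hat_sine:
  fixes h k c :: real
  assumes "0 < h" "k \<noteq> 0"
  shows "((\<lambda>x. sin (k * x) * max (1 - \<bar>x / h - c\<bar>) 0) has_integral
           h * hat_symbol (k * h) * sin (k * (c * h))) {(c - 1) * h .. (c + 1) * h}"
proof -
  define P where "P s x = - (cos (k * x) / k) * (1 + s * (x / h - c)) + s * sin (k * x) / (k\<^sup>2 * h)" for s x
  have P: "(P s has_real_derivative sin (k * x) * (1 + s * (x / h - c))) (at x within A)" for s x A
    unfolding P_def using assms
    by (auto intro!: derivative_eq_intros simp: field_simps power2_eq_square)
  note P = P[unfolded has_real_derivative_iff_has_vector_derivative]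
  have left: "((\<lambda>x. sin (k * x) * max (1 - \<bar>x / h - c\<bar>) 0) has_integral P 1 (c * h) - P 1 ((c - 1) * h)) {(c - 1) * h .. c * h}"
  proof (rule has_integral_eq)
    show "((\<lambda>x. sin (k * x) * (1 + 1 * (x / h - c))) has_integral P 1 (c * h) - P 1 ((c - 1) * h)) {(c - 1) * h .. c * h}"
      by (intro fundamental_theorem_of_calculus P) (use assms in \<open>simp add: mult_right_mono\<close>)
    fix x assume x: "x \<in> {(c - 1) * h .. c * h}"
    have "c - 1 \<le> x / h" "x / h \<le> c"
      using x assms by (simp_all add: pos_le_divide_eq pos_divide_le_eq)
    then show "sin (k * x) * (1 + 1 * (x / h - c)) = sin (k * x) * max (1 - \<bar>x / h - c\<bar>) 0"
      using assms by simp
  qed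
  have right: "((\<lambda>x. sin (k * x) * max (1 - \<bar>x / h - c\<bar>) 0) has_integral P (-1) ((c + 1) * h) - P (-1) (c * h)) {c * h .. (c + 1) * h}"
  proof (rule has_integral_eq)
    show "((\<lambda>x. sin (k * x) * (1 + (-1) * (x / h - c))) has_integral P (-1) ((c + 1) * h) - P (-1) (c * h)) {c * h .. (c + 1) * h}"
      by (intro fundamental_theorem_of_calculus P) (use assms in \<open>simp add: mult_right_mono\<close>)
    fix x assume x: "x \<in> {c * h .. (c + 1) * h}"
    have "c \<le> x / h" "x / h \<le> c + 1"
      using x assms by (simp_all add: pos_le_divide_eq pos_divide_le_eq)
    then show "sin (k * x) * (1 + (-1) * (x / h - c)) = sin (k * x) * max (1 - \<bar>x / h - c\<bar>) 0"
      using assms by simp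
  qed
  have nodes: "sin (k * ((c + 1) * h)) + sin (k * ((c - 1) * h)) = 2 * cos (k * h) * sin (k * (c * h))"
    using sin_add[of "k * (c * h)" "k * h"] sin_diff[of "k * (c * h)" "k * h"] by (simp add: algebra_simps)
  have ends: "(P 1 (c * h) - P 1 ((c - 1) * h)) + (P (-1) ((c + 1) * h) - P (-1) (c * h)) =
      (2 * sin (k * (c * h)) - (sin (k * ((c + 1) * h)) + sin (k * ((c - 1) * h)))) / (k\<^sup>2 * h)"
    using assms by (simp add: P_def diff_divide_distrib add_divide_distrib)
  have "(P 1 (c * h) - P 1 ((c - 1) * h)) + (P (-1) ((c + 1) * h) - P (-1) (c * h)) =
      h * hat_symbol (k * h) * sin (k * (c * h))"
    unfolding ends nodes using assms by (simp add: hat_symbol_def field_simps power2_eq_square)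
  then show ?thesis
    using has_integral_combine[OF _ _ left right] assms by (simp add: mult_right_mono)
qed

lemma q_h_sine:
  assumes "0 < h" "k \<noteq> 0"
  shows "q_h h (\<lambda>x. sin (k * x) * y) i = hat_symbol (k * h) * sin (k * (real i * h)) * y"
proof -
  have "((\<lambda>x. sin (k * x) * y * max (1 - \<bar>x / h - real i\<bar>) 0) has_integral
      h * hat_symbol (k * h) * sin (k * (real i * h)) * y) {(real i - 1) * h .. (real i + 1) * h}"
    using has_integral_mult_left[OF has_integral_hat_sine[OF assms, of "real i"], of y]
    by (simp add: mult_ac)
  then show ?thesis
    using assms unfolding q_h_def by (simp add: integral_unique)
qed

lemma q_tau_sine:
  assumes "0 < \<tau>" "c \<noteq> 0" "1 \<le> m"
  shows "q_tau \<tau> (\<lambda>t. s * sin (c * t)) m = s * (hat_symbol (c * \<tau>) * sin (c * (real m * \<tau>)))"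
  using q_h_sine[OF assms(1,2), of s m] assms(3) by (simp add: q_tau_def q_h_def mult_ac)

text \<open>
  At the initial level only half of the hat is present, so the average of a sine is not a multiple
  of its vanishing nodal value; this one exceptional value enters \<open>free_response\<close> below.
\<close>

lemma q_tau_sine_0:
  assumes "0 < \<tau>" "c \<noteq> 0"
  shows "q_tau \<tau> (\<lambda>t. s * sin (c * t)) 0 = s * (2 * (c * \<tau> - sin (c * \<tau>)) / (c * \<tau>)\<^sup>2)"
proof -
  define P where "P x = - (cos (c * x) / c) * (1 - x / \<tau>) - sin (c * x) / (c\<^sup>2 * \<tau>)" for x
  have P: "(P has_real_derivative sin (c * x) * (1 - x / \<tau>)) (at x within A)" for x A
    unfolding P_def using assms
    by (auto intro!: derivative_eq_intros simp: field_simps power2_eq_square)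
  have "((\<lambda>x. sin (c * x) * (1 - x / \<tau>)) has_integral P \<tau> - P 0) {0..\<tau>}"
    using P assms by (intro fundamental_theorem_of_calculus)
      (auto simp: has_real_derivative_iff_has_vector_derivative[symmetric])
  from has_integral_mult_right[OF this, of s]
  have "integral {0..\<tau>} (\<lambda>x. s * sin (c * x) * (1 - x / \<tau>)) = s * (P \<tau> - P 0)"
    by (intro integral_unique) (simp add: mult.assoc)
  moreover have "(2 / \<tau>) * (P \<tau> - P 0) = 2 * (c * \<tau> - sin (c * \<tau>)) / (c * \<tau>)\<^sup>2"
    using assms by (simp add: P_def field_simps power2_eq_square)
  moreover have "q_tau \<tau> (\<lambda>t. s * sin (c * t)) 0 = (2 / \<tau>) * integral {0..\<tau>} (\<lambda>x. s * sin (c * x) * (1 - x / \<tau>))"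
    by (simp add: q_tau_def)
  ultimately show ?thesis
    by (metis mult.left_commute)
qed

lemma f_mesh_zero [simp]: "f_mesh h \<tau> (\<lambda>x t. 0) i m = 0"
  by (simp add: f_mesh_def q_h_def q_tau_def)

definition forcing_factor :: "real \<Rightarrow> real \<Rightarrow> real \<Rightarrow> real \<Rightarrow> nat \<Rightarrow> real" where
  "forcing_factor h \<tau> k c m = hat_symbol (k * h) *
     (if m = 0 then 2 * (c * \<tau> - sin (c * \<tau>)) / (c * \<tau>)\<^sup>2
      else hat_symbol (c * \<tau>) * sin (c * (real m * \<tau>)))"

lemma f_mesh_sine:
  assumes "0 < h" "0 < \<tau>" "k \<noteq> 0" "c \<noteq> 0"
  shows "f_mesh h \<tau> (\<lambda>x t. sin (k * x) * sin (c * t)) i m = forcing_factor h \<tau> k c m * sin (k * (real i * h))"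
proof (cases "m = 0")
  case True
  show ?thesis
    unfolding True f_mesh_def q_tau_sine_0[OF assms(2,4)] q_h_sine[OF assms(1,3)] forcing_factor_def by simp
next
  case False
  then have "1 \<le> m" by simp
  then show ?thesis
    unfolding f_mesh_def q_tau_sine[OF assms(2,4) \<open>1 \<le> m\<close>] q_h_sine[OF assms(1,3)] forcing_factor_def
    using False by simp
qed

section \<open>Discrete oscillations\<close>

lemma Lambda_t_oscillation:
  assumes "1 \<le> m"
  shows "Lambda_t \<tau> (\<lambda>m. A * sin (\<theta> * real m + \<psi>)) m = - ((2 - 2 * cos \<theta>) / \<tau>\<^sup>2) * (A * sin (\<theta> * real m + \<psi>))"
proof -
  have "\<theta> * real (m + 1) + \<psi> = (\<theta> * real m + \<psi>) + \<theta>" "\<theta> * real (m - 1) + \<psi> = (\<theta> * real m + \<psi>) - \<theta>"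
    using assms by (simp_all add: of_nat_diff algebra_simps)
  then have "A * sin (\<theta> * real (m + 1) + \<psi>) - 2 * (A * sin (\<theta> * real m + \<psi>)) + A * sin (\<theta> * real (m - 1) + \<psi>) =
    - (2 - 2 * cos \<theta>) * (A * sin (\<theta> * real m + \<psi>))"
    by (simp only: sin_add[of _ \<theta>] sin_diff[of _ \<theta>]) (simp add: algebra_simps)
  then show ?thesis
    unfolding Lambda_t_def by (rule divide_eq_neg_symbol)
qed

lemma Lambda_t_add: "Lambda_t \<tau> (\<lambda>m. y m + z m) m = Lambda_t \<tau> y m + Lambda_t \<tau> z m"
  by (simp add: Lambda_t_def algebra_simps add_divide_distrib diff_divide_distrib)

section \<open>Numerical dispersion\<close>

lemma abs_sin_minus_self_le: "\<bar>sin x - x\<bar> \<le> \<bar>x\<bar> ^ 3 / 6" for x :: real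
  using Maclaurin_sin_bound[of x 3]
  by (simp add: sin_coeff_def numeral_3_eq_3 lessThan_Suc)

lemma sin_ge_half:
  assumes "0 \<le> x" "x \<le> (1::real)"
  shows "x / 2 \<le> sin x"
proof -
  have "x ^ 3 \<le> x" using assms power_decreasing[of 1 3 x] by simp
  moreover have "\<bar>x\<bar> = x" using assms by simp
  ultimately show ?thesis
    using abs_sin_minus_self_le[of x] assms(1) unfolding abs_le_iff by simp
qed

lemma one_minus_cos_le: "1 - cos x \<le> x\<^sup>2 / 2" for x :: real
proof -
  have "1 - cos x = 2 * (sin (x / 2))\<^sup>2"
    using cos_double_sin[of "x / 2"] by simp
  also have "\<dots> \<le> 2 * (x / 2)\<^sup>2"
    by (intro mult_left_mono abs_le_square_iff[THEN iffD1] abs_sin_x_le_abs_x) auto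
  finally show ?thesis by (simp add: power_divide)
qed

lemma one_minus_cos_ge:
  assumes "\<bar>x\<bar> \<le> (1::real)"
  shows "11 / 24 * x\<^sup>2 \<le> 1 - cos x"
proof -
  obtain t where "cos x = (\<Sum>m<4. cos_coeff m * x ^ m) + (cos (t + 1 / 2 * real 4 * pi) / fact 4) * x ^ 4"
    using Maclaurin_cos_expansion[of x 4] by blast
  then have "cos x = 1 - x\<^sup>2 / 2 + cos (t + 1 / 2 * real 4 * pi) * (x ^ 4 / 24)"
    by (simp add: cos_coeff_def lessThan_nat_numeral fact_numeral)
  moreover have "cos (t + 1 / 2 * real 4 * pi) * (x ^ 4 / 24) \<le> 1 * (x ^ 4 / 24)"
    by (intro mult_right_mono) auto
  moreover have "x ^ 4 \<le> x\<^sup>2"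
    using assms power_decreasing[of 2 4 "\<bar>x\<bar>"] by simp
  ultimately show ?thesis by linarith
qed

lemma sin_squared_expansion:
  fixes x :: real
  shows "\<bar>(sin x)\<^sup>2 - (x\<^sup>2 - x ^ 4 / 3 + 2 * x ^ 6 / 45)\<bar> \<le> x ^ 8 / 315"
proof -
  obtain t where "cos (2 * x) = (\<Sum>m<8. cos_coeff m * (2 * x) ^ m) + (cos (t + 1 / 2 * real 8 * pi) / fact 8) * (2 * x) ^ 8"
    using Maclaurin_cos_expansion[of "2 * x" 8] by blast
  moreover define R where "R = cos (t + 1 / 2 * real 8 * pi) * (2 * x ^ 8 / 315)"
  ultimately have "cos (2 * x) = 1 - 2 * x ^ 2 + 2 * x ^ 4 / 3 - 4 * x ^ 6 / 45 + R"
    by (simp add: cos_coeff_def lessThan_nat_numeral fact_numeral field_simps)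
  moreover have "(sin x)\<^sup>2 = (1 - cos (2 * x)) / 2"
    using cos_double_sin[of x] by simp
  moreover have "\<bar>R\<bar> \<le> 1 * (2 * x ^ 8 / 315)"
    unfolding R_def abs_mult by (intro mult_mono) auto
  ultimately have "(sin x)\<^sup>2 - (x\<^sup>2 - x ^ 4 / 3 + 2 * x ^ 6 / 45) = - (R / 2)"
    by (simp add: field_simps)
  then show ?thesis using \<open>\<bar>R\<bar> \<le> 1 * (2 * x ^ 8 / 315)\<close> by simp
qed

text \<open>
  From the degree six Taylor polynomial of \<open>sin\<^sup>2\<close>.  In \<open>q = x\<^sup>2\<close> the product
  \<open>(q - q\<^sup>2 / 3 + 2 q\<^sup>3 / 45) (1 + q / 3 + q\<^sup>2 / 15)\<close> has no terms of degree \<open>2\<close> and \<open>3\<close>, and the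
  degree four term decides: it is negative, and becomes positive after the correction
  \<open>q\<^sup>3 / 15\<close>.
\<close>

lemma inverse_sin_squared_bounds:
  fixes x :: real
  assumes "0 < x" "x \<le> 1 / 2"
  shows "1 / x\<^sup>2 + 1 / 3 + x\<^sup>2 / 15 \<le> 1 / (sin x)\<^sup>2"
    and "1 / (sin x)\<^sup>2 \<le> 1 / x\<^sup>2 + 1 / 3 + x\<^sup>2 / 15 + x ^ 4 / 15"
proof -
  define q where "q = x\<^sup>2"
  have q: "0 < q" "q \<le> 1 / 4"
    using assms power_mono[of x "1/2" 2] by (auto simp: q_def power2_eq_square)
  have "sin x \<noteq> 0" using sin_ge_half[of x] assms by auto
  then have s0: "0 < (sin x)\<^sup>2" by simp
  define s where "s = (sin x)\<^sup>2"
  have "\<bar>s - (q - q\<^sup>2 / 3 + 2 * q ^ 3 / 45)\<bar> \<le> q ^ 4 / 315"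
    using sin_squared_expansion[of x] by (simp add: s_def q_def flip: power_mult)
  then have upper: "s \<le> q - q\<^sup>2 / 3 + 2 * q ^ 3 / 45 + q ^ 4 / 315"
    and lower: "q - q\<^sup>2 / 3 + 2 * q ^ 3 / 45 - q ^ 4 / 315 \<le> s" by linarith+
  have qpow: "0 \<le> q ^ n" for n using q by simp
  have qle: "q ^ Suc n \<le> q ^ n / 4" for n
    using mult_right_mono[OF q(2) qpow[of n]] by simp
  have c: "q ^ 5 \<le> q ^ 4 / 4" "q ^ 6 \<le> q ^ 5 / 4" "q ^ 7 \<le> q ^ 6 / 4"
    using qle[of 4] qle[of 5] qle[of 6] by (simp_all del: power_Suc)
  have "s * (1 + q / 3 + q\<^sup>2 / 15) \<le> (q - q\<^sup>2 / 3 + 2 * q ^ 3 / 45 + q ^ 4 / 315) * (1 + q / 3 + q\<^sup>2 / 15)"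
    using q by (intro mult_right_mono upper) auto
  also have "\<dots> = q - (4 / 945) * q ^ 4 + (19 / 4725) * q ^ 5 + q ^ 6 / 4725"
    by (simp add: field_simps eval_nat_numeral)
  also have "\<dots> \<le> q" using c qpow[of 4] qpow[of 5] qpow[of 6] by linarith
  finally have "1 + q / 3 + q\<^sup>2 / 15 \<le> q / s"
    using s0 by (simp add: s_def pos_le_divide_eq mult.commute)
  then have "(1 + q / 3 + q\<^sup>2 / 15) / q \<le> (q / s) / q"
    using q by (intro divide_right_mono) auto
  then show "1 / x\<^sup>2 + 1 / 3 + x\<^sup>2 / 15 \<le> 1 / (sin x)\<^sup>2"
    using q unfolding q_def[symmetric] s_def[symmetric]
    by (simp add: add_divide_distrib power2_eq_square)
  have "0 \<le> (53 / 945) * q ^ 4 - (32 / 1575) * q ^ 5 - q ^ 7 / 4725"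
    using c qpow[of 4] qpow[of 5] qpow[of 6] by linarith
  moreover have "0 \<le> (13 / 4725) * q ^ 6" using qpow[of 6] by simp
  ultimately have "q \<le> q + (53 / 945) * q ^ 4 - (32 / 1575) * q ^ 5 + (13 / 4725) * q ^ 6 - q ^ 7 / 4725"
    by linarith
  also have "\<dots> = (q - q\<^sup>2 / 3 + 2 * q ^ 3 / 45 - q ^ 4 / 315) * (1 + q / 3 + q\<^sup>2 / 15 + q ^ 3 / 15)"
    by (simp add: field_simps eval_nat_numeral)
  also have "\<dots> \<le> s * (1 + q / 3 + q\<^sup>2 / 15 + q ^ 3 / 15)"
    using q by (intro mult_right_mono lower) auto
  finally have "q / s \<le> 1 + q / 3 + q\<^sup>2 / 15 + q ^ 3 / 15"
    using s0 by (simp add: s_def pos_divide_le_eq mult.commute)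
  then have "(q / s) / q \<le> (1 + q / 3 + q\<^sup>2 / 15 + q ^ 3 / 15) / q"
    using q by (intro divide_right_mono) auto
  moreover have "x ^ 4 = q\<^sup>2" by (simp add: q_def flip: power_mult)
  ultimately show "1 / (sin x)\<^sup>2 \<le> 1 / x\<^sup>2 + 1 / 3 + x\<^sup>2 / 15 + x ^ 4 / 15"
    using q unfolding q_def[symmetric] s_def[symmetric]
    by (simp add: add_divide_distrib power2_eq_square power3_eq_cube)
qed

text \<open>
  Here \<open>a\<close>, \<open>b\<close> are the half phases in space and time and \<open>c = \<sigma> a\<close> is the value of \<open>b\<close> for a scheme
  without dispersion.  By the previous lemma \<open>D = 1 / b\<^sup>2 - 1 / c\<^sup>2\<close> is
  \<open>(a\<^sup>2 / \<sigma>\<^sup>2 - b\<^sup>2) / 15\<close> up to higher order, that is about \<open>a\<^sup>2 (1 - \<sigma>^4) / (15 \<sigma>\<^sup>2)\<close>, and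
  \<open>c - b = D c\<^sup>2 b\<^sup>2 / (c + b)\<close>.  The hypothesis on \<open>a\<^sup>2\<close> makes the remainder at most half of the main
  term.
\<close>

lemma phase_defect_bounds:
  fixes \<sigma> a b :: real
  assumes \<sigma>: "0 < \<sigma>" "\<sigma> < 1" and a: "0 < a" "a \<le> 1 / 2" "a\<^sup>2 \<le> (1 - \<sigma> ^ 4) / 2"
    and b: "0 < b" "b \<le> pi / 2"
    and eq: "1 / (sin b)\<^sup>2 - 1 / 3 = (1 / (sin a)\<^sup>2 - 1 / 3) / \<sigma>\<^sup>2"
  shows "\<sigma> * a ^ 5 * (1 - \<sigma> ^ 4) / 240 \<le> \<sigma> * a - b" and "\<sigma> * a - b \<le> \<sigma> * a ^ 5 / 10"
proof -
  define c where "c = \<sigma> * a"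
  have "c \<le> a" using \<sigma> a mult_right_mono[of \<sigma> 1 a] by (simp add: c_def)
  moreover have "0 < c" using \<sigma> a by (simp add: c_def)
  ultimately have c: "0 < c" "c \<le> 1 / 2" "c \<le> a" using a by linarith+
  have \<sigma>2: "0 < \<sigma>\<^sup>2" using \<sigma> by simp
  have G: "(1 / (sin a)\<^sup>2 - 1 / 3) / \<sigma>\<^sup>2 \<ge> 1 / c\<^sup>2 + a\<^sup>2 / 15 / \<sigma>\<^sup>2"
    "(1 / (sin a)\<^sup>2 - 1 / 3) / \<sigma>\<^sup>2 \<le> 1 / c\<^sup>2 + (a\<^sup>2 / 15 + a ^ 4 / 15) / \<sigma>\<^sup>2"
  proof -
    have "(1 / a\<^sup>2 + a\<^sup>2 / 15) / \<sigma>\<^sup>2 \<le> (1 / (sin a)\<^sup>2 - 1 / 3) / \<sigma>\<^sup>2"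
      using inverse_sin_squared_bounds(1)[OF a(1,2)] by (intro divide_right_mono) auto
    then show "(1 / (sin a)\<^sup>2 - 1 / 3) / \<sigma>\<^sup>2 \<ge> 1 / c\<^sup>2 + a\<^sup>2 / 15 / \<sigma>\<^sup>2"
      by (simp add: c_def power_mult_distrib add_divide_distrib mult.commute)
    have "(1 / (sin a)\<^sup>2 - 1 / 3) / \<sigma>\<^sup>2 \<le> (1 / a\<^sup>2 + (a\<^sup>2 / 15 + a ^ 4 / 15)) / \<sigma>\<^sup>2"
      using inverse_sin_squared_bounds(2)[OF a(1,2)] by (intro divide_right_mono) auto
    then show "(1 / (sin a)\<^sup>2 - 1 / 3) / \<sigma>\<^sup>2 \<le> 1 / c\<^sup>2 + (a\<^sup>2 / 15 + a ^ 4 / 15) / \<sigma>\<^sup>2"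
      by (simp add: c_def power_mult_distrib add_divide_distrib mult.commute)
  qed
  define E where "E = a\<^sup>2 * (1 - \<sigma> ^ 4) / (30 * \<sigma>\<^sup>2)"
  have s4: "\<sigma> ^ 4 \<le> 1" "0 < \<sigma> ^ 4" "\<sigma> ^ 6 \<le> 1" using \<sigma> by (auto intro: power_le_one)
  have "\<sigma> ^ 4 < 1" using \<sigma> by (simp add: power_less_one_iff)
  then have E0: "0 < E" using a \<sigma> by (simp add: E_def)
  have gain: "E \<le> a\<^sup>2 / 15 / \<sigma>\<^sup>2 - (c\<^sup>2 / 15 + c ^ 4 / 15)"
  proof -
    have "\<sigma> ^ 6 * a\<^sup>2 \<le> 1 * a\<^sup>2" using s4 by (intro mult_right_mono) auto
    also have "\<dots> \<le> (1 - \<sigma> ^ 4) / 2" using a by simp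
    finally have "a\<^sup>2 * ((1 - \<sigma> ^ 4) / 2) \<le> a\<^sup>2 * (1 - \<sigma> ^ 4 - \<sigma> ^ 6 * a\<^sup>2)"
      by (intro mult_left_mono) auto
    then have "a\<^sup>2 * ((1 - \<sigma> ^ 4) / 2) / (15 * \<sigma>\<^sup>2) \<le> a\<^sup>2 * (1 - \<sigma> ^ 4 - \<sigma> ^ 6 * a\<^sup>2) / (15 * \<sigma>\<^sup>2)"
      using \<sigma>2 by (intro divide_right_mono) auto
    moreover have "a\<^sup>2 * (1 - \<sigma> ^ 4 - \<sigma> ^ 6 * a\<^sup>2) / (15 * \<sigma>\<^sup>2) = a\<^sup>2 / 15 / \<sigma>\<^sup>2 - (c\<^sup>2 / 15 + c ^ 4 / 15)"
      using \<sigma> by (simp add: c_def field_simps eval_nat_numeral)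
    ultimately show ?thesis by (simp add: E_def)
  qed
  \<comment> \<open>The sign of the defect comes first: it puts \<open>b\<close> into the range of the expansion.\<close>
  have "1 / (sin c)\<^sup>2 \<le> 1 / (sin b)\<^sup>2"
    using inverse_sin_squared_bounds(2)[OF c(1,2)] G(1) gain E0 eq by linarith
  moreover have sb: "0 < sin b" "0 < sin c"
    using b c pi_gt3 by (auto intro!: sin_gt_zero)
  ultimately have "(sin b)\<^sup>2 \<le> (sin c)\<^sup>2"
    by (simp add: field_simps)
  then have "sin b \<le> sin c" using sb by (simp add: power_mono_iff)
  then have bc: "b \<le> c"
    using sin_mono_le_eq[of b c] b c pi_gt3 by simp
  then have b2: "b \<le> 1 / 2" using c by simp
  have bcpow: "b\<^sup>2 \<le> c\<^sup>2" "b ^ 4 \<le> c ^ 4" using b bc by (auto intro: power_mono)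
  define D where "D = 1 / b\<^sup>2 - 1 / c\<^sup>2"
  have D1: "E \<le> D"
    using inverse_sin_squared_bounds(2)[OF b(1) b2] G(1) gain eq bcpow unfolding D_def by linarith
  have a4: "a ^ 4 \<le> a\<^sup>2 / 4"
    using mult_right_mono[of "a\<^sup>2" "1/4" "a\<^sup>2"] power_mono[of a "1/2" 2] a(1,2)
    by (simp add: eval_nat_numeral)
  have D2: "D \<le> a\<^sup>2 / (10 * \<sigma>\<^sup>2)"
  proof -
    have "D \<le> (a\<^sup>2 / 15 + a ^ 4 / 15) / \<sigma>\<^sup>2"
      using inverse_sin_squared_bounds(1)[OF b(1) b2] G(2) eq zero_le_power2[of b] unfolding D_def by linarith
    also have "\<dots> \<le> (a\<^sup>2 / 10) / \<sigma>\<^sup>2"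
    proof (intro divide_right_mono)
      show "a\<^sup>2 / 15 + a ^ 4 / 15 \<le> a\<^sup>2 / 10"
        using a4 zero_le_power2[of a] by linarith
    qed simp
    finally show ?thesis by simp
  qed
  have diff: "c - b = D * (c\<^sup>2 * b\<^sup>2 / (c + b))"
  proof -
    have "D * (c\<^sup>2 * b\<^sup>2) = c\<^sup>2 - b\<^sup>2"
      using b c by (simp add: D_def field_simps)
    also have "\<dots> = (c - b) * (c + b)" by (simp add: algebra_simps power2_eq_square)
    finally show ?thesis using b c by (simp add: field_simps)
  qed
  have half: "c / 2 \<le> b"
  proof -
    have "D * c\<^sup>2 \<le> a\<^sup>2 / (10 * \<sigma>\<^sup>2) * c\<^sup>2" using D2 by (intro mult_right_mono) auto
    also have "\<dots> = a ^ 4 / 10" using \<sigma> by (simp add: c_def power_mult_distrib eval_nat_numeral)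
    also have "\<dots> \<le> 3" using a4 power_mono[of a 1 2] a(1,2) by simp
    finally have "c\<^sup>2 / b\<^sup>2 \<le> 4" using b c by (simp add: D_def algebra_simps)
    then have "(c / b)\<^sup>2 \<le> 2\<^sup>2" by (simp add: power_divide)
    then have "c / b \<le> 2" by (rule power2_le_imp_le) simp
    then show ?thesis using b by (simp add: field_simps)
  qed
  have "c * (c / 2)\<^sup>2 / 2 \<le> c\<^sup>2 * b\<^sup>2 / (c + b)"
  proof -
    have "c * (c / 2)\<^sup>2 * (c + b) \<le> c * (c / 2)\<^sup>2 * (2 * c)"
      using bc c by (intro mult_left_mono) auto
    also have "\<dots> = 2 * c\<^sup>2 * (c / 2)\<^sup>2" by (simp add: power2_eq_square)
    also have "\<dots> \<le> 2 * c\<^sup>2 * b\<^sup>2" using half c by (intro mult_left_mono power_mono) auto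
    finally show ?thesis using b c by (simp add: field_simps)
  qed
  then have low: "E * (c * (c / 2)\<^sup>2 / 2) \<le> c - b"
    unfolding diff using D1 E0 c by (intro mult_mono) auto
  have Ec: "E * (c * (c / 2)\<^sup>2 / 2) = \<sigma> * a ^ 5 * (1 - \<sigma> ^ 4) / 240"
    using \<sigma> by (simp add: E_def c_def field_simps eval_nat_numeral)
  show "\<sigma> * a ^ 5 * (1 - \<sigma> ^ 4) / 240 \<le> \<sigma> * a - b"
    using low unfolding Ec by (simp only: c_def)
  have "c\<^sup>2 * b\<^sup>2 / (c + b) \<le> c ^ 3"
  proof -
    have "c\<^sup>2 * b\<^sup>2 \<le> c\<^sup>2 * c\<^sup>2" using bcpow by (intro mult_left_mono) auto
    also have "\<dots> = c ^ 3 * c" by (simp add: eval_nat_numeral)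
    also have "\<dots> \<le> c ^ 3 * (c + b)" using b c by (intro mult_left_mono) auto
    finally show ?thesis using b c by (simp add: pos_divide_le_eq)
  qed
  then have "c - b \<le> a\<^sup>2 / (10 * \<sigma>\<^sup>2) * c ^ 3"
    unfolding diff using D2 b c D1 E0 by (intro mult_mono) auto
  also have "\<dots> = \<sigma> * a ^ 5 / 10"
    using \<sigma> by (simp add: c_def field_simps eval_nat_numeral)
  finally show "\<sigma> * a - b \<le> \<sigma> * a ^ 5 / 10" by (simp add: c_def)
qed

definition phase :: "real \<Rightarrow> real \<Rightarrow> real \<Rightarrow> real" where
  "phase h \<tau> k = arccos (1 - \<tau>\<^sup>2 * lap_symbol h k / (2 * B_symbol h \<tau> k))"

definition frequency_defect :: "real \<Rightarrow> real \<Rightarrow> real \<Rightarrow> real" where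
  "frequency_defect h \<tau> k = k - phase h \<tau> k / \<tau>"

text \<open>
  The discrete oscillation has phase \<open>phase h \<tau> k\<close> per step, so its frequency is
  \<open>phase h \<tau> k / \<tau>\<close>.  The half phases satisfy the hypotheses of \<open>phase_defect_bounds\<close> with
  \<open>\<sigma> = \<tau> / h\<close>; stability gives \<open>1 - \<sigma>^4 \<ge> \<epsilon>\<^sup>2 / 2\<close>, and the condition \<open>k h \<le> \<epsilon>\<close> then
  implies the smallness of \<open>a\<close> required there.
\<close>

lemma phase_and_frequency_defect:
  fixes h \<tau> k \<epsilon> :: real
  assumes h: "0 < h" "0 < \<tau>" and stab: "\<tau>\<^sup>2 \<le> (1 - \<epsilon>\<^sup>2 / 2) * h\<^sup>2" and \<epsilon>: "0 < \<epsilon>" "\<epsilon> \<le> 1"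
    and k: "0 < k" "k * h \<le> \<epsilon>"
  shows "2 / 3 \<le> B_symbol h \<tau> k" "B_symbol h \<tau> k \<le> 1"
    and "0 < phase h \<tau> k" "phase h \<tau> k \<le> k * \<tau>"
    and "B_symbol h \<tau> k * (2 - 2 * cos (phase h \<tau> k)) = \<tau>\<^sup>2 * lap_symbol h k"
    and "\<epsilon>\<^sup>2 / 7680 * (k ^ 5 * h ^ 4) \<le> frequency_defect h \<tau> k"
    and "frequency_defect h \<tau> k \<le> (k ^ 5 * h ^ 4) / 160"
proof -
  define \<sigma> a s where "\<sigma> = \<tau> / h" and "a = k * h / 2" and "s = (sin (k * h / 2))\<^sup>2"
  have \<sigma>0: "0 < \<sigma>" using h by (simp add: \<sigma>_def)
  have \<sigma>2: "\<sigma>\<^sup>2 \<le> 1 - \<epsilon>\<^sup>2 / 2"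
    using stab h by (simp add: \<sigma>_def power_divide pos_divide_le_eq)
  have \<epsilon>2: "0 < \<epsilon>\<^sup>2" using \<epsilon> by simp
  have "\<sigma>\<^sup>2 < 1" using \<sigma>2 \<epsilon>2 by linarith
  then have \<sigma>1: "\<sigma> < 1" using \<sigma>0 by (simp add: power2_less_1_iff abs_less_iff)
  have \<sigma>4: "\<epsilon>\<^sup>2 / 2 \<le> 1 - \<sigma> ^ 4"
  proof -
    have "\<sigma> ^ 4 \<le> \<sigma>\<^sup>2" using \<sigma>0 \<sigma>1 by (intro power_decreasing) auto
    then show ?thesis using \<sigma>2 by linarith
  qed
  have a: "0 < a" "a \<le> \<epsilon> / 2" "a \<le> 1 / 2" using k h \<epsilon> by (auto simp: a_def)
  have "a\<^sup>2 \<le> (\<epsilon> / 2)\<^sup>2" using a by (intro power_mono) auto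
  then have a2: "a\<^sup>2 \<le> (1 - \<sigma> ^ 4) / 2" using \<sigma>4 by (simp add: power_divide)
  have sina: "0 < sin a" using a pi_gt3 by (intro sin_gt_zero) auto
  then have s0: "0 < s" by (simp add: s_def a_def)
  have "s \<le> a\<^sup>2"
    using abs_sin_x_le_abs_x[of a] unfolding s_def a_def[symmetric] by (simp add: abs_le_square_iff)
  moreover have "a\<^sup>2 \<le> (1 / 2)\<^sup>2" using a by (intro power_mono) auto
  ultimately have s1: "s \<le> 1 / 4" by (simp add: power_divide)
  have lap: "lap_symbol h k = 4 * s / h\<^sup>2"
    using cos_double_sin[of "k * h / 2"] by (simp add: lap_symbol_def s_def)
  have B: "B_symbol h \<tau> k = 1 - (1 - \<sigma>\<^sup>2) * s / 3"
    unfolding B_symbol_def lap using h by (simp add: \<sigma>_def field_simps)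
  have q: "0 \<le> (1 - \<sigma>\<^sup>2) * s" "(1 - \<sigma>\<^sup>2) * s \<le> 1 * (1/4)"
  proof -
    show "0 \<le> (1 - \<sigma>\<^sup>2) * s" using \<open>\<sigma>\<^sup>2 < 1\<close> s0 by simp
    show "(1 - \<sigma>\<^sup>2) * s \<le> 1 * (1/4)" using s0 s1 by (intro mult_mono) auto
  qed
  show B1: "2 / 3 \<le> B_symbol h \<tau> k" and "B_symbol h \<tau> k \<le> 1"
    using q unfolding B by linarith+
  define S where "S = \<sigma>\<^sup>2 * s / B_symbol h \<tau> k"
  have arg: "\<tau>\<^sup>2 * lap_symbol h k / (2 * B_symbol h \<tau> k) = 2 * S"
    unfolding lap S_def \<sigma>_def by (simp add: power_divide mult_ac)
  have S0: "0 < S" using \<sigma>0 s0 B1 by (simp add: S_def)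
  have "\<sigma>\<^sup>2 * s \<le> 1 * (1 / 4)" using \<open>\<sigma>\<^sup>2 < 1\<close> s0 s1 by (intro mult_mono) auto
  then have S1: "S \<le> 1 / 2" using B1 by (simp add: S_def pos_divide_le_eq)
  define \<theta> where "\<theta> = phase h \<tau> k"
  have \<theta>_def': "\<theta> = arccos (1 - 2 * S)" by (simp add: \<theta>_def phase_def arg)
  have cos\<theta>: "cos \<theta> = 1 - 2 * S"
    unfolding \<theta>_def' using S0 S1 by (intro cos_arccos) auto
  have \<theta>: "0 \<le> \<theta>" "\<theta> \<le> pi"
    unfolding \<theta>_def' using S0 S1 by (auto intro!: arccos_lbound arccos_ubound)
  moreover have "\<theta> \<noteq> 0" using cos\<theta> S0 by auto
  ultimately have \<theta>0: "0 < \<theta>" by simp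
  then show "0 < phase h \<tau> k" by (simp add: \<theta>_def)
  have "B_symbol h \<tau> k * S = \<sigma>\<^sup>2 * s" using B1 by (simp add: S_def)
  moreover have "B_symbol h \<tau> k * (2 - 2 * cos \<theta>) = 4 * (B_symbol h \<tau> k * S)"
    unfolding cos\<theta> by simp
  ultimately show "B_symbol h \<tau> k * (2 - 2 * cos (phase h \<tau> k)) = \<tau>\<^sup>2 * lap_symbol h k"
    unfolding \<theta>_def[symmetric] lap by (simp add: \<sigma>_def power_divide)
  have S_half: "(sin (\<theta> / 2))\<^sup>2 = S"
    using cos_double_sin[of "\<theta> / 2"] cos\<theta> by simp
  have disp: "1 / (sin (\<theta> / 2))\<^sup>2 - 1 / 3 = (1 / (sin a)\<^sup>2 - 1 / 3) / \<sigma>\<^sup>2"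
  proof -
    have "(sin a)\<^sup>2 = s" by (simp add: a_def s_def)
    then show ?thesis
      unfolding S_half S_def B using s0 \<sigma>0 by (simp add: field_simps)
  qed
  have scale: "\<sigma> * a = k * \<tau> / 2" "\<sigma> * a ^ 5 = (k ^ 5 * h ^ 4) * \<tau> / 32"
    using h by (simp_all add: \<sigma>_def a_def power_divide power_mult_distrib eval_nat_numeral)
  have low: "\<sigma> * a ^ 5 * (1 - \<sigma> ^ 4) / 240 \<le> k * \<tau> / 2 - \<theta> / 2"
    and up: "k * \<tau> / 2 - \<theta> / 2 \<le> \<sigma> * a ^ 5 / 10"
    using phase_defect_bounds[OF \<sigma>0 \<sigma>1 a(1,3) a2 _ _ disp] \<theta>0 \<theta>(2) unfolding scale(1) by auto
  have z0: "0 \<le> (k ^ 5 * h ^ 4) * \<tau> / 32" using h k by simp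
  have "(k ^ 5 * h ^ 4) * \<tau> / 32 * (\<epsilon>\<^sup>2 / 2) \<le> (k ^ 5 * h ^ 4) * \<tau> / 32 * (1 - \<sigma> ^ 4)"
    using z0 \<sigma>4 by (rule mult_left_mono[rotated])
  then have "(k ^ 5 * h ^ 4) * \<tau> / 32 * (\<epsilon>\<^sup>2 / 2) / 240 \<le> (k ^ 5 * h ^ 4) * \<tau> / 32 * (1 - \<sigma> ^ 4) / 240"
    by (rule divide_right_mono) simp
  from order_trans[OF this low[unfolded scale(2)]]
  have low': "(k ^ 5 * h ^ 4) * \<tau> * \<epsilon>\<^sup>2 / 7680 \<le> k * \<tau> - \<theta>"
    by (simp add: mult.commute)
  have "0 \<le> (k ^ 5 * h ^ 4) * \<tau> * \<epsilon>\<^sup>2 / 7680" using z0 by simp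
  then show "phase h \<tau> k \<le> k * \<tau>" using low' unfolding \<theta>_def by linarith
  have fd: "frequency_defect h \<tau> k = (k * \<tau> - \<theta>) / \<tau>"
    using h by (simp add: frequency_defect_def \<theta>_def diff_divide_distrib)
  show "\<epsilon>\<^sup>2 / 7680 * (k ^ 5 * h ^ 4) \<le> frequency_defect h \<tau> k"
    unfolding fd using low' h by (simp add: pos_le_divide_eq mult_ac)
  show "frequency_defect h \<tau> k \<le> (k ^ 5 * h ^ 4) / 160"
    unfolding fd using up h unfolding scale(2) by (simp add: pos_divide_le_eq mult_ac)
qed

section \<open>Trigonometric sums\<close>

text \<open>
  Multiplication by \<open>2 sin (\<nu> / 2)\<close> makes the sum telescope.
\<close>

lemma abs_cos_sum_le:
  assumes "0 < sin (\<nu> / 2)"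
  shows "\<bar>\<Sum>m=1..n. cos (\<nu> * real m + \<phi>)\<bar> \<le> 1 / sin (\<nu> / 2)"
proof -
  have "2 * sin (\<nu> / 2) * (\<Sum>m=1..n. cos (\<nu> * real m + \<phi>)) =
      sin (\<nu> * real n + \<phi> + \<nu> / 2) - sin (\<phi> + \<nu> / 2)"
  proof (induction n)
    case (Suc n)
    have "2 * sin (\<nu> / 2) * cos (\<nu> * real (Suc n) + \<phi>) =
        sin (\<nu> * real (Suc n) + \<phi> + \<nu> / 2) - sin (\<nu> * real (Suc n) + \<phi> - \<nu> / 2)"
      by (simp add: sin_add[of _ "\<nu> / 2"] sin_diff[of _ "\<nu> / 2"])
    moreover have "\<nu> * real (Suc n) + \<phi> - \<nu> / 2 = \<nu> * real n + \<phi> + \<nu> / 2"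
      by (simp add: algebra_simps)
    moreover have "(\<Sum>m=1..Suc n. cos (\<nu> * real m + \<phi>)) =
        (\<Sum>m=1..n. cos (\<nu> * real m + \<phi>)) + cos (\<nu> * real (Suc n) + \<phi>)" by simp
    ultimately show ?case using Suc by (simp only: distrib_left)
  qed simp
  then have "2 * sin (\<nu> / 2) * \<bar>\<Sum>m=1..n. cos (\<nu> * real m + \<phi>)\<bar> =
      \<bar>sin (\<nu> * real n + \<phi> + \<nu> / 2) - sin (\<phi> + \<nu> / 2)\<bar>"
    using assms by (metis abs_mult abs_of_pos mult_pos_pos zero_less_numeral)
  also have "\<dots> \<le> 2"
    using abs_sin_le_one[of "\<nu> * real n + \<phi> + \<nu> / 2"] abs_sin_le_one[of "\<phi> + \<nu> / 2"] by linarith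
  finally show ?thesis using assms by (simp add: field_simps)
qed

lemma abs_weighted_cos_sum_le:
  assumes "0 < \<tau>" "0 < k" "k * \<tau> \<le> \<nu>" "\<nu> \<le> 2"
  shows "\<bar>\<Sum>m=1..n. \<tau> * cos (\<nu> * real m + \<phi>)\<bar> \<le> 4 / k"
proof -
  have \<nu>: "0 < \<nu>" using assms by (smt (verit) mult_pos_pos)
  have s: "\<nu> / 4 \<le> sin (\<nu> / 2)" using sin_ge_half[of "\<nu> / 2"] \<nu> assms by simp
  then have s0: "0 < sin (\<nu> / 2)" using \<nu> by linarith
  have "\<bar>\<Sum>m=1..n. \<tau> * cos (\<nu> * real m + \<phi>)\<bar> = \<tau> * \<bar>\<Sum>m=1..n. cos (\<nu> * real m + \<phi>)\<bar>"
    using assms by (simp add: abs_mult flip: sum_distrib_left)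
  also have "\<dots> \<le> \<tau> * (1 / sin (\<nu> / 2))"
    using assms by (intro mult_left_mono abs_cos_sum_le s0) auto
  also have "\<dots> \<le> \<tau> * (1 / (k * \<tau> / 4))"
    using s assms by (intro mult_left_mono divide_left_mono mult_pos_pos s0) auto
  also have "\<dots> = 4 / k" using assms by simp
  finally show ?thesis .
qed

section \<open>Lower bounds for separated errors\<close>

lemma half_sum_le_L1h_norm:
  assumes "0 < h" "n \<le> N"
  shows "(\<Sum>i=1..n. h * \<bar>w i\<bar>) / 2 \<le> L1h_norm N h w"
proof -
  have "(\<Sum>i=1..n. h * \<bar>w i\<bar>) / 2 \<le> (\<Sum>i=1..N. h * \<bar>w i\<bar>) / 2"
    using assms by (intro divide_right_mono sum_mono2) auto
  also have "\<dots> = (\<Sum>i=1..N. h * \<bar>w i\<bar> / 2)" by (simp add: sum_divide_distrib)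
  also have "\<dots> \<le> (\<Sum>i=1..N. (\<bar>w (i - 1)\<bar> + \<bar>w i\<bar>) / 2 * h)"
    using assms by (intro sum_mono) (simp add: field_simps)
  finally show ?thesis by (simp add: L1h_norm_def)
qed

lemma L1_norm_bdelta_separated:
  assumes e: "\<And>i m. i \<le> N \<Longrightarrow> m \<le> M \<Longrightarrow> e i m = X i * Y m"
  shows "L1_norm_bdelta l T N M e =
    (if l = 0 then L1h_norm N (pi / real N) X else L1h_norm_diff N (pi / real N) (bdelta_x (pi / real N) X)) *
    L1h_norm M (T / real M) Y"
proof -
  define h where "h = pi / real N"
  define c where "c = (if l = 0 then L1h_norm N h X else L1h_norm_diff N h (bdelta_x h X))"
  have slice: "(if l = 0 then L1h_norm N h (\<lambda>i. e i m) else L1h_norm_diff N h (bdelta_x h (\<lambda>i. e i m))) = c * \<bar>Y m\<bar>"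
    if "m \<le> M" for m
  proof -
    have "L1h_norm N h (\<lambda>i. e i m) = L1h_norm N h X * \<bar>Y m\<bar>"
      unfolding L1h_norm_def sum_distrib_right using that
      by (intro sum.cong) (auto simp: e abs_mult field_simps)
    moreover have "L1h_norm_diff N h (bdelta_x h (\<lambda>i. e i m)) = L1h_norm_diff N h (bdelta_x h X) * \<bar>Y m\<bar>"
      unfolding L1h_norm_diff_def sum_distrib_right bdelta_x_def using that
      by (intro sum.cong) (auto simp: e abs_mult abs_divide simp flip: left_diff_distrib)
    ultimately show ?thesis by (simp add: c_def)
  qed
  have "L1_norm_bdelta l T N M e = (\<Sum>j=1..M. (\<bar>c * \<bar>Y (j - 1)\<bar>\<bar> + \<bar>c * \<bar>Y j\<bar>\<bar>) / 2 * (T / real M))"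
    unfolding L1_norm_bdelta_def Let_def h_def[symmetric] L1h_norm_def[of M]
  proof (intro sum.cong refl)
    fix j assume "j \<in> {1..M}"
    then have "j \<le> M" "j - 1 \<le> M" by auto
    then show "(\<bar>if l = 0 then L1h_norm N h (\<lambda>i. e i (j - 1)) else L1h_norm_diff N h (bdelta_x h (\<lambda>i. e i (j - 1)))\<bar> +
        \<bar>if l = 0 then L1h_norm N h (\<lambda>i. e i j) else L1h_norm_diff N h (bdelta_x h (\<lambda>i. e i j))\<bar>) / 2 * (T / real M) =
        (\<bar>c * \<bar>Y (j - 1)\<bar>\<bar> + \<bar>c * \<bar>Y j\<bar>\<bar>) / 2 * (T / real M)"
      by (simp only: slice)
  qed
  also have "\<dots> = \<bar>c\<bar> * L1h_norm M (T / real M) Y"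
    unfolding L1h_norm_def[of M] sum_distrib_left
    by (intro sum.cong) (auto simp: abs_mult field_simps)
  also have "\<bar>c\<bar> = c"
  proof -
    have "0 \<le> h" by (simp add: h_def)
    then have "0 \<le> c" by (auto simp: c_def L1h_norm_def L1h_norm_diff_def intro!: sum_nonneg)
    then show ?thesis by simp
  qed
  finally show ?thesis by (simp add: c_def h_def)
qed

text \<open>
  \<open>\<bar>g\<bar> \<ge> g\<^sup>2\<close>, and the square has mean \<open>1 / 2\<close> up to a cosine sum of size \<open>4 / k\<close>.
\<close>

lemma sum_abs_trig_ge:
  fixes N k :: nat
  assumes N: "0 < N" and k: "4 \<le> real k" "real k * h \<le> 1" and h: "h = pi / real N"
    and g: "\<And>i. (g i)\<^sup>2 = (1 + s * cos (2 * (real k * h) * real i + \<phi>)) / 2" "\<And>i. \<bar>g i\<bar> \<le> 1"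
    and s: "\<bar>s\<bar> = 1"
  shows "1 \<le> (\<Sum>i=1..N. h * \<bar>g i\<bar>)"
proof -
  have h0: "0 < h" using N h by simp
  let ?C = "\<Sum>i=1..N. h * cos (2 * (real k * h) * real i + \<phi>)"
  have "\<bar>?C\<bar> \<le> 4 / real k"
    using abs_weighted_cos_sum_le[of h "real k" "2 * (real k * h)" \<phi> N] h0 k by simp
  moreover have "4 / real k \<le> 1" using k by simp
  ultimately have C: "\<bar>s * ?C\<bar> \<le> 1" unfolding abs_mult s by simp
  have "pi / 2 + s * ?C / 2 = (\<Sum>i=1..N. h * (g i)\<^sup>2)"
    using N by (simp add: g(1) h sum_distrib_left sum.distrib distrib_left sum_divide_distrib add_divide_distrib mult_ac)
  also have "\<dots> \<le> (\<Sum>i=1..N. h * \<bar>g i\<bar>)"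
  proof (intro sum_mono mult_left_mono)
    fix i
    have "\<bar>g i\<bar> * \<bar>g i\<bar> \<le> \<bar>g i\<bar> * 1" using g(2)[of i] by (intro mult_left_mono) auto
    then show "(g i)\<^sup>2 \<le> \<bar>g i\<bar>" by (simp add: power2_eq_square)
  qed (use h0 in simp)
  finally show ?thesis using C pi_gt3 by linarith
qed

lemma space_factor_ge:
  fixes N k :: nat
  assumes N: "0 < N" and k: "4 \<le> real k" "real k * h \<le> 1" and h: "h = pi / real N" and l: "l \<in> {0, 1}"
  shows "real k ^ l / 2 \<le> (if l = 0 then L1h_norm N h (\<lambda>i. sin (real k * (real i * h)))
    else L1h_norm_diff N h (bdelta_x h (\<lambda>i. sin (real k * (real i * h)))))"
proof (cases "l = 0")
  case True
  have "1 \<le> (\<Sum>i=1..N. h * \<bar>sin (real k * (real i * h))\<bar>)"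
  proof (rule sum_abs_trig_ge[OF N k h])
    fix i
    show "(sin (real k * (real i * h)))\<^sup>2 = (1 + -1 * cos (2 * (real k * h) * real i + 0)) / 2"
      using cos_double_sin[of "real k * (real i * h)"] by (simp add: mult_ac)
  qed auto
  then show ?thesis
    using half_sum_le_L1h_norm[of h N N "\<lambda>i. sin (real k * (real i * h))"] N True h by simp
next
  case False
  then have l1: "l = 1" using l by simp
  have h0: "0 < h" using N h by simp
  let ?g = "\<lambda>i. cos (real k * ((real i - 1 / 2) * h))"
  have "1 \<le> (\<Sum>i=1..N. h * \<bar>?g i\<bar>)"
  proof (rule sum_abs_trig_ge[OF N k h])
    fix i
    show "(?g i)\<^sup>2 = (1 + 1 * cos (2 * (real k * h) * real i + (- (real k * h)))) / 2"
      using cos_double_cos[of "real k * ((real i - 1 / 2) * h)"] by (simp add: algebra_simps)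
  qed auto
  moreover have "bdelta_x h (\<lambda>i. sin (real k * (real i * h))) i = 2 / h * sin (real k * h / 2) * ?g i" if "1 \<le> i" for i
  proof -
    have "sin (real k * (real i * h)) - sin (real k * (real (i - 1) * h)) = 2 * sin (real k * h / 2) * ?g i"
      using that by (simp add: sin_diff_sin of_nat_diff field_simps)
    then show ?thesis by (simp add: bdelta_x_def)
  qed
  then have "L1h_norm_diff N h (bdelta_x h (\<lambda>i. sin (real k * (real i * h)))) =
      (\<Sum>i=1..N. \<bar>2 / h * sin (real k * h / 2)\<bar> * (h * \<bar>?g i\<bar>))"
    unfolding L1h_norm_diff_def by (intro sum.cong) (auto simp: abs_mult)
  then have "L1h_norm_diff N h (bdelta_x h (\<lambda>i. sin (real k * (real i * h)))) =
      \<bar>2 / h * sin (real k * h / 2)\<bar> * (\<Sum>i=1..N. h * \<bar>?g i\<bar>)"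
    by (simp only: sum_distrib_left)
  moreover have "real k / 2 \<le> \<bar>2 / h * sin (real k * h / 2)\<bar>"
  proof -
    have "real k * h / 2 / 2 \<le> sin (real k * h / 2)" using h0 k by (intro sin_ge_half) auto
    then have "2 / h * (real k * h / 2 / 2) \<le> 2 / h * sin (real k * h / 2)"
      using h0 by (intro mult_left_mono) auto
    then have "real k / 2 \<le> 2 / h * sin (real k * h / 2)" using h0 by simp
    then show ?thesis by (rule order_trans[OF _ abs_ge_self])
  qed
  ultimately show ?thesis
    using mult_mono[of "real k / 2" "\<bar>2 / h * sin (real k * h / 2)\<bar>" 1 "\<Sum>i=1..N. h * \<bar>?g i\<bar>"] l1 by simp
qed

lemma sum_squares_ge: "real n ^ 3 / 3 \<le> (\<Sum>m=1..n. (real m)\<^sup>2)"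
proof (induction n)
  case (Suc n)
  have "real (Suc n) ^ 3 / 3 \<le> real n ^ 3 / 3 + (real (Suc n))\<^sup>2"
    by (simp add: power3_eq_cube power2_eq_square field_simps)
  then show ?case using Suc by simp
qed simp

text \<open>
  In the applications \<open>F\<close> collects the fast oscillations and \<open>\<eta>\<close> the deviation of the amplitudes from
  their asymptotic values; the quadratic minorant sums to a third of the cube of the window length.
\<close>

lemma weighted_sum_ge:
  assumes \<tau>: "0 < \<tau>" and Z: "\<And>m. m \<in> {1..n} \<Longrightarrow> c * (\<tau> * real m)\<^sup>2 + F m - \<eta> \<le> \<bar>Z m\<bar>"
    and F: "\<bar>\<Sum>m=1..n. \<tau> * F m\<bar> \<le> R" and c: "0 \<le> c" and \<eta>: "0 \<le> \<eta>" and n: "\<tau> * real n \<le> 1"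
  shows "c * (\<tau> * real n) ^ 3 / 3 - R - \<eta> \<le> (\<Sum>m=1..n. \<tau> * \<bar>Z m\<bar>)"
proof -
  have "c * (\<tau> * real n) ^ 3 / 3 = c * \<tau> ^ 3 * (real n ^ 3 / 3)" by (simp add: power_mult_distrib)
  also have "\<dots> \<le> c * \<tau> ^ 3 * (\<Sum>m=1..n. (real m)\<^sup>2)"
    using c \<tau> by (intro mult_left_mono sum_squares_ge) auto
  also have "\<dots> = (\<Sum>m=1..n. \<tau> * (c * (\<tau> * real m)\<^sup>2))"
    by (simp add: sum_distrib_left power_mult_distrib power2_eq_square power3_eq_cube mult_ac)
  finally have "c * (\<tau> * real n) ^ 3 / 3 \<le> (\<Sum>m=1..n. \<tau> * (c * (\<tau> * real m)\<^sup>2))" .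
  moreover have "\<tau> * real n * \<eta> \<le> 1 * \<eta>" using n \<eta> by (intro mult_right_mono) auto
  moreover have "(\<Sum>m=1..n. \<tau> * (c * (\<tau> * real m)\<^sup>2)) + (\<Sum>m=1..n. \<tau> * F m) - \<tau> * real n * \<eta> =
      (\<Sum>m=1..n. \<tau> * (c * (\<tau> * real m)\<^sup>2 + F m - \<eta>))"
    by (simp add: sum.distrib sum_subtractf distrib_left right_diff_distrib mult_ac)
  moreover have "(\<Sum>m=1..n. \<tau> * (c * (\<tau> * real m)\<^sup>2 + F m - \<eta>)) \<le> (\<Sum>m=1..n. \<tau> * \<bar>Z m\<bar>)"
    using Z \<tau> by (intro sum_mono mult_left_mono) auto
  ultimately show ?thesis using F by linarith
qed

section \<open>The error of a single mode\<close>

text \<open>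
  A stable mesh together with a mode that it resolves: \<open>k h \<le> \<epsilon>\<close> is the range of validity of the
  dispersion estimate.
\<close>

locale mesh_mode =
  fixes T \<epsilon> :: real and N M k :: nat
  assumes T: "0 < T" and \<epsilon>: "0 < \<epsilon>" "\<epsilon> \<le> 1"
    and stable: "stable_mesh T \<epsilon> N M"
    and k: "4 \<le> k" "real k * (pi / real N) \<le> \<epsilon>"
begin

definition "h = pi / real N"
definition "\<tau> = T / real M"
definition "\<theta> = phase h \<tau> (real k)"
definition "B = B_symbol h \<tau> (real k)"
definition "g = frequency_defect h \<tau> (real k)"

lemma mesh: "0 < N" "0 < M" "0 < h" "0 < \<tau>" "\<tau>\<^sup>2 \<le> (1 - \<epsilon>\<^sup>2 / 2) * h\<^sup>2" "\<tau>\<^sup>2 \<le> h\<^sup>2" "\<tau> \<le> h"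
  and mesh_unfolded: "(T / real M)\<^sup>2 \<le> (pi / real N)\<^sup>2"
proof -
  show 1: "0 < N" "0 < M" "0 < h" "0 < \<tau>" "\<tau>\<^sup>2 \<le> (1 - \<epsilon>\<^sup>2 / 2) * h\<^sup>2"
    using stable T by (auto simp: stable_mesh_def h_def \<tau>_def)
  have "(1 - \<epsilon>\<^sup>2 / 2) * h\<^sup>2 \<le> 1 * h\<^sup>2" by (intro mult_right_mono) auto
  then show 2: "\<tau>\<^sup>2 \<le> h\<^sup>2" using 1 by linarith
  show "\<tau> \<le> h" by (rule power2_le_imp_le[OF 2]) (use 1 in simp)
  show "(T / real M)\<^sup>2 \<le> (pi / real N)\<^sup>2" using 2 by (simp add: h_def \<tau>_def)
qed

lemma kh: "real k * h \<le> \<epsilon>" "real k * h \<le> 1" "real k * \<tau> \<le> 1" "real k * \<tau> \<le> real k * h" "k < N"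
proof -
  show 1: "real k * h \<le> \<epsilon>" using k by (simp add: h_def)
  then show 2: "real k * h \<le> 1" using \<epsilon> by simp
  show 3: "real k * \<tau> \<le> real k * h" using mesh by (intro mult_left_mono) auto
  then show "real k * \<tau> \<le> 1" using 2 by simp
  have "real k * pi \<le> real N" using 2 mesh by (simp add: h_def field_simps)
  moreover have "real k * 1 < real k * pi" using k pi_gt3 by (intro mult_strict_left_mono) auto
  ultimately show "k < N" by simp
qed

lemma phase_facts:
  "2 / 3 \<le> B" "B \<le> 1" "0 < \<theta>" "\<theta> \<le> real k * \<tau>" "0 < sin \<theta>"
  "B * (2 - 2 * cos \<theta>) = \<tau>\<^sup>2 * lap_symbol h (real k)"
  "\<epsilon>\<^sup>2 / 7680 * (real k ^ 5 * h ^ 4) \<le> g" "g \<le> (real k ^ 5 * h ^ 4) / 160"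
  "\<theta> = \<tau> * (real k - g)"
proof -
  have k0: "0 < real k" using k by simp
  note * = phase_and_frequency_defect[OF mesh(3,4,5) \<epsilon> k0 kh(1), folded \<theta>_def B_def g_def]
  show "2 / 3 \<le> B" "B \<le> 1" "0 < \<theta>" "\<theta> \<le> real k * \<tau>"
    "B * (2 - 2 * cos \<theta>) = \<tau>\<^sup>2 * lap_symbol h (real k)"
    "\<epsilon>\<^sup>2 / 7680 * (real k ^ 5 * h ^ 4) \<le> g" "g \<le> (real k ^ 5 * h ^ 4) / 160"
    using * by auto
  show "0 < sin \<theta>" using * kh pi_gt3 by (intro sin_gt_zero) auto
  show "\<theta> = \<tau> * (real k - g)"
    using mesh by (simp add: g_def frequency_defect_def \<theta>_def)
qed

lemma oscillation_step:
  assumes "1 \<le> m"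
  shows "B * Lambda_t \<tau> (\<lambda>m. A * sin (\<theta> * real m + \<psi>)) m + lap_symbol h (real k) * (A * sin (\<theta> * real m + \<psi>)) = 0"
proof -
  have "lap_symbol h (real k) = B * ((2 - 2 * cos \<theta>) / \<tau>\<^sup>2)"
    using phase_facts(6) mesh(4) by (simp add: field_simps)
  then show ?thesis unfolding Lambda_t_oscillation[OF assms] by simp
qed

lemma node: "i \<le> N \<Longrightarrow> real i * (pi / real N) \<in> {0..pi}" "m \<le> M \<Longrightarrow> real m * (T / real M) \<in> {0..T}"
  using mesh(1,2) T by (auto simp: field_simps)

lemma scheme_error_initial_value:
  assumes U: "\<And>i. i \<in> {1..<N} \<Longrightarrow> U N M (\<lambda>x. 0) i = 0" and im: "i \<le> N" "m \<le> M"
  shows "scheme_error T U N M (\<lambda>x. sin (real k * x)) (\<lambda>x. 0) (\<lambda>x t. 0) i m =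
    sin (real k * (real i * h)) * (cos (real k * \<tau> * real m) - cos (\<theta> * real m))"
proof -
  have cos_eq: "cos z = 1 * sin (z + pi / 2)" for z by (simp add: sin_add)
  have "is_scheme_solution T N M (\<lambda>x. sin (real k * x)) (U N M (\<lambda>x. 0)) (\<lambda>x t. 0)
      (\<lambda>i m. sin (real k * (real i * (pi / real N))) * cos (\<theta> * real m))"
  proof (rule is_scheme_solution_separated[where g = "\<lambda>m. 0" and ?g1.0 = 0], unfold h_def[symmetric] \<tau>_def[symmetric] B_def[symmetric])
    have "B * (cos \<theta> - 1) = - \<tau>\<^sup>2 * lap_symbol h (real k) / 2"
      using phase_facts(6) by (simp add: algebra_simps)
    then have "B * ((cos \<theta> - 1) / \<tau>) = - \<tau>\<^sup>2 * lap_symbol h (real k) / 2 / \<tau>"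
      by (simp only: times_divide_eq_right)
    then show "B * ((cos (\<theta> * real 1) - cos (\<theta> * real 0)) / \<tau>) + \<tau> / 2 * lap_symbol h (real k) * cos (\<theta> * real 0) = 0 + \<tau> / 2 * 0"
      using mesh(4) by (simp add: power2_eq_square)
    show "B * Lambda_t \<tau> (\<lambda>m. cos (\<theta> * real m)) m + lap_symbol h (real k) * cos (\<theta> * real m) = 0" if "1 \<le> m" for m
      unfolding cos_eq by (rule oscillation_step[OF that])
  qed (use mesh U in auto)
  from scheme_solution_eqI[OF this mesh(1,2) T mesh_unfolded im] show ?thesis
    unfolding scheme_error_def wave_solution_initial_value[OF T node(1)[OF im(1)] node(2)[OF im(2)]]
    by (simp add: h_def \<tau>_def mult_ac right_diff_distrib)
qed

text \<open>
  Amplitude of the discrete wave relative to the exact amplitude \<open>1 / k\<close>; \<open>a\<close> is the symbol of the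
  approximation of the initial velocity.
\<close>

definition "velocity_amplitude a = real k * \<tau> * a / (B * sin \<theta>)"

lemma scheme_error_initial_velocity:
  assumes U: "\<And>i. i \<in> {1..<N} \<Longrightarrow> U N M (\<lambda>x. sin (real k * x)) i = a * sin (real k * (real i * (pi / real N)))"
    and im: "i \<le> N" "m \<le> M"
  shows "scheme_error T U N M (\<lambda>x. 0) (\<lambda>x. sin (real k * x)) (\<lambda>x t. 0) i m =
    sin (real k * (real i * h)) * ((sin (real k * \<tau> * real m) - velocity_amplitude a * sin (\<theta> * real m)) / real k)"
proof -
  define A where "A = \<tau> * a / (B * sin \<theta>)"
  have "is_scheme_solution T N M (\<lambda>x. 0) (U N M (\<lambda>x. sin (real k * x))) (\<lambda>x t. 0)
      (\<lambda>i m. sin (real k * (real i * (pi / real N))) * (A * sin (\<theta> * real m)))"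
  proof (rule is_scheme_solution_separated[where g = "\<lambda>m. 0" and ?g1.0 = a], unfold h_def[symmetric] \<tau>_def[symmetric] B_def[symmetric])
    show "B * ((A * sin (\<theta> * real 1) - A * sin (\<theta> * real 0)) / \<tau>) + \<tau> / 2 * lap_symbol h (real k) * (A * sin (\<theta> * real 0)) = a + \<tau> / 2 * 0"
      using mesh(4) phase_facts(1,5) by (simp add: A_def)
    show "B * Lambda_t \<tau> (\<lambda>m. A * sin (\<theta> * real m)) m + lap_symbol h (real k) * (A * sin (\<theta> * real m)) = 0" if "1 \<le> m" for m
      using oscillation_step[OF that, of A 0] by simp
  qed (use mesh U in \<open>auto simp: h_def\<close>)
  from scheme_solution_eqI[OF this mesh(1,2) T mesh_unfolded im] show ?thesis
    using wave_solution_initial_velocity[OF T node(1)[OF im(1)] node(2)[OF im(2)], of k] k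
    unfolding scheme_error_def
    by (simp add: h_def \<tau>_def mult_ac right_diff_distrib diff_divide_distrib velocity_amplitude_def A_def)
qed

text \<open>
  For the forcing \<open>sin (k x) sin (\<kappa> t)\<close> the discrete solution is a stationary response of frequency
  \<open>\<kappa>\<close> plus a free oscillation with phase \<open>\<theta>\<close> per step, whose amplitude is fixed by the first two time levels.
\<close>

definition "\<kappa> = real (k - 1)"
definition "forcing_response = hat_symbol (real k * h) * hat_symbol (\<kappa> * \<tau>) /
  (lap_symbol h (real k) - B * ((2 - 2 * cos (\<kappa> * \<tau>)) / \<tau>\<^sup>2))"
definition "free_response =
  (\<tau>\<^sup>2 * forcing_factor h \<tau> (real k) \<kappa> 0 / (2 * B) - forcing_response * sin (\<kappa> * \<tau>)) / sin \<theta>"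

lemma \<kappa>: "\<kappa> = real k - 1" "3 \<le> \<kappa>"
  using k by (auto simp: \<kappa>_def of_nat_diff)

lemma scheme_error_forcing:
  assumes U: "\<And>i. i \<in> {1..<N} \<Longrightarrow> U N M (\<lambda>x. 0) i = 0" and im: "i \<le> N" "m \<le> M"
    and nonres: "lap_symbol h (real k) \<noteq> B * ((2 - 2 * cos (\<kappa> * \<tau>)) / \<tau>\<^sup>2)"
  shows "scheme_error T U N M (\<lambda>x. 0) (\<lambda>x. 0) (\<lambda>x t. sin (real k * x) * sin (real (k - 1) * t)) i m =
    sin (real k * (real i * h)) *
      (((real k / (2 * real k - 1) - real k * forcing_response) * sin (\<kappa> * \<tau> * real m)
       - \<kappa> / (2 * real k - 1) * sin (real k * \<tau> * real m)
       + - real k * free_response * sin (\<theta> * real m)) / real k)"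
proof -
  let ?\<alpha> = forcing_response and ?\<beta> = free_response
  let ?f = "\<lambda>x t. sin (real k * x) * sin (\<kappa> * t)"
  let ?y = "\<lambda>m. ?\<alpha> * sin (\<kappa> * \<tau> * real m) + ?\<beta> * sin (\<theta> * real m)"
  have "is_scheme_solution T N M (\<lambda>x. 0) (U N M (\<lambda>x. 0)) ?f
      (\<lambda>i m. sin (real k * (real i * (pi / real N))) * ?y m)"
  proof (rule is_scheme_solution_separated[where g = "forcing_factor h \<tau> (real k) \<kappa>" and ?g1.0 = 0],
      unfold h_def[symmetric] \<tau>_def[symmetric] B_def[symmetric])
    have "?\<alpha> * sin (\<kappa> * \<tau>) + ?\<beta> * sin \<theta> = \<tau>\<^sup>2 * forcing_factor h \<tau> (real k) \<kappa> 0 / (2 * B)"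
      using phase_facts(5) by (simp add: free_response_def)
    then show "B * ((?y 1 - ?y 0) / \<tau>) + \<tau> / 2 * lap_symbol h (real k) * ?y 0 = 0 + \<tau> / 2 * forcing_factor h \<tau> (real k) \<kappa> 0"
      using mesh(4) phase_facts(1) by (simp add: power2_eq_square)
    show "B * Lambda_t \<tau> ?y m + lap_symbol h (real k) * ?y m = forcing_factor h \<tau> (real k) \<kappa> m" if m: "1 \<le> m" for m
    proof -
      have "B * Lambda_t \<tau> (\<lambda>m. ?\<beta> * sin (\<theta> * real m)) m + lap_symbol h (real k) * (?\<beta> * sin (\<theta> * real m)) = 0"
        using oscillation_step[OF m, of ?\<beta> 0] by simp
      moreover have "Lambda_t \<tau> (\<lambda>m. ?\<alpha> * sin (\<kappa> * \<tau> * real m)) m = - ((2 - 2 * cos (\<kappa> * \<tau>)) / \<tau>\<^sup>2) * (?\<alpha> * sin (\<kappa> * \<tau> * real m))"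
        using Lambda_t_oscillation[OF m, of \<tau> ?\<alpha> "\<kappa> * \<tau>" 0] by simp
      ultimately have "B * Lambda_t \<tau> ?y m + lap_symbol h (real k) * ?y m =
          (lap_symbol h (real k) - B * ((2 - 2 * cos (\<kappa> * \<tau>)) / \<tau>\<^sup>2)) * ?\<alpha> * sin (\<kappa> * \<tau> * real m)"
        unfolding Lambda_t_add by (simp only: distrib_left left_diff_distrib)
      also have "(lap_symbol h (real k) - B * ((2 - 2 * cos (\<kappa> * \<tau>)) / \<tau>\<^sup>2)) * ?\<alpha> = hat_symbol (real k * h) * hat_symbol (\<kappa> * \<tau>)"
        using nonres by (simp add: forcing_response_def)
      also have "\<dots> * sin (\<kappa> * \<tau> * real m) = forcing_factor h \<tau> (real k) \<kappa> m"
        using m by (simp add: forcing_factor_def mult_ac)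
      finally show ?thesis .
    qed
    show "f_mesh h \<tau> ?f i m = forcing_factor h \<tau> (real k) \<kappa> m * sin (real k * (real i * h))" for i m
      using mesh k \<kappa> by (intro f_mesh_sine) auto
  qed (use mesh U in auto)
  note scheme = scheme_solution_eqI[OF this mesh(1,2) T mesh_unfolded im]
  note exact = wave_solution_forcing[OF T node(1)[OF im(1)] node(2)[OF im(2)], of k]
  have alg: "(s1 - \<kappa> / K * s2) / D - (\<alpha> * s1 + \<beta> * s3) = ((K / D - K * \<alpha>) * s1 - \<kappa> / D * s2 + - K * \<beta> * s3) / K"
    if "K \<noteq> 0" "D \<noteq> 0" for s1 s2 s3 K D \<alpha> \<beta> :: real
    using that by (simp add: field_simps)
  have "scheme_error T U N M (\<lambda>x. 0) (\<lambda>x. 0) (\<lambda>x t. sin (real k * x) * sin (\<kappa> * t)) i m =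
    sin (real k * (real i * h)) * ((sin (\<kappa> * (real m * \<tau>)) - \<kappa> / real k * sin (real k * (real m * \<tau>))) / (2 * real k - 1) - ?y m)"
    using scheme exact k unfolding scheme_error_def \<kappa>_def[symmetric] h_def[symmetric] \<tau>_def[symmetric]
    by (simp only: right_diff_distrib)
  also have "\<kappa> * (real m * \<tau>) = \<kappa> * \<tau> * real m" by simp
  also have "real k * (real m * \<tau>) = real k * \<tau> * real m" by simp
  also have "(sin (\<kappa> * \<tau> * real m) - \<kappa> / real k * sin (real k * \<tau> * real m)) / (2 * real k - 1) - ?y m =
     ((real k / (2 * real k - 1) - real k * ?\<alpha>) * sin (\<kappa> * \<tau> * real m)
       - \<kappa> / (2 * real k - 1) * sin (real k * \<tau> * real m) + - real k * ?\<beta> * sin (\<theta> * real m)) / real k"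
    using k by (intro alg) auto
  finally show ?thesis unfolding \<kappa>_def[symmetric] .
qed

end

section \<open>Beats between exact and discrete waves\<close>

text \<open>
  Near \<open>t = 0\<close> the right-hand sides behave like \<open>g\<^sup>2 t\<^sup>2 / 4\<close> and \<open>g t\<^sup>2 / 8\<close>; the common
  minorant is smaller than both.
\<close>

lemma slow_beat_ge:
  fixes g t :: real
  assumes "0 \<le> g" "g \<le> 1 / 4" "0 \<le> t" "t \<le> 1"
  shows "g\<^sup>2 / 12 * t\<^sup>2 \<le> (1 - cos (g * t)) / 2"
    and "g\<^sup>2 / 12 * t\<^sup>2 \<le> (g * (1 - cos t) - (1 - cos (g * t))) / (4 * (1 - g))"
proof -
  have gt: "0 \<le> g * t" "g * t \<le> 1" using assms mult_mono[of g 1 t 1] by auto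
  have sq: "0 \<le> t\<^sup>2" "0 \<le> g * t\<^sup>2" "g * (g * t\<^sup>2) \<le> 1 / 4 * (g * t\<^sup>2)"
  proof -
    show "0 \<le> t\<^sup>2" "0 \<le> g * t\<^sup>2" using assms by auto
    then show "g * (g * t\<^sup>2) \<le> 1 / 4 * (g * t\<^sup>2)" using assms by (intro mult_right_mono) auto
  qed
  have "11 / 24 * (g * t)\<^sup>2 \<le> 1 - cos (g * t)" using gt by (intro one_minus_cos_ge) auto
  moreover have "g\<^sup>2 / 12 * t\<^sup>2 = (g * t)\<^sup>2 / 12" by (simp add: power_mult_distrib)
  moreover have "q / 12 \<le> c / 2" if "11 / 24 * q \<le> c" "0 \<le> q" for q c :: real
    using that by linarith
  ultimately show "g\<^sup>2 / 12 * t\<^sup>2 \<le> (1 - cos (g * t)) / 2"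
    by (metis zero_le_power2)
  have "g * (11 / 24 * t\<^sup>2) \<le> g * (1 - cos t)"
    using assms by (intro mult_left_mono one_minus_cos_ge) auto
  moreover have "1 - cos (g * t) \<le> g * (g * t\<^sup>2) / 2"
    using one_minus_cos_le[of "g * t"] by (simp add: power2_eq_square mult_ac)
  ultimately have num: "g * t\<^sup>2 / 3 \<le> g * (1 - cos t) - (1 - cos (g * t))"
    using sq by linarith
  have "g\<^sup>2 / 12 * t\<^sup>2 \<le> g * t\<^sup>2 / 3 / 4"
    using sq by (simp add: power2_eq_square)
  also have "\<dots> \<le> (g * (1 - cos t) - (1 - cos (g * t))) / 4"
    using num by (rule divide_right_mono) simp
  also have "\<dots> \<le> (g * (1 - cos t) - (1 - cos (g * t))) / (4 * (1 - g))"
  proof (rule divide_left_mono)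
    show "0 \<le> g * (1 - cos t) - (1 - cos (g * t))" using num sq(2) by linarith
  qed (use assms in auto)
  finally show "g\<^sup>2 / 12 * t\<^sup>2 \<le> (g * (1 - cos t) - (1 - cos (g * t))) / (4 * (1 - g))" .
qed

lemma abs_three_cos_sum_le:
  assumes "0 < \<tau>" "0 < k" "\<And>\<nu>. \<nu> \<in> {\<nu>1, \<nu>2, \<nu>3} \<Longrightarrow> k * \<tau> \<le> \<nu> \<and> \<nu> \<le> 2"
    and "\<bar>a1\<bar> \<le> 1" "\<bar>a2\<bar> \<le> 1" "\<bar>a3\<bar> \<le> 1"
  shows "\<bar>\<Sum>m=1..n. \<tau> * (a1 * cos (\<nu>1 * real m) + a2 * cos (\<nu>2 * real m) + a3 * cos (\<nu>3 * real m))\<bar> \<le> 12 / k"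
proof -
  define S where "S \<nu> = (\<Sum>m=1..n. \<tau> * cos (\<nu> * real m))" for \<nu>
  have S: "\<bar>a * S \<nu>\<bar> \<le> 4 / k" if "\<nu> \<in> {\<nu>1, \<nu>2, \<nu>3}" "\<bar>a\<bar> \<le> 1" for a \<nu>
  proof -
    have "\<bar>S \<nu>\<bar> \<le> 4 / k"
      using abs_weighted_cos_sum_le[of \<tau> k \<nu> 0 n] assms(1,2) assms(3)[OF that(1)] by (simp add: S_def)
    then have "\<bar>a\<bar> * \<bar>S \<nu>\<bar> \<le> 1 * (4 / k)" using that by (intro mult_mono) auto
    then show ?thesis by (simp add: abs_mult)
  qed
  have "(\<Sum>m=1..n. \<tau> * (a1 * cos (\<nu>1 * real m) + a2 * cos (\<nu>2 * real m) + a3 * cos (\<nu>3 * real m))) =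
      a1 * S \<nu>1 + a2 * S \<nu>2 + a3 * S \<nu>3"
    by (simp add: S_def sum_distrib_left sum.distrib distrib_left mult_ac)
  then show ?thesis
    using S[of \<nu>1 a1] S[of \<nu>2 a2] S[of \<nu>3 a3] assms by simp
qed

lemma mult_le_abs_of_bounded: "y * s \<le> \<bar>y\<bar>" if "\<bar>s\<bar> \<le> 1" for y s :: real
proof -
  have "y * s \<le> \<bar>y\<bar> * \<bar>s\<bar>" by (metis abs_ge_self abs_mult)
  also have "\<dots> \<le> \<bar>y\<bar> * 1" using that by (intro mult_left_mono) auto
  finally show ?thesis by simp
qed

context mesh_mode
begin

lemma fast_frequencies:
  assumes "\<nu> \<in> {2 * (real k * \<tau>), real k * \<tau> + \<theta>, real k * \<tau> + \<kappa> * \<tau>}"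
  shows "real k * \<tau> \<le> \<nu> \<and> \<nu> \<le> 2"
proof -
  have "0 \<le> \<kappa> * \<tau>" "\<kappa> * \<tau> \<le> real k * \<tau>"
    using mesh \<kappa> by (auto intro!: mult_right_mono)
  moreover have "0 \<le> real k * \<tau>" using mesh by simp
  moreover note assms phase_facts(3,4) kh(3)
  ultimately show ?thesis
    by (elim insertE emptyE; intro conjI; linarith)
qed

lemma beat_phase: "real k * \<tau> * real m - \<theta> * real m = g * (\<tau> * real m)"
  by (simp add: phase_facts(9) algebra_simps)

context
  fixes n :: nat
  assumes g: "0 \<le> g" "g \<le> 1 / 4" and n: "\<tau> * real n \<le> 1"
begin

lemma time_le:
  assumes "m \<in> {1..n}"
  shows "0 \<le> \<tau> * real m" "\<tau> * real m \<le> 1"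
proof -
  have "\<tau> * real m \<le> \<tau> * real n" using assms mesh(4) by (intro mult_left_mono) auto
  then show "\<tau> * real m \<le> 1" using n by linarith
  show "0 \<le> \<tau> * real m" using mesh(4) by simp
qed

text \<open>
  For \<open>x = k t\<close>, \<open>y = \<mu> t\<close> the test factor \<open>cos x\<close> gives
  \<open>(cos x - cos y) cos x = (1 - cos (x - y)) / 2 + (cos (2 x) - cos (x + y)) / 2\<close>, where
  \<open>x - y = g t\<close> is slow.  The next two lemmas test with \<open>sin x\<close> in the same way.
\<close>

lemma initial_value_beat:
  "g\<^sup>2 / 12 * (\<tau> * real n) ^ 3 / 3 - 12 / real k
    \<le> (\<Sum>m=1..n. \<tau> * \<bar>cos (real k * \<tau> * real m) - cos (\<theta> * real m)\<bar>)"
proof -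
  let ?F = "\<lambda>m. 1 / 2 * cos (2 * (real k * \<tau>) * real m) + - 1 / 2 * cos ((real k * \<tau> + \<theta>) * real m) + 0 * cos ((real k * \<tau> + \<kappa> * \<tau>) * real m)"
  have "g\<^sup>2 / 12 * (\<tau> * real n) ^ 3 / 3 - 12 / real k - 0
    \<le> (\<Sum>m=1..n. \<tau> * \<bar>cos (real k * \<tau> * real m) - cos (\<theta> * real m)\<bar>)"
  proof (rule weighted_sum_ge[where F = ?F])
    show "\<bar>\<Sum>m=1..n. \<tau> * ?F m\<bar> \<le> 12 / real k"
      using fast_frequencies mesh(4) k by (intro abs_three_cos_sum_le) auto
    fix m assume m: "m \<in> {1..n}"
    define x y where "x = real k * \<tau> * real m" and "y = \<theta> * real m"
    have gt: "g * (\<tau> * real m) = x - y" by (simp only: beat_phase[symmetric] x_def y_def)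
    have "g\<^sup>2 / 12 * (\<tau> * real m)\<^sup>2 + ?F m - 0 \<le> (1 - cos (g * (\<tau> * real m))) / 2 + ?F m"
      using slow_beat_ge(1)[OF g, of "\<tau> * real m"] time_le[OF m] by linarith
    also have "\<dots> = (1 - cos (x - y)) / 2 + (1 / 2 * cos (2 * x) - 1 / 2 * cos (x + y))"
      unfolding gt by (simp add: x_def y_def mult_ac distrib_left distrib_right)
    also have "\<dots> = (cos x - cos y) * cos x"
      using cos_double_cos[of x] by (simp add: cos_diff cos_add field_simps power2_eq_square)
    also have "\<dots> \<le> \<bar>cos x - cos y\<bar>" by (intro mult_le_abs_of_bounded) simp
    finally show "g\<^sup>2 / 12 * (\<tau> * real m)\<^sup>2 + ?F m - 0 \<le> \<bar>cos (real k * \<tau> * real m) - cos (\<theta> * real m)\<bar>"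
      by (simp add: x_def y_def)
  qed (use mesh(4) n in auto)
  then show ?thesis by simp
qed

lemma initial_velocity_beat:
  "g\<^sup>2 / 12 * (\<tau> * real n) ^ 3 / 3 - 12 / real k - \<bar>A - 1\<bar>
    \<le> (\<Sum>m=1..n. \<tau> * \<bar>sin (real k * \<tau> * real m) - A * sin (\<theta> * real m)\<bar>)"
proof -
  let ?F = "\<lambda>m. - 1 / 2 * cos (2 * (real k * \<tau>) * real m) + 1 / 2 * cos ((real k * \<tau> + \<theta>) * real m) + 0 * cos ((real k * \<tau> + \<kappa> * \<tau>) * real m)"
  show ?thesis
  proof (rule weighted_sum_ge[where F = ?F])
    show "\<bar>\<Sum>m=1..n. \<tau> * ?F m\<bar> \<le> 12 / real k"
      using fast_frequencies mesh(4) k by (intro abs_three_cos_sum_le) auto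
    fix m assume m: "m \<in> {1..n}"
    define x y where "x = real k * \<tau> * real m" and "y = \<theta> * real m"
    have gt: "g * (\<tau> * real m) = x - y" by (simp only: beat_phase[symmetric] x_def y_def)
    have "g\<^sup>2 / 12 * (\<tau> * real m)\<^sup>2 + ?F m \<le> (1 - cos (g * (\<tau> * real m))) / 2 + ?F m"
      using slow_beat_ge(1)[OF g, of "\<tau> * real m"] time_le[OF m] by linarith
    also have "\<dots> = (1 - cos (x - y)) / 2 + (- 1 / 2 * cos (2 * x) + 1 / 2 * cos (x + y))"
      unfolding gt by (simp add: x_def y_def mult_ac distrib_left distrib_right)
    also have "\<dots> = (sin x - sin y) * sin x"
      using cos_double_sin[of x] by (simp add: cos_diff cos_add field_simps power2_eq_square)
    also have "\<dots> \<le> \<bar>sin x - sin y\<bar>" by (intro mult_le_abs_of_bounded) simp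
    also have "\<dots> \<le> \<bar>sin x - A * sin y\<bar> + \<bar>(A - 1) * sin y\<bar>"
      using abs_triangle_ineq[of "sin x - A * sin y" "(A - 1) * sin y"] by (simp add: algebra_simps)
    also have "\<bar>(A - 1) * sin y\<bar> \<le> \<bar>A - 1\<bar> * 1"
      unfolding abs_mult by (intro mult_left_mono) auto
    finally show "g\<^sup>2 / 12 * (\<tau> * real m)\<^sup>2 + ?F m - \<bar>A - 1\<bar> \<le> \<bar>sin (real k * \<tau> * real m) - A * sin (\<theta> * real m)\<bar>"
      by (simp add: x_def y_def)
  qed (use mesh(4) n in auto)
qed

text \<open>
  The centres of \<open>A1\<close>, \<open>A2\<close>, \<open>A3\<close> are the asymptotic values of \<open>k\<close> times the amplitudes of the error: \<open>1 / 2\<close> for the exact response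
  and the exact free wave, \<open>1 / (2 (1 - g))\<close> for the discrete ones, so the two responses of the same
  frequency \<open>\<kappa>\<close> combine to \<open>1 / 2 - 1 / (2 (1 - g)) = - g / (2 (1 - g))\<close>.
\<close>

lemma forcing_beat:
  assumes A1: "\<bar>A1 + g / (2 * (1 - g))\<bar> \<le> \<eta>" and A2: "\<bar>A2 - 1 / 2\<bar> \<le> \<eta>" and A3: "\<bar>A3 - 1 / (2 * (1 - g))\<bar> \<le> \<eta>"
  shows "g\<^sup>2 / 12 * (\<tau> * real n) ^ 3 / 3 - 12 / real k - 3 * \<eta>
    \<le> (\<Sum>m=1..n. \<tau> * \<bar>A1 * sin (\<kappa> * \<tau> * real m) - A2 * sin (real k * \<tau> * real m) + A3 * sin (\<theta> * real m)\<bar>)"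
proof -
  define D where "D = 2 * (1 - g)"
  have D: "3 / 2 \<le> D" "D \<le> 2" "D \<noteq> 0" "2 - 2 * g = D" using g by (auto simp: D_def)
  let ?F = "\<lambda>m. 1 / 4 * cos (2 * (real k * \<tau>) * real m) + - 1 / (2 * D) * cos ((real k * \<tau> + \<theta>) * real m) + g / (2 * D) * cos ((real k * \<tau> + \<kappa> * \<tau>) * real m)"
  show ?thesis
  proof (rule weighted_sum_ge[where F = ?F])
    show "\<bar>\<Sum>m=1..n. \<tau> * ?F m\<bar> \<le> 12 / real k"
      using fast_frequencies mesh(4) k D g by (intro abs_three_cos_sum_le) auto
    fix m assume m: "m \<in> {1..n}"
    define x y z where "x = real k * \<tau> * real m" and "y = \<theta> * real m" and "z = \<kappa> * \<tau> * real m"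
    have zx: "\<tau> * real m = x - z" by (simp add: x_def z_def \<kappa> algebra_simps)
    have gt: "g * (x - z) = x - y" unfolding zx[symmetric] beat_phase[symmetric] by (simp add: x_def y_def)
    have "g\<^sup>2 / 12 * (\<tau> * real m)\<^sup>2 + ?F m \<le>
        (g * (1 - cos (\<tau> * real m)) - (1 - cos (g * (\<tau> * real m)))) / (4 * (1 - g)) + ?F m"
      using slow_beat_ge(2)[OF g, of "\<tau> * real m"] time_le[OF m] by linarith
    also have "\<dots> = (g * (1 - cos (x - z)) - (1 - cos (x - y))) / (2 * D) +
        (1 / 4 * cos (2 * x) - cos (x + y) / (2 * D) + g * cos (x + z) / (2 * D))"
      unfolding zx gt by (simp add: x_def y_def z_def D_def mult_ac distrib_left distrib_right)
    also have "\<dots> = (- g / D * sin z - 1 / 2 * sin x + 1 / D * sin y) * sin x"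
    proof -
      have g1: "g - 1 = - (D / 2)" using D(4) by linarith
      have "(g * (1 - cos (x - z)) - (1 - cos (x - y))) / (2 * D) +
        (1 / 4 * cos (2 * x) - cos (x + y) / (2 * D) + g * cos (x + z) / (2 * D)) =
        (g - 1) / (2 * D) + 1 / 4 * cos (2 * x) + (cos (x - y) - cos (x + y)) / (2 * D) - g * (cos (x - z) - cos (x + z)) / (2 * D)"
        using D by (simp add: field_simps)
      also have "(g - 1) / (2 * D) = - 1 / 4" unfolding g1 using D(3) by simp
      also have "- 1 / 4 + 1 / 4 * cos (2 * x) = - 1 / 2 * sin x * sin x"
        using cos_double_sin[of x] by (simp add: power2_eq_square field_simps)
      also have "cos (x - y) - cos (x + y) = 2 * (sin x * sin y)" by (simp add: cos_diff cos_add)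
      also have "cos (x - z) - cos (x + z) = 2 * (sin x * sin z)" by (simp add: cos_diff cos_add)
      finally show ?thesis by (rule trans) (simp add: algebra_simps)
    qed
    also have "\<dots> \<le> \<bar>- g / D * sin z - 1 / 2 * sin x + 1 / D * sin y\<bar>" by (intro mult_le_abs_of_bounded) simp
    also have "\<dots> \<le> \<bar>A1 * sin z - A2 * sin x + A3 * sin y\<bar> + 3 * \<eta>"
    proof -
      have small: "\<bar>d * sin w\<bar> \<le> \<eta>" if "\<bar>d\<bar> \<le> \<eta>" for d w
      proof -
        have "\<bar>d\<bar> * \<bar>sin w\<bar> \<le> \<eta> * 1" using that by (intro mult_mono) auto
        then show ?thesis by (simp add: abs_mult)
      qed
      have "\<bar>(A1 + g / D) * sin z\<bar> \<le> \<eta>" "\<bar>(A2 - 1 / 2) * sin x\<bar> \<le> \<eta>" "\<bar>(A3 - 1 / D) * sin y\<bar> \<le> \<eta>"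
        using A1 A2 A3 by (auto intro!: small simp: D_def)
      moreover have "- g / D * sin z - 1 / 2 * sin x + 1 / D * sin y =
          (A1 * sin z - A2 * sin x + A3 * sin y) - (A1 + g / D) * sin z + (A2 - 1 / 2) * sin x - (A3 - 1 / D) * sin y"
        by (simp add: algebra_simps)
      moreover have "\<bar>P - a + b - c\<bar> \<le> \<bar>P\<bar> + 3 * \<eta>" if "\<bar>a\<bar> \<le> \<eta>" "\<bar>b\<bar> \<le> \<eta>" "\<bar>c\<bar> \<le> \<eta>" for P a b c
        using that by linarith
      ultimately show ?thesis by presburger
    qed
    finally show "g\<^sup>2 / 12 * (\<tau> * real m)\<^sup>2 + ?F m - 3 * \<eta> \<le>
        \<bar>A1 * sin (\<kappa> * \<tau> * real m) - A2 * sin (real k * \<tau> * real m) + A3 * sin (\<theta> * real m)\<bar>"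
      by (simp add: x_def y_def z_def)
  qed (use mesh(4) n A1 in auto)
qed

end

lemma L1_error_ge:
  assumes l: "l \<in> {0, 1}" and n: "n \<le> M"
    and e: "\<And>i m. i \<le> N \<Longrightarrow> m \<le> M \<Longrightarrow> e i m = sin (real k * (real i * h)) * Y m"
    and s: "s \<le> (\<Sum>m=1..n. \<tau> * \<bar>Y m\<bar>)" "0 \<le> s"
  shows "real k ^ l / 4 * s \<le> L1_norm_bdelta l T N M e"
proof -
  define X where "X = (if l = 0 then L1h_norm N h (\<lambda>i. sin (real k * (real i * h)))
      else L1h_norm_diff N h (bdelta_x h (\<lambda>i. sin (real k * (real i * h)))))"
  have "L1_norm_bdelta l T N M e = X * L1h_norm M \<tau> Y"
    unfolding X_def h_def \<tau>_def by (rule L1_norm_bdelta_separated) (rule e[unfolded h_def])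
  moreover have "s / 2 \<le> L1h_norm M \<tau> Y"
    using half_sum_le_L1h_norm[OF mesh(4) n, of Y] s by linarith
  moreover have "real k ^ l / 2 \<le> X"
    unfolding X_def using mesh(1) k kh(2) by (intro space_factor_ge[OF _ _ _ h_def l]) auto
  moreover from this have "0 \<le> X" by (rule order_trans[rotated]) simp
  ultimately have "real k ^ l / 2 * (s / 2) \<le> L1_norm_bdelta l T N M e"
    using s(2) by (metis mult_mono divide_nonneg_nonneg zero_le_numeral)
  then show ?thesis by simp
qed

end

section \<open>Limits of the discrete amplitudes\<close>

lemma tendsto_sin_over_self:
  fixes f :: "'a \<Rightarrow> real"
  assumes "(f \<longlongrightarrow> 0) F" "\<forall>\<^sub>F p in F. f p \<noteq> 0"
  shows "((\<lambda>p. sin (f p) / f p) \<longlongrightarrow> 1) F"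
proof -
  have "((\<lambda>x::real. sin x / x) \<longlongrightarrow> 1) (at 0)"
    using DERIV_sin[of 0] by (simp add: has_field_derivative_iff)
  then show ?thesis
    by (rule filterlim_compose) (use assms in \<open>simp add: filterlim_at\<close>)
qed

lemma tendsto_hat_symbol:
  assumes "(f \<longlongrightarrow> 0) F" "\<forall>\<^sub>F p in F. f p \<noteq> 0"
  shows "((\<lambda>p. hat_symbol (f p)) \<longlongrightarrow> 1) F"
proof -
  have "((\<lambda>p. (sin (f p / 2) / (f p / 2))\<^sup>2) \<longlongrightarrow> 1\<^sup>2) F"
    using assms by (intro tendsto_power tendsto_sin_over_self) (auto intro: tendsto_divide_zero)
  moreover have "(sin (y / 2) / (y / 2))\<^sup>2 = hat_symbol y" for y
    using cos_double_sin[of "y / 2"] by (simp add: hat_symbol_def power_divide)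
  ultimately show ?thesis by simp
qed

text \<open>
  The mesh ratio \<open>\<tau> / h\<close> and the defect \<open>g\<close> need not converge under refinement; all that is used of
  them is bounds that hold eventually.  Quantities depending on \<open>g\<close> are therefore multiplied by
  \<open>1 - g\<close> before the limit is taken.
\<close>

locale mode_limit =
  fixes F :: "'a filter" and h \<tau> k \<theta> B g :: "'a \<Rightarrow> real"
  assumes facts: "\<forall>\<^sub>F p in F. 0 < h p \<and> 0 < \<tau> p \<and> (\<tau> p)\<^sup>2 \<le> (h p)\<^sup>2 \<and> 4 \<le> k p \<and> k p * \<tau> p \<le> k p * h p \<and>
      0 < \<theta> p \<and> \<theta> p \<le> k p * \<tau> p \<and> \<theta> p = \<tau> p * (k p - g p) \<and> 0 \<le> g p \<and> g p \<le> 1 / 4 \<and> 2 / 3 \<le> B p \<and>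
      B p = B_symbol (h p) (\<tau> p) (k p) \<and> B p * (2 - 2 * cos (\<theta> p)) = (\<tau> p)\<^sup>2 * lap_symbol (h p) (k p)"
    and kh: "((\<lambda>p. k p * h p) \<longlongrightarrow> 0) F" and k_inv: "((\<lambda>p. 1 / k p) \<longlongrightarrow> 0) F"
begin

definition "\<kappa> p = k p - 1"

lemma small_args:
  "((\<lambda>p. k p * \<tau> p) \<longlongrightarrow> 0) F" "(\<theta> \<longlongrightarrow> 0) F" "((\<lambda>p. \<kappa> p * \<tau> p) \<longlongrightarrow> 0) F" "(\<tau> \<longlongrightarrow> 0) F"
  "((\<lambda>p. g p / k p) \<longlongrightarrow> 0) F"
proof -
  have sq: "(f \<longlongrightarrow> 0) F" if "\<forall>\<^sub>F p in F. 0 \<le> f p \<and> f p \<le> k p * h p" for f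
    by (rule tendsto_sandwich[OF _ _ tendsto_const kh]) (use that in \<open>auto elim: eventually_mono\<close>)
  show "((\<lambda>p. k p * \<tau> p) \<longlongrightarrow> 0) F" by (rule sq, rule eventually_mono[OF facts]) auto
  show "(\<theta> \<longlongrightarrow> 0) F" by (rule sq, rule eventually_mono[OF facts]) auto
  show "((\<lambda>p. \<kappa> p * \<tau> p) \<longlongrightarrow> 0) F"
    by (rule sq, rule eventually_mono[OF facts]) (auto simp: \<kappa>_def left_diff_distrib)
  show "(\<tau> \<longlongrightarrow> 0) F"
  proof (rule sq, rule eventually_mono[OF facts], clarify)
    fix p assume *: "0 < \<tau> p" "4 \<le> k p" "k p * \<tau> p \<le> k p * h p"
    have "1 * \<tau> p \<le> k p * \<tau> p" using * by (intro mult_right_mono) auto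
    then have "\<tau> p \<le> k p * h p" using *(3) by linarith
    then show "0 \<le> \<tau> p \<and> \<tau> p \<le> k p * h p" using *(1) by simp
  qed
  show "((\<lambda>p. g p / k p) \<longlongrightarrow> 0) F"
    by (rule tendsto_sandwich[OF _ _ tendsto_const k_inv]; rule eventually_mono[OF facts])
       (auto intro!: divide_right_mono)
qed

lemma B_limit: "(B \<longlongrightarrow> 1) F"
proof -
  have "((\<lambda>p. B p - 1) \<longlongrightarrow> 0) F"
  proof (rule Lim_null_comparison)
    show "((\<lambda>p. (2 - 2 * cos (k p * h p)) / 12) \<longlongrightarrow> 0) F"
      using tendsto_divide[OF tendsto_diff[OF tendsto_const[of 2] tendsto_mult[OF tendsto_const[of 2] isCont_tendsto_compose[OF isCont_cos kh]]] tendsto_const[of 12]]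
      by simp
    show "\<forall>\<^sub>F p in F. norm (B p - 1) \<le> (2 - 2 * cos (k p * h p)) / 12"
    proof (rule eventually_mono[OF facts], clarify)
      fix p assume *: "0 < h p" "0 < \<tau> p" "(\<tau> p)\<^sup>2 \<le> (h p)\<^sup>2" "B p = B_symbol (h p) (\<tau> p) (k p)"
      define c where "c = 2 - 2 * cos (k p * h p)"
      have c: "0 \<le> c" by (simp add: c_def)
      define q where "q = ((h p)\<^sup>2 - (\<tau> p)\<^sup>2) / (h p)\<^sup>2"
      have q: "0 \<le> q" "q \<le> 1" using * by (auto simp: q_def divide_le_eq)
      have "B p - 1 = - (q * c / 12)"
        using * by (simp add: B_symbol_def lap_symbol_def q_def c_def)
      then have "norm (B p - 1) = q * c / 12" using q c by simp
      also have "\<dots> \<le> 1 * c / 12" using q c by (intro divide_right_mono mult_right_mono) auto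
      finally show "norm (B p - 1) \<le> (2 - 2 * cos (k p * h p)) / 12" by (simp add: c_def)
    qed
  qed
  then show ?thesis using LIM_zero_cancel by blast
qed

lemma sin_ratio_limits:
  "((\<lambda>p. k p * \<tau> p / sin (\<theta> p)) \<longlongrightarrow> 1) F"
  "((\<lambda>p. sin (\<kappa> p * \<tau> p) / sin (\<theta> p)) \<longlongrightarrow> 1) F"
proof -
  have s\<theta>: "((\<lambda>p. sin (\<theta> p) / \<theta> p) \<longlongrightarrow> 1) F"
    by (intro tendsto_sin_over_self small_args eventually_mono[OF facts]) auto
  have s\<kappa>: "((\<lambda>p. sin (\<kappa> p * \<tau> p) / (\<kappa> p * \<tau> p)) \<longlongrightarrow> 1) F"
    by (intro tendsto_sin_over_self small_args eventually_mono[OF facts]) (auto simp: \<kappa>_def)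
  have lim: "((\<lambda>p. 1 / ((sin (\<theta> p) / \<theta> p) * (1 - g p / k p))) \<longlongrightarrow> 1) F"
    by (rule tendsto_eq_intros s\<theta> small_args refl | simp)+
  have eq: "k p * \<tau> p / s = 1 / (s / \<theta> p * (1 - g p / k p))"
    if "0 < \<tau> p" "4 \<le> k p" "0 < \<theta> p" "\<theta> p = \<tau> p * (k p - g p)" for p s
  proof -
    have "1 - g p / k p = (k p - g p) / k p" using that by (simp add: field_simps)
    moreover have "k p - g p \<noteq> 0" using that by auto
    ultimately have "s / \<theta> p * (1 - g p / k p) = s / (k p * \<tau> p)"
      using that(1,2) unfolding that(4) by simp
    then show ?thesis by simp
  qed
  show 1: "((\<lambda>p. k p * \<tau> p / sin (\<theta> p)) \<longlongrightarrow> 1) F"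
    by (rule Lim_transform_eventually[OF lim]) (rule eventually_mono[OF facts], use eq in auto)
  have lim2: "((\<lambda>p. (sin (\<kappa> p * \<tau> p) / (\<kappa> p * \<tau> p)) * (1 - 1 / k p) * (k p * \<tau> p / sin (\<theta> p))) \<longlongrightarrow> 1) F"
    by (rule tendsto_eq_intros s\<kappa> k_inv 1 refl | simp)+
  have ratio: "s' / (\<kappa> p * \<tau> p) * (1 - 1 / k p) * (k p * \<tau> p / s) = s' / s" if "0 < \<tau> p" "4 \<le> k p" for p s s'
  proof -
    have "1 - 1 / k p = \<kappa> p / k p" "\<kappa> p \<noteq> 0" using that by (auto simp: \<kappa>_def field_simps)
    then show ?thesis using that by simp
  qed
  show "((\<lambda>p. sin (\<kappa> p * \<tau> p) / sin (\<theta> p)) \<longlongrightarrow> 1) F"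
    by (rule Lim_transform_eventually[OF lim2]) (rule eventually_mono[OF facts], use ratio in auto)
qed

lemma velocity_limit: "((\<lambda>p. k p * \<tau> p / (B p * sin (\<theta> p))) \<longlongrightarrow> 1) F"
proof -
  have "((\<lambda>p. k p * \<tau> p / sin (\<theta> p) / B p) \<longlongrightarrow> 1) F"
    by (rule tendsto_eq_intros sin_ratio_limits B_limit refl | simp)+
  then show ?thesis by (simp add: mult.commute)
qed

definition "denominator p = lap_symbol (h p) (k p) - B p * ((2 - 2 * cos (\<kappa> p * \<tau> p)) / (\<tau> p)\<^sup>2)"
definition "response p = hat_symbol (k p * h p) * hat_symbol (\<kappa> p * \<tau> p) / denominator p"
definition "fast p = \<tau> p * (2 * k p - 1 - g p) / 2"
definition "slow p = \<tau> p * (1 - g p) / 2"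

text \<open>
  By the dispersion relation the eigenvalue of \<open>- \<Lambda>\<^sub>x\<close> is that of the discrete second time
  derivative at the phase \<open>\<theta>\<close>.  The denominator is thus a multiple of \<open>cos (\<kappa> \<tau>) - cos \<theta>\<close>, a product of two
  sines; the frequencies \<open>\<kappa>\<close> and \<open>\<theta> / \<tau>\<close> differ by \<open>1 - g > 0\<close>, so resonance is avoided.
\<close>

lemma denominator_eq:
  "\<forall>\<^sub>F p in F. denominator p = B p * (sin (fast p) / fast p) * (sin (slow p) / slow p) * (2 * k p - 1 - g p) * (1 - g p)"
proof (rule eventually_mono[OF facts], clarify)
  fix p
  assume *: "0 < \<tau> p" "4 \<le> k p" "\<theta> p = \<tau> p * (k p - g p)" "0 \<le> g p" "g p \<le> 1 / 4"
    and rel: "B p * (2 - 2 * cos (\<theta> p)) = (\<tau> p)\<^sup>2 * lap_symbol (h p) (k p)"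
  have pos: "fast p \<noteq> 0" "slow p \<noteq> 0" using * by (auto simp: fast_def slow_def)
  have sum: "fast p = (\<kappa> p * \<tau> p + \<theta> p) / 2" "slow p = (\<theta> p - \<kappa> p * \<tau> p) / 2"
    unfolding *(3) by (simp_all add: fast_def slow_def \<kappa>_def field_simps)
  have "lap_symbol (h p) (k p) = B p * ((2 - 2 * cos (\<theta> p)) / (\<tau> p)\<^sup>2)"
    using rel *(1) by (simp add: field_simps)
  then have "denominator p = 2 * B p * (cos (\<kappa> p * \<tau> p) - cos (\<theta> p)) / (\<tau> p)\<^sup>2"
    using *(1) by (simp add: denominator_def field_simps)
  also have "cos (\<kappa> p * \<tau> p) - cos (\<theta> p) = 2 * (sin (fast p) * sin (slow p))"
    unfolding sum by (simp add: cos_diff_cos)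
  also have "2 * B p * (2 * (sin (fast p) * sin (slow p))) / (\<tau> p)\<^sup>2 =
      B p * (sin (fast p) / fast p) * (sin (slow p) / slow p) * (4 * (fast p * slow p) / (\<tau> p)\<^sup>2)"
    using pos by (simp add: field_simps)
  also have "4 * (fast p * slow p) / (\<tau> p)\<^sup>2 = (2 * k p - 1 - g p) * (1 - g p)"
    using * by (simp add: fast_def slow_def field_simps power2_eq_square)
  finally show "denominator p = B p * (sin (fast p) / fast p) * (sin (slow p) / slow p) * (2 * k p - 1 - g p) * (1 - g p)"
    by (simp add: mult_ac)
qed

lemma beat_sinc_limits:
  "((\<lambda>p. sin (fast p) / fast p) \<longlongrightarrow> 1) F" "((\<lambda>p. sin (slow p) / slow p) \<longlongrightarrow> 1) F"
proof -
  have fast: "(fast \<longlongrightarrow> 0) F"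
  proof (rule tendsto_sandwich[OF _ _ tendsto_const small_args(1)])
    show "\<forall>\<^sub>F p in F. 0 \<le> fast p" by (rule eventually_mono[OF facts]) (auto simp: fast_def)
    show "\<forall>\<^sub>F p in F. fast p \<le> k p * \<tau> p"
      by (rule eventually_mono[OF facts]) (auto simp: fast_def algebra_simps)
  qed
  have slow: "(slow \<longlongrightarrow> 0) F"
  proof (rule tendsto_sandwich[OF _ _ tendsto_const small_args(4)])
    show "\<forall>\<^sub>F p in F. 0 \<le> slow p" by (rule eventually_mono[OF facts]) (auto simp: slow_def)
    show "\<forall>\<^sub>F p in F. slow p \<le> \<tau> p"
      by (rule eventually_mono[OF facts]) (auto simp: slow_def algebra_simps intro: add_increasing)
  qed
  show "((\<lambda>p. sin (fast p) / fast p) \<longlongrightarrow> 1) F"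
    by (rule tendsto_sin_over_self[OF fast]) (rule eventually_mono[OF facts], auto simp: fast_def)
  show "((\<lambda>p. sin (slow p) / slow p) \<longlongrightarrow> 1) F"
    by (rule tendsto_sin_over_self[OF slow]) (rule eventually_mono[OF facts], auto simp: slow_def)
qed

lemma response_limit: "((\<lambda>p. k p * response p * (1 - g p)) \<longlongrightarrow> 1 / 2) F"
proof -
  have hats: "((\<lambda>p. hat_symbol (k p * h p)) \<longlongrightarrow> 1) F" "((\<lambda>p. hat_symbol (\<kappa> p * \<tau> p)) \<longlongrightarrow> 1) F"
    by (intro tendsto_hat_symbol kh small_args eventually_mono[OF facts]; auto simp: \<kappa>_def)+
  have lim: "((\<lambda>p. hat_symbol (k p * h p) * hat_symbol (\<kappa> p * \<tau> p) / (B p * (sin (fast p) / fast p) * (sin (slow p) / slow p))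
      * (1 / (2 - 1 / k p - g p / k p))) \<longlongrightarrow> 1 / 2) F"
    by (rule tendsto_eq_intros hats B_limit beat_sinc_limits k_inv small_args(5) refl | simp)+
  show ?thesis
  proof (rule Lim_transform_eventually[OF lim], rule eventually_mono[OF eventually_conj[OF facts denominator_eq]], clarify)
    fix p
    assume *: "4 \<le> k p" "0 \<le> g p" "g p \<le> 1 / 4"
      and den: "denominator p = B p * (sin (fast p) / fast p) * (sin (slow p) / slow p) * (2 * k p - 1 - g p) * (1 - g p)"
    define X where "X = B p * (sin (fast p) / fast p) * (sin (slow p) / slow p)"
    define H where "H = hat_symbol (k p * h p) * hat_symbol (\<kappa> p * \<tau> p)"
    have "2 - 1 / k p - g p / k p = (2 * k p - 1 - g p) / k p"
      using * by (simp add: field_simps)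
    then have "1 / (2 - 1 / k p - g p / k p) = k p / (2 * k p - 1 - g p)" by simp
    then have "H / X * (1 / (2 - 1 / k p - g p / k p)) = k p * (H / (X * (2 * k p - 1 - g p) * (1 - g p))) * (1 - g p)"
      using * by (simp add: mult_ac)
    then show "hat_symbol (k p * h p) * hat_symbol (\<kappa> p * \<tau> p) / (B p * (sin (fast p) / fast p) * (sin (slow p) / slow p))
      * (1 / (2 - 1 / k p - g p / k p)) = k p * response p * (1 - g p)"
      unfolding response_def den H_def X_def by simp
  qed
qed

lemma denominator_nonzero: "\<forall>\<^sub>F p in F. denominator p \<noteq> 0"
proof -
  have "\<forall>\<^sub>F p in F. 0 < k p * response p * (1 - g p)"
    using order_tendstoD(1)[OF response_limit] by simp
  then show ?thesis by (rule eventually_mono) (auto simp: response_def)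
qed

definition "free p = ((\<tau> p)\<^sup>2 * forcing_factor (h p) (\<tau> p) (k p) (\<kappa> p) 0 / (2 * B p) - response p * sin (\<kappa> p * \<tau> p)) / sin (\<theta> p)"

lemma free_limit: "((\<lambda>p. - k p * free p * (1 - g p)) \<longlongrightarrow> 1 / 2) F"
proof -
  define W where "W p = (\<kappa> p * \<tau> p - sin (\<kappa> p * \<tau> p)) / (\<kappa> p * \<tau> p)\<^sup>2" for p
  have W: "(W \<longlongrightarrow> 0) F"
  proof (rule Lim_null_comparison)
    show "((\<lambda>p. \<bar>\<kappa> p * \<tau> p\<bar>) \<longlongrightarrow> 0) F" by (rule tendsto_rabs_zero[OF small_args(3)])
    show "\<forall>\<^sub>F p in F. norm (W p) \<le> \<bar>\<kappa> p * \<tau> p\<bar>"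
    proof (rule always_eventually, rule allI)
      fix p
      define y where "y = \<kappa> p * \<tau> p"
      have "\<bar>y - sin y\<bar> \<le> \<bar>y\<bar> ^ 3" using abs_sin_minus_self_le[of y] zero_le_power[of "\<bar>y\<bar>" 3] by linarith
      also have "\<dots> = \<bar>y\<bar> * y\<^sup>2" by (simp add: power3_eq_cube power2_eq_square)
      finally show "norm (W p) \<le> \<bar>\<kappa> p * \<tau> p\<bar>"
        by (cases "y = 0") (simp_all add: W_def abs_divide divide_le_eq flip: y_def)
    qed
  qed
  have hat: "((\<lambda>p. hat_symbol (k p * h p)) \<longlongrightarrow> 1) F"
    by (intro tendsto_hat_symbol kh eventually_mono[OF facts]) auto
  have start0: "((\<lambda>p. (k p * \<tau> p / sin (\<theta> p)) * \<tau> p * hat_symbol (k p * h p) * W p / B p) \<longlongrightarrow> 0) F"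
    by (rule tendsto_eq_intros sin_ratio_limits small_args(4) hat W B_limit refl | simp)+
  have start: "((\<lambda>p. ((k p * \<tau> p / sin (\<theta> p)) * \<tau> p * hat_symbol (k p * h p) * W p / B p) * (1 - g p)) \<longlongrightarrow> 0) F"
  proof (rule tendsto_0_le[OF start0, where K = 1], rule eventually_mono[OF facts], clarify)
    fix p assume "0 \<le> g p" "g p \<le> 1 / 4"
    then have "\<bar>1 - g p\<bar> \<le> 1" by simp
    then show "norm (((k p * \<tau> p / sin (\<theta> p)) * \<tau> p * hat_symbol (k p * h p) * W p / B p) * (1 - g p))
        \<le> norm ((k p * \<tau> p / sin (\<theta> p)) * \<tau> p * hat_symbol (k p * h p) * W p / B p) * 1"
      unfolding norm_mult[of _ "1 - g p"] by (intro mult_left_mono) auto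
  qed
  have lim: "((\<lambda>p. k p * response p * (1 - g p) * (sin (\<kappa> p * \<tau> p) / sin (\<theta> p)) -
      ((k p * \<tau> p / sin (\<theta> p)) * \<tau> p * hat_symbol (k p * h p) * W p / B p) * (1 - g p)) \<longlongrightarrow> 1 / 2) F"
    by (rule tendsto_eq_intros response_limit sin_ratio_limits start refl | simp)+
  have "k p * response p * (1 - g p) * (sin (\<kappa> p * \<tau> p) / sin (\<theta> p)) -
      ((k p * \<tau> p / sin (\<theta> p)) * \<tau> p * hat_symbol (k p * h p) * W p / B p) * (1 - g p) = - k p * free p * (1 - g p)" for p
  proof -
    have ff: "forcing_factor (h p) (\<tau> p) (k p) (\<kappa> p) 0 = 2 * (hat_symbol (k p * h p) * W p)"
      by (simp add: forcing_factor_def W_def)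
    show ?thesis
      unfolding free_def ff by (simp add: power2_eq_square algebra_simps diff_divide_distrib)
  qed
  then show ?thesis using lim by simp
qed

end

section \<open>Refinement of the mesh\<close>

text \<open>
  The stable meshes with \<open>h \<rightarrow> 0\<close>, \<open>\<tau>\<close> varying freely.  An eventual property for this filter holds
  uniformly for all stable meshes with \<open>h\<close> below a threshold, as needed for \<open>h\<^sub>0\<close>.
\<close>

definition meshes :: "real \<Rightarrow> real \<Rightarrow> (nat \<times> nat) filter" where
  "meshes T \<epsilon> = inf (filtercomap fst at_top) (principal {(N, M). stable_mesh T \<epsilon> N M})"

lemma eventually_meshes:
  "eventually P (meshes T \<epsilon>) \<longleftrightarrow> (\<exists>N0. \<forall>N\<ge>N0. \<forall>M. stable_mesh T \<epsilon> N M \<longrightarrow> P (N, M))"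
  by (auto simp: meshes_def eventually_inf_principal eventually_filtercomap_at_top_linorder)

lemma filterlim_fst_meshes: "filterlim fst at_top (meshes T \<epsilon>)"
  unfolding meshes_def by (rule filterlim_mono[OF filterlim_filtercomap order_refl]) simp

definition mode_number :: "nat \<Rightarrow> nat" where
  "mode_number N = nat \<lfloor>(pi / real N) powr (- 4 / 5)\<rfloor>"

lemma mode_number_bounds:
  "real (mode_number N) \<le> (pi / real N) powr (- 4 / 5)"
  "(pi / real N) powr (- 4 / 5) - 1 \<le> real (mode_number N)"
proof -
  have "0 \<le> (pi / real N) powr (- 4 / 5)" by simp
  then show "real (mode_number N) \<le> (pi / real N) powr (- 4 / 5)"
    "(pi / real N) powr (- 4 / 5) - 1 \<le> real (mode_number N)"
    unfolding mode_number_def by linarith+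
qed

text \<open>
  Rounding down costs at most a factor \<open>2\<close> once \<open>h^(-4/5) \<ge> 2\<close>, whence \<open>1 / 32 = 2^(-5)\<close>.
\<close>

lemma mode_number_limits:
  "filterlim (\<lambda>N. real (mode_number N)) at_top at_top"
  "((\<lambda>N. real (mode_number N) * (pi / real N)) \<longlongrightarrow> 0) at_top"
  "\<forall>\<^sub>F N in at_top. 1 / 32 \<le> real (mode_number N) ^ 5 * (pi / real N) ^ 4 \<and>
     real (mode_number N) ^ 5 * (pi / real N) ^ 4 \<le> 1"
proof -
  show "filterlim (\<lambda>N. real (mode_number N)) at_top at_top"
  proof (rule filterlim_at_top_mono)
    show "filterlim (\<lambda>N. (pi / real N) powr (- 4 / 5) - 1) at_top at_top" by real_asymp
  qed (use mode_number_bounds(2) in simp)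
  show "((\<lambda>N. real (mode_number N) * (pi / real N)) \<longlongrightarrow> 0) at_top"
  proof (rule tendsto_sandwich[OF _ _ tendsto_const])
    show "((\<lambda>N. (pi / real N) powr (- 4 / 5) * (pi / real N)) \<longlongrightarrow> 0) at_top" by real_asymp
    show "\<forall>\<^sub>F N in at_top. real (mode_number N) * (pi / real N) \<le> (pi / real N) powr (- 4 / 5) * (pi / real N)"
      using mode_number_bounds(1) by (intro always_eventually allI mult_right_mono) auto
  qed simp
  have "\<forall>\<^sub>F N in at_top. 2 < (pi / real N) powr (- 4 / 5)" by real_asymp
  moreover have "\<forall>\<^sub>F N::nat in at_top. 0 < N" by (rule eventually_gt_at_top)
  ultimately show "\<forall>\<^sub>F N in at_top. 1 / 32 \<le> real (mode_number N) ^ 5 * (pi / real N) ^ 4 \<and>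
     real (mode_number N) ^ 5 * (pi / real N) ^ 4 \<le> 1"
  proof eventually_elim
    case (elim N)
    let ?x = "(pi / real N) powr (- 4 / 5)"
    have "(?x / 2) ^ 5 * (pi / real N) ^ 4 \<le> real (mode_number N) ^ 5 * (pi / real N) ^ 4"
      using elim mode_number_bounds(2)[of N] by (intro mult_right_mono power_mono) auto
    moreover have "real (mode_number N) ^ 5 * (pi / real N) ^ 4 \<le> ?x ^ 5 * (pi / real N) ^ 4"
      using mode_number_bounds(1)[of N] by (intro mult_right_mono power_mono) auto
    moreover have "?x ^ 5 * (pi / real N) ^ 4 = 1"
    proof -
      have pos: "0 < pi / real N" using elim by simp
      have five: "real 5 * (- 4 / 5) = - 4" by simp
      have "?x ^ 5 = (pi / real N) powr (real 5 * (- 4 / 5))" using elim by (intro powr_power) simp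
      also have "\<dots> = 1 / (pi / real N) ^ 4"
        unfolding five powr_minus_divide powr_numeral[OF less_imp_le[OF pos]] ..
      finally show ?thesis using elim by simp
    qed
    ultimately show ?case by (simp add: power_divide)
  qed
qed

lemma eventually_mesh_mode:
  assumes "0 < T" "0 < \<epsilon>" "\<epsilon> \<le> 1"
  shows "\<forall>\<^sub>F p in meshes T \<epsilon>. mesh_mode T \<epsilon> (fst p) (snd p) (mode_number (fst p)) \<and>
     1 / 32 \<le> real (mode_number (fst p)) ^ 5 * (pi / real (fst p)) ^ 4 \<and>
     real (mode_number (fst p)) ^ 5 * (pi / real (fst p)) ^ 4 \<le> 1"
proof -
  have "\<forall>\<^sub>F N in at_top. real (mode_number N) * (pi / real N) < \<epsilon>"
    by (rule order_tendstoD(2)[OF mode_number_limits(2)]) (rule assms)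
  moreover have "\<forall>\<^sub>F N in at_top. 4 \<le> real (mode_number N)"
    using mode_number_limits(1) unfolding filterlim_at_top by blast
  ultimately have "\<forall>\<^sub>F N in at_top. 4 \<le> mode_number N \<and> real (mode_number N) * (pi / real N) \<le> \<epsilon> \<and>
     1 / 32 \<le> real (mode_number N) ^ 5 * (pi / real N) ^ 4 \<and> real (mode_number N) ^ 5 * (pi / real N) ^ 4 \<le> 1"
    using mode_number_limits(3) by eventually_elim auto
  from eventually_compose_filterlim[OF this filterlim_fst_meshes[of T \<epsilon>]]
  have *: "\<forall>\<^sub>F p in meshes T \<epsilon>. 4 \<le> mode_number (fst p) \<and> real (mode_number (fst p)) * (pi / real (fst p)) \<le> \<epsilon> \<and>
     1 / 32 \<le> real (mode_number (fst p)) ^ 5 * (pi / real (fst p)) ^ 4 \<and>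
     real (mode_number (fst p)) ^ 5 * (pi / real (fst p)) ^ 4 \<le> 1" .
  have "\<forall>\<^sub>F p in meshes T \<epsilon>. stable_mesh T \<epsilon> (fst p) (snd p)"
    by (auto simp: eventually_meshes)
  with * show ?thesis
    by eventually_elim (use assms in \<open>auto simp: mesh_mode_def\<close>)
qed

section \<open>Asymptotically resonant amplitudes\<close>

definition (in mesh_mode) "amplitudes_close \<delta> \<longleftrightarrow>
  \<tau> \<le> \<delta> \<and> 1 / real k \<le> \<delta> \<and> (real k * h)\<^sup>2 \<le> \<delta> \<and>
  lap_symbol h (real k) \<noteq> B * ((2 - 2 * cos (\<kappa> * \<tau>)) / \<tau>\<^sup>2) \<and>
  \<bar>velocity_amplitude 1 - 1\<bar> \<le> \<delta> \<and>
  \<bar>real k * forcing_response * (1 - g) - 1 / 2\<bar> \<le> \<delta> \<and>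
  \<bar>- real k * free_response * (1 - g) - 1 / 2\<bar> \<le> \<delta>"

lemma eventually_amplitudes_close:
  assumes "0 < T" "0 < \<epsilon>" "\<epsilon> \<le> 1" and \<delta>: "0 < \<delta>"
  shows "\<forall>\<^sub>F p in meshes T \<epsilon>. mesh_mode.amplitudes_close T (fst p) (snd p) (mode_number (fst p)) \<delta>"
proof -
  let ?F = "meshes T \<epsilon>"
  let ?h = "\<lambda>p. mesh_mode.h (fst p)" and ?\<tau> = "\<lambda>p. mesh_mode.\<tau> T (snd p)"
    and ?K = "\<lambda>p::nat \<times> nat. mode_number (fst p)"
  let ?\<theta> = "\<lambda>p. mesh_mode.\<theta> T (fst p) (snd p) (?K p)" and ?B = "\<lambda>p. mesh_mode.B T (fst p) (snd p) (?K p)"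
    and ?g = "\<lambda>p. mesh_mode.g T (fst p) (snd p) (?K p)"
  note ev = eventually_mesh_mode[OF assms(1-3)]
  have h_eq: "\<forall>\<^sub>F p in ?F. ?h p = pi / real (fst p)"
    using ev by eventually_elim (elim conjE, rule mesh_mode.h_def)
  interpret lim: mode_limit ?F ?h ?\<tau> "\<lambda>p. real (?K p)" ?\<theta> ?B ?g
  proof (unfold_locales, goal_cases)
    case 1
    show ?case
      using ev
    proof eventually_elim
      case (elim p)
      interpret mesh_mode T \<epsilon> "fst p" "snd p" "?K p" using elim by simp
      have w: "1 / 32 \<le> real (?K p) ^ 5 * h ^ 4" "real (?K p) ^ 5 * h ^ 4 \<le> 1" using elim by (auto simp: h_def)
      have "0 \<le> \<epsilon>\<^sup>2 / 7680 * (real (?K p) ^ 5 * h ^ 4)" using w by (intro mult_nonneg_nonneg) auto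
      then have "0 \<le> g" "g \<le> 1 / 4" using phase_facts(7,8) w by linarith+
      then show ?case
        using mesh kh phase_facts k(1) by (auto simp: B_def)
    qed
  next
    case 2
    show ?case
    proof (rule Lim_transform_eventually)
      show "((\<lambda>p. real (?K p) * (pi / real (fst p))) \<longlongrightarrow> 0) ?F"
        by (rule filterlim_compose[OF mode_number_limits(2) filterlim_fst_meshes])
      show "\<forall>\<^sub>F p in ?F. real (?K p) * (pi / real (fst p)) = real (?K p) * ?h p"
        using h_eq by eventually_elim simp
    qed
  next
    case 3
    show ?case
      by (rule tendsto_divide_0[OF tendsto_const])
         (rule filterlim_at_top_imp_at_infinity, rule filterlim_compose[OF mode_number_limits(1) filterlim_fst_meshes])
  qed
  have near: "\<forall>\<^sub>F p in ?F. \<bar>f p - c\<bar> \<le> \<delta>" if "(f \<longlongrightarrow> c) ?F" for f and c :: real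
    using tendstoD[OF that \<delta>] by eventually_elim (simp add: dist_real_def)
  have sq: "((\<lambda>p. (real (?K p) * ?h p)\<^sup>2) \<longlongrightarrow> 0) ?F"
    using tendsto_power[OF lim.kh, of 2] by simp
  from ev near[OF lim.small_args(4)] near[OF lim.k_inv] near[OF sq] lim.denominator_nonzero
    near[OF lim.velocity_limit] near[OF lim.response_limit] near[OF lim.free_limit]
  show ?thesis
  proof eventually_elim
    case (elim p)
    obtain N M where p: "p = (N, M)" by (cases p)
    interpret mesh_mode T \<epsilon> N M "mode_number N" using elim(1) p by simp
    have \<kappa>': "lim.\<kappa> p = \<kappa>" by (simp add: lim.\<kappa>_def \<kappa> p)
    have "lim.denominator p = lap_symbol h (real (mode_number N)) - B * ((2 - 2 * cos (\<kappa> * \<tau>)) / \<tau>\<^sup>2)"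
      unfolding lim.denominator_def \<kappa>' by (simp add: p)
    moreover from this have "lim.response p = forcing_response"
      unfolding lim.response_def \<kappa>' forcing_response_def by (simp add: p)
    moreover from this have "lim.free p = free_response"
      unfolding lim.free_def \<kappa>' free_response_def by (simp add: p)
    ultimately show ?case
      using elim mesh unfolding p by (simp add: amplitudes_close_def velocity_amplitude_def)
  qed
qed

section \<open>Lower error bounds\<close>

lemma ennreal_ratio_ge:
  assumes "0 < e" "ennreal e \<le> E" "X \<le> ennreal n" "0 \<le> c" "c * n \<le> e"
  shows "ennreal c \<le> E / X"
proof (cases "X = 0")
  case True
  then show ?thesis using assms by auto
next
  case False
  have "X < top" using assms(3) by (auto intro: le_less_trans)
  have "ennreal c * X \<le> ennreal c * ennreal n" using assms(3) by (rule mult_left_mono) simp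
  also have "\<dots> \<le> ennreal e"
    using assms by (cases "0 \<le> n") (auto simp: ennreal_neg simp flip: ennreal_mult intro!: ennreal_leI)
  also have "\<dots> \<le> E" by (rule assms)
  finally show ?thesis
    using divide_less_ennreal[OF False \<open>X < top\<close>, of E "ennreal c"] by (simp add: not_less[symmetric])
qed

text \<open>
  The exponent \<open>p\<close> is \<open>0\<close> for the initial value and \<open>1\<close> for the other data; it enters the error and
  the norm alike and cancels.  What is left, \<open>k^(l - r)\<close>, is at least
  \<open>h^(4 (r - l) / 5)\<close> because \<open>r \<ge> l\<close> and \<open>k \<le> h^(-4/5)\<close>.
  The constant \<open>980 = 4 * 245\<close> combines the factors lost in the mesh norms and in the Hoelder norm.
\<close>

lemma error_ratio_ge:
  fixes k l p :: nat
  assumes s: "0 < s" and h: "0 < h" and k: "1 \<le> k" "real k \<le> h powr (- 4 / 5)" and r: "real l \<le> r" and C: "0 < C" "C \<le> 245"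
    and E: "ennreal (real k ^ l / 4 * (s / real k ^ p)) \<le> E" and X: "X \<le> ennreal (C * real k powr (r - real p))"
  shows "ennreal (s / 980 * h powr (4 * (r - real l) / 5)) \<le> E / X"
proof (rule ennreal_ratio_ge[OF _ E X])
  have k0: "0 < real k" using k by simp
  show "0 < real k ^ l / 4 * (s / real k ^ p)" using k0 s by simp
  show "0 \<le> s / 980 * h powr (4 * (r - real l) / 5)" using s by simp
  define y where "y = h powr (4 * (r - real l) / 5) * real k powr (r - real l)"
  have "real k powr (r - real l) \<le> (h powr (- 4 / 5)) powr (r - real l)"
    using k r by (intro powr_mono2) auto
  also have "\<dots> = h powr (- (4 * (r - real l) / 5))"
    by (simp add: powr_powr algebra_simps)
  finally have "y \<le> h powr (4 * (r - real l) / 5) * h powr (- (4 * (r - real l) / 5))"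
    unfolding y_def by (intro mult_left_mono) auto
  also have "\<dots> = 1" using h by (simp flip: powr_add)
  finally have y: "y \<le> 1" "0 \<le> y" by (auto simp: y_def)
  have kp: "real k powr (r - real p) = real k powr (r - real l) * (real k ^ l / real k ^ p)"
    using k0 by (simp add: powr_diff powr_realpow)
  have "s / 980 * h powr (4 * (r - real l) / 5) * (C * real k powr (r - real p)) = (C * y) * (s / 980 * (real k ^ l / real k ^ p))"
    unfolding kp y_def by (simp add: mult_ac)
  also have "\<dots> \<le> (245 * 1) * (s / 980 * (real k ^ l / real k ^ p))"
    using C y s by (intro mult_right_mono mult_mono) auto
  finally show "s / 980 * h powr (4 * (r - real l) / 5) * (C * real k powr (r - real p)) \<le> real k ^ l / 4 * (s / real k ^ p)"
    by simp
qed

text \<open>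
  With the defect at least \<open>\<epsilon>\<^sup>2 / 7680 / 32\<close> on a time window of length at least \<open>min T 1 / 2\<close>, half of the beat
  is kept as the lower bound; the other half absorbs the fast sums and the amplitude deviations.
\<close>

definition beat_constant :: "real \<Rightarrow> real \<Rightarrow> real" where
  "beat_constant T \<epsilon> = (\<epsilon>\<^sup>2 / 245760)\<^sup>2 / 36 * (min T 1 / 2) ^ 3 / 2"

context mesh_mode
begin

context
  fixes \<delta> :: real
  assumes w: "1 / 32 \<le> real k ^ 5 * h ^ 4" "real k ^ 5 * h ^ 4 \<le> 1"
    and \<delta>: "\<tau> \<le> min T 1 / 2" "1 / real k \<le> \<delta>" "30 * \<delta> \<le> beat_constant T \<epsilon>"
begin

text \<open>
  Number of time steps tested: the beats are bounded below for \<open>t \<le> 1\<close> only.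
\<close>

definition "window = nat \<lfloor>min T 1 / \<tau>\<rfloor>"

lemma window: "\<tau> * real window \<le> 1" "window \<le> M" "min T 1 / 2 \<le> \<tau> * real window"
proof -
  have r: "0 \<le> min T 1 / \<tau>" using T mesh by simp
  then have "real window \<le> min T 1 / \<tau>" "min T 1 / \<tau> - 1 \<le> real window"
    unfolding window_def by linarith+
  then have *: "\<tau> * real window \<le> min T 1" "min T 1 - \<tau> \<le> \<tau> * real window"
    using mesh(4) by (simp_all add: field_simps)
  then show "\<tau> * real window \<le> 1" "min T 1 / 2 \<le> \<tau> * real window" using \<delta>(1) by linarith+
  have "\<tau> * real window \<le> \<tau> * real M" using * mesh by (simp add: \<tau>_def)
  then show "window \<le> M" using mesh(4) by simp
qed

lemma defect_range: "\<epsilon>\<^sup>2 / 245760 \<le> g" "0 \<le> g" "g \<le> 1 / 4"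
proof -
  have "\<epsilon>\<^sup>2 / 7680 * (1 / 32) \<le> \<epsilon>\<^sup>2 / 7680 * (real k ^ 5 * h ^ 4)"
    using w by (intro mult_left_mono) auto
  then show 1: "\<epsilon>\<^sup>2 / 245760 \<le> g" using phase_facts(7) by simp
  show "0 \<le> g" by (rule order_trans[OF _ 1]) simp
  show "g \<le> 1 / 4" using phase_facts(8) w by linarith
qed

text \<open>
  The bound \<open>30 \<delta>\<close> on the total loss is split into \<open>12 \<delta>\<close> for the fast sums and \<open>18 \<delta>\<close> for the
  deviation of the amplitudes.
\<close>

lemma beat_sum_ge:
  assumes "g\<^sup>2 / 12 * (\<tau> * real window) ^ 3 / 3 - 12 / real k - 18 * \<delta> \<le> S"
  shows "beat_constant T \<epsilon> \<le> S" "0 < beat_constant T \<epsilon>"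
proof -
  have "2 * beat_constant T \<epsilon> = (\<epsilon>\<^sup>2 / 245760)\<^sup>2 / 36 * (min T 1 / 2) ^ 3"
    by (simp add: beat_constant_def)
  also have "\<dots> \<le> g\<^sup>2 / 36 * (\<tau> * real window) ^ 3"
    using defect_range window(3) T by (intro mult_mono divide_right_mono power_mono) auto
  also have "\<dots> = g\<^sup>2 / 12 * (\<tau> * real window) ^ 3 / 3" by simp
  finally have "2 * beat_constant T \<epsilon> \<le> g\<^sup>2 / 12 * (\<tau> * real window) ^ 3 / 3" .
  moreover have "12 / real k \<le> 12 * \<delta>" using \<delta>(2) by simp
  ultimately show "beat_constant T \<epsilon> \<le> S" using assms \<delta>(3) by linarith
  show "0 < beat_constant T \<epsilon>" using T \<epsilon> by (simp add: beat_constant_def)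
qed

lemma initial_value_error_ge:
  assumes "\<And>i. i \<in> {1..<N} \<Longrightarrow> U N M (\<lambda>x. 0) i = 0" and l: "l \<in> {0, 1}"
  shows "real k ^ l / 4 * (beat_constant T \<epsilon> / real k ^ 0) \<le>
    L1_norm_bdelta l T N M (scheme_error T U N M (\<lambda>x. sin (real k * x)) (\<lambda>x. 0) (\<lambda>x t. 0))"
proof -
  have "0 \<le> \<delta>" by (rule order_trans[OF _ \<delta>(2)]) simp
  then have s: "beat_constant T \<epsilon> \<le> (\<Sum>m=1..window. \<tau> * \<bar>cos (real k * \<tau> * real m) - cos (\<theta> * real m)\<bar>)" "0 < beat_constant T \<epsilon>"
    using beat_sum_ge initial_value_beat[OF defect_range(2,3) window(1)] by force+
  have e: "scheme_error T U N M (\<lambda>x. sin (real k * x)) (\<lambda>x. 0) (\<lambda>x t. 0) i m =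
      sin (real k * (real i * h)) * (cos (real k * \<tau> * real m) - cos (\<theta> * real m))" if "i \<le> N" "m \<le> M" for i m
    by (rule scheme_error_initial_value) (use assms(1) that in auto)
  have "real k ^ l / 4 * beat_constant T \<epsilon> \<le>
    L1_norm_bdelta l T N M (scheme_error T U N M (\<lambda>x. sin (real k * x)) (\<lambda>x. 0) (\<lambda>x t. 0))"
    by (rule L1_error_ge[OF l window(2) _ s(1)], rule e, assumption, assumption, rule less_imp_le[OF s(2)])
  then show ?thesis by simp
qed

lemma initial_velocity_error_ge:
  assumes U: "\<And>i. i \<in> {1..<N} \<Longrightarrow> U N M (\<lambda>x. sin (real k * x)) i = a * sin (real k * (real i * (pi / real N)))"
    and l: "l \<in> {0, 1}" and a: "\<bar>a - 1\<bar> \<le> 4 * \<delta>" and V: "\<bar>velocity_amplitude 1 - 1\<bar> \<le> \<delta>" and \<delta>1: "\<delta> \<le> 1"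
  shows "real k ^ l / 4 * (beat_constant T \<epsilon> / real k ^ 1) \<le>
    L1_norm_bdelta l T N M (scheme_error T U N M (\<lambda>x. 0) (\<lambda>x. sin (real k * x)) (\<lambda>x t. 0))"
proof -
  have \<delta>0: "0 \<le> \<delta>" by (rule order_trans[OF _ \<delta>(2)]) simp
  have "velocity_amplitude a - 1 = (a - 1) * velocity_amplitude 1 + (velocity_amplitude 1 - 1)"
    by (simp add: velocity_amplitude_def algebra_simps diff_divide_distrib)
  moreover have "\<bar>(a - 1) * velocity_amplitude 1\<bar> \<le> 4 * \<delta> * 2"
    unfolding abs_mult using a V \<delta>1 by (intro mult_mono) auto
  ultimately have A: "\<bar>velocity_amplitude a - 1\<bar> \<le> 18 * \<delta>" using V \<delta>0 by linarith
  let ?Y = "\<lambda>m. sin (real k * \<tau> * real m) - velocity_amplitude a * sin (\<theta> * real m)"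
  have s: "beat_constant T \<epsilon> \<le> (\<Sum>m=1..window. \<tau> * \<bar>?Y m\<bar>)" "0 < beat_constant T \<epsilon>"
    using beat_sum_ge[OF order_trans[OF _ initial_velocity_beat[OF defect_range(2,3) window(1), of "velocity_amplitude a"]]] A
    by auto
  have "beat_constant T \<epsilon> / real k \<le> (\<Sum>m=1..window. \<tau> * \<bar>?Y m\<bar>) / real k"
    using s(1) by (rule divide_right_mono) simp
  also have "\<dots> = (\<Sum>m=1..window. \<tau> * \<bar>?Y m / real k\<bar>)"
    by (simp add: sum_divide_distrib abs_divide)
  finally have sk: "beat_constant T \<epsilon> / real k \<le> (\<Sum>m=1..window. \<tau> * \<bar>?Y m / real k\<bar>)" .
  have e: "scheme_error T U N M (\<lambda>x. 0) (\<lambda>x. sin (real k * x)) (\<lambda>x t. 0) i m =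
      sin (real k * (real i * h)) * (?Y m / real k)" if "i \<le> N" "m \<le> M" for i m
    by (rule scheme_error_initial_velocity) (use U that in auto)
  have "real k ^ l / 4 * (beat_constant T \<epsilon> / real k) \<le>
    L1_norm_bdelta l T N M (scheme_error T U N M (\<lambda>x. 0) (\<lambda>x. sin (real k * x)) (\<lambda>x t. 0))"
    by (rule L1_error_ge[OF l window(2) _ sk], rule e, assumption, assumption) (use s(2) in simp)
  then show ?thesis by simp
qed

lemma forcing_error_ge:
  assumes U: "\<And>i. i \<in> {1..<N} \<Longrightarrow> U N M (\<lambda>x. 0) i = 0" and l: "l \<in> {0, 1}"
    and nonres: "lap_symbol h (real k) \<noteq> B * ((2 - 2 * cos (\<kappa> * \<tau>)) / \<tau>\<^sup>2)"
    and \<alpha>: "\<bar>real k * forcing_response * (1 - g) - 1 / 2\<bar> \<le> \<delta>"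
    and \<beta>: "\<bar>- real k * free_response * (1 - g) - 1 / 2\<bar> \<le> \<delta>"
  shows "real k ^ l / 4 * (beat_constant T \<epsilon> / real k ^ 1) \<le>
    L1_norm_bdelta l T N M (scheme_error T U N M (\<lambda>x. 0) (\<lambda>x. 0) (\<lambda>x t. sin (real k * x) * sin (real (k - 1) * t)))"
proof -
  have \<delta>0: "0 \<le> \<delta>" by (rule order_trans[OF _ \<delta>(2)]) simp
  have g1: "3 / 4 \<le> 1 - g" using defect_range by simp
  have quot: "\<bar>y - 1 / (2 * (1 - g))\<bar> \<le> 2 * \<delta>" if "\<bar>y * (1 - g) - 1 / 2\<bar> \<le> \<delta>" for y
  proof -
    have "y - 1 / (2 * (1 - g)) = (y * (1 - g) - 1 / 2) / (1 - g)" using g1 by (simp add: field_simps)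
    then have "\<bar>y - 1 / (2 * (1 - g))\<bar> = \<bar>y * (1 - g) - 1 / 2\<bar> / (1 - g)" using g1 by (simp add: abs_divide)
    also have "\<dots> \<le> \<delta> / (1 / 2)" using that g1 by (intro frac_le) auto
    finally show ?thesis by simp
  qed
  have k2: "\<bar>1 / (2 * (2 * real k - 1))\<bar> \<le> \<delta>"
  proof -
    have "1 / (2 * (2 * real k - 1)) \<le> 1 / real k" using k by (intro divide_left_mono) auto
    then show ?thesis using \<delta>(2) k by simp
  qed
  have A2: "\<bar>\<kappa> / (2 * real k - 1) - 1 / 2\<bar> \<le> 6 * \<delta>"
  proof -
    have "\<kappa> / (2 * real k - 1) - 1 / 2 = - (1 / (2 * (2 * real k - 1)))" using k by (simp add: \<kappa> field_simps)
    then show ?thesis using k2 \<delta>0 by simp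
  qed
  have A1: "\<bar>real k / (2 * real k - 1) - real k * forcing_response + g / (2 * (1 - g))\<bar> \<le> 6 * \<delta>"
  proof -
    have "real k / (2 * real k - 1) = 1 / 2 + 1 / (2 * (2 * real k - 1))" using k by (simp add: field_simps)
    moreover have "1 / 2 + g / (2 * (1 - g)) = 1 / (2 * (1 - g))" using g1 by (simp add: field_simps)
    ultimately have "real k / (2 * real k - 1) - real k * forcing_response + g / (2 * (1 - g)) =
        1 / (2 * (2 * real k - 1)) - (real k * forcing_response - 1 / (2 * (1 - g)))" by simp
    then show ?thesis using k2 quot[OF \<alpha>] \<delta>0 by linarith
  qed
  have A3: "\<bar>- real k * free_response - 1 / (2 * (1 - g))\<bar> \<le> 6 * \<delta>"
    using quot[OF \<beta>] \<delta>0 by linarith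
  let ?Y = "\<lambda>m. (real k / (2 * real k - 1) - real k * forcing_response) * sin (\<kappa> * \<tau> * real m)
       - \<kappa> / (2 * real k - 1) * sin (real k * \<tau> * real m) + - real k * free_response * sin (\<theta> * real m)"
  have s: "beat_constant T \<epsilon> \<le> (\<Sum>m=1..window. \<tau> * \<bar>?Y m\<bar>)" "0 < beat_constant T \<epsilon>"
    using beat_sum_ge[of "\<Sum>m=1..window. \<tau> * \<bar>?Y m\<bar>"] forcing_beat[OF defect_range(2,3) window(1) A1 A2 A3]
    by simp_all
  have "beat_constant T \<epsilon> / real k \<le> (\<Sum>m=1..window. \<tau> * \<bar>?Y m\<bar>) / real k"
    using s(1) by (rule divide_right_mono) simp
  also have "\<dots> = (\<Sum>m=1..window. \<tau> * \<bar>?Y m / real k\<bar>)"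
    by (simp add: sum_divide_distrib abs_divide)
  finally have sk: "beat_constant T \<epsilon> / real k \<le> (\<Sum>m=1..window. \<tau> * \<bar>?Y m / real k\<bar>)" .
  have e: "scheme_error T U N M (\<lambda>x. 0) (\<lambda>x. 0) (\<lambda>x t. sin (real k * x) * sin (real (k - 1) * t)) i m =
      sin (real k * (real i * h)) * (?Y m / real k)" if "i \<le> N" "m \<le> M" for i m
    by (rule scheme_error_forcing) (use U that nonres in auto)
  have "real k ^ l / 4 * (beat_constant T \<epsilon> / real k) \<le>
    L1_norm_bdelta l T N M (scheme_error T U N M (\<lambda>x. 0) (\<lambda>x. 0) (\<lambda>x t. sin (real k * x) * sin (real (k - 1) * t)))"
    by (rule L1_error_ge[OF l window(2) _ sk], rule e, assumption, assumption) (use s(2) in simp)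
  then show ?thesis by simp
qed

end

end

theorem theorem2:
  fixes T \<epsilon>\<^sub>0 :: real and l :: nat
    and U :: "nat \<Rightarrow> nat \<Rightarrow> (real \<Rightarrow> real) \<Rightarrow> nat \<Rightarrow> real"
  assumes "T > 0" and "0 < \<epsilon>\<^sub>0" and "\<epsilon>\<^sub>0 \<le> 1" and "l \<in> {0, 1}"
    and "admissible_u1h T \<epsilon>\<^sub>0 U"
  shows "\<exists>h\<^sub>0>0. \<exists>c\<^sub>1>0. \<forall>N M. stable_mesh T \<epsilon>\<^sub>0 N M \<longrightarrow> pi / real N \<le> h\<^sub>0 \<longrightarrow>
    (\<forall>r::real. real l \<le> r \<and> r \<le> 5 + real l \<longrightarrow>
      (SUP k\<in>{1::nat..}.
         error_norm l T U N M (\<lambda>x. sin (real k * x)) (\<lambda>x. 0) (\<lambda>x t. 0)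
         / holder0_norm_I r (\<lambda>x. sin (real k * x)))
        \<ge> ennreal (c\<^sub>1 * (pi / real N) powr (4 * (r - real l) / 5)) \<and>
      ((l = 0 \<longrightarrow> 1 \<le> r) \<longrightarrow>
        (SUP k\<in>{1::nat..}.
           error_norm l T U N M (\<lambda>x. 0) (\<lambda>x. sin (real k * x)) (\<lambda>x t. 0)
           / holder0_norm_I (r - 1) (\<lambda>x. sin (real k * x)))
          \<ge> ennreal (c\<^sub>1 * (pi / real N) powr (4 * (r - real l) / 5)) \<and>
        (SUP k\<in>{2::nat..}.
           error_norm l T U N M (\<lambda>x. 0) (\<lambda>x. 0) (\<lambda>x t. sin (real k * x) * sin (real (k - 1) * t))
           / holder0_norm_Q T (r - 1) (\<lambda>x t. sin (real k * x) * sin (real (k - 1) * t)))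
          \<ge> ennreal (c\<^sub>1 * (pi / real N) powr (4 * (r - real l) / 5))))"
proof -
  obtain C where C: "\<And>N M k. stable_mesh T \<epsilon>\<^sub>0 N M \<Longrightarrow> k \<in> {1..<N} \<Longrightarrow>
      \<exists>a. \<bar>a - 1\<bar> \<le> C * (real k * (pi / real N))\<^sup>2 \<and>
        (\<forall>i\<in>{1..<N}. U N M (\<lambda>x. sin (real k * x)) i = a * sin (real k * (real i * (pi / real N))))"
    using assms(5) unfolding admissible_u1h_def by blast
  have U0: "U N M (\<lambda>x. 0) i = 0" if "stable_mesh T \<epsilon>\<^sub>0 N M" "i \<in> {1..<N}" for N M i
  proof -
    have "\<forall>w z a b. continuous_on {0..pi} w \<longrightarrow> continuous_on {0..pi} z \<longrightarrow>
          (\<forall>i\<in>{1..<N}. U N M (\<lambda>x. a * w x + b * z x) i = a * U N M w i + b * U N M z i)"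
      using assms(5) that(1) unfolding admissible_u1h_def by blast
    from this[rule_format, of "\<lambda>x. 0" "\<lambda>x. 0" i 0 0] show ?thesis
      using that(2) by simp
  qed
  define c where "c = beat_constant T \<epsilon>\<^sub>0"
  have c: "0 < c" using assms by (simp add: c_def beat_constant_def)
  define \<delta> where "\<delta> = min (min (c / 30) 1) (min T 1 / 2)"
  have \<delta>: "0 < \<delta>" "30 * \<delta> \<le> c" "\<delta> \<le> 1" "\<delta> \<le> min T 1 / 2"
    using c assms by (auto simp: \<delta>_def)
  \<comment> \<open>The symbol of the initial velocity deviates from \<open>1\<close> by up to \<open>C (k h)\<^sup>2\<close>.\<close>
  define \<delta>' where "\<delta>' = \<delta> / (1 + \<bar>C\<bar>)"
  have \<delta>': "0 < \<delta>'" "\<delta>' \<le> \<delta>" "\<bar>C\<bar> * \<delta>' \<le> \<delta>"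
  proof -
    have pos: "0 < 1 + \<bar>C\<bar>" by simp
    show "0 < \<delta>'" using \<delta> pos by (simp add: \<delta>'_def)
    have "\<delta>' * (1 + \<bar>C\<bar>) = \<delta>" using pos by (simp add: \<delta>'_def)
    then have "\<delta>' + \<bar>C\<bar> * \<delta>' = \<delta>" by (simp add: algebra_simps)
    moreover have "0 \<le> \<bar>C\<bar> * \<delta>'" using \<open>0 < \<delta>'\<close> by simp
    ultimately show "\<delta>' \<le> \<delta>" "\<bar>C\<bar> * \<delta>' \<le> \<delta>" using \<open>0 < \<delta>'\<close> by linarith+
  qed
  from eventually_conj[OF eventually_mesh_mode eventually_amplitudes_close, OF assms(1-3) assms(1-3) \<delta>'(1)]
  obtain N0 where N0: "\<And>N M. N0 \<le> N \<Longrightarrow> stable_mesh T \<epsilon>\<^sub>0 N M \<Longrightarrow>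
    (mesh_mode T \<epsilon>\<^sub>0 N M (mode_number N) \<and> 1 / 32 \<le> real (mode_number N) ^ 5 * (pi / real N) ^ 4 \<and>
      real (mode_number N) ^ 5 * (pi / real N) ^ 4 \<le> 1) \<and>
    mesh_mode.amplitudes_close T N M (mode_number N) \<delta>'"
    unfolding eventually_meshes by auto
  show ?thesis
  proof (intro exI conjI allI impI)
    show "0 < pi / real (Suc N0)" "0 < c / 980" using c by auto
    fix N M and r :: real
    assume stable: "stable_mesh T \<epsilon>\<^sub>0 N M" and fine: "pi / real N \<le> pi / real (Suc N0)" and r: "real l \<le> r \<and> r \<le> 5 + real l"
    have "0 < N" using stable by (simp add: stable_mesh_def)
    then have "pi * real (Suc N0) \<le> pi * real N" using fine by (simp add: field_simps)
    then have "real (Suc N0) \<le> real N" using mult_le_cancel_left_pos[OF pi_gt_zero] by blast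
    then have "N0 \<le> N" by simp
    define k where "k = mode_number N"
    note near = N0[OF \<open>N0 \<le> N\<close> stable, folded k_def]
    interpret mesh_mode T \<epsilon>\<^sub>0 N M k using near by simp
    note close = near[unfolded amplitudes_close_def]
    have w: "1 / 32 \<le> real k ^ 5 * h ^ 4" "real k ^ 5 * h ^ 4 \<le> 1" using close by (auto simp: h_def)
    have d: "\<tau> \<le> min T 1 / 2" "1 / real k \<le> \<delta>" "30 * \<delta> \<le> beat_constant T \<epsilon>\<^sub>0"
      using close \<delta> \<delta>' by (auto simp: c_def)
    have k1: "1 \<le> k" "k \<in> {1..}" "k \<in> {2..}" "2 \<le> k" "k \<in> {1..<N}" using k(1) kh(5) by auto
    have kh': "real k \<le> h powr (- 4 / 5)" unfolding k_def h_def by (rule mode_number_bounds)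
    obtain a where a: "\<bar>a - 1\<bar> \<le> C * (real k * h)\<^sup>2"
      "\<And>i. i \<in> {1..<N} \<Longrightarrow> U N M (\<lambda>x. sin (real k * x)) i = a * sin (real k * (real i * (pi / real N)))"
      using C[OF stable k1(5)] unfolding h_def by blast
    have a': "\<bar>a - 1\<bar> \<le> 4 * \<delta>"
    proof -
      have sq: "(real k * h)\<^sup>2 \<le> \<delta>'" using close by auto
      have "C * (real k * h)\<^sup>2 \<le> \<bar>C\<bar> * \<delta>'" using sq by (intro mult_mono) auto
      also have "\<dots> \<le> \<delta>" by (rule \<delta>'(3))
      finally show ?thesis using a(1) \<delta>(1) by linarith
    qed
    note rat = error_ratio_ge[OF c mesh(3) k1(1) kh' conjunct1[OF r], unfolded h_def]
    show "ennreal (c / 980 * (pi / real N) powr (4 * (r - real l) / 5)) \<le> (SUP k\<in>{1::nat..}.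
         error_norm l T U N M (\<lambda>x. sin (real k * x)) (\<lambda>x. 0) (\<lambda>x t. 0) / holder0_norm_I r (\<lambda>x. sin (real k * x)))"
    proof (rule SUP_upper2[OF k1(2)], rule rat[where C = 9 and p = 0])
      show "ennreal (real k ^ l / 4 * (c / real k ^ 0)) \<le> error_norm l T U N M (\<lambda>x. sin (real k * x)) (\<lambda>x. 0) (\<lambda>x t. 0)"
        unfolding error_norm_def c_def
        by (intro ennreal_leI initial_value_error_ge[OF w d _ assms(4)] U0[OF stable])
      show "holder0_norm_I r (\<lambda>x. sin (real k * x)) \<le> ennreal (9 * real k powr (r - real 0))"
        using holder0_norm_I_sine_le[OF k1(1), of r] r assms(4) by auto
    qed auto
    assume r1: "l = 0 \<longrightarrow> 1 \<le> r"
    then have r1: "0 \<le> r - 1" "r - 1 \<le> 6" using r assms(4) by auto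
    show "ennreal (c / 980 * (pi / real N) powr (4 * (r - real l) / 5)) \<le> (SUP k\<in>{1::nat..}.
         error_norm l T U N M (\<lambda>x. 0) (\<lambda>x. sin (real k * x)) (\<lambda>x t. 0) / holder0_norm_I (r - 1) (\<lambda>x. sin (real k * x)))"
    proof (rule SUP_upper2[OF k1(2)], rule rat[where C = 9 and p = 1])
      show "ennreal (real k ^ l / 4 * (c / real k ^ 1)) \<le> error_norm l T U N M (\<lambda>x. 0) (\<lambda>x. sin (real k * x)) (\<lambda>x t. 0)"
        unfolding error_norm_def c_def
      proof (intro ennreal_leI initial_velocity_error_ge[OF w d _ assms(4) a'] a(2))
        show "\<bar>velocity_amplitude 1 - 1\<bar> \<le> \<delta>" "\<delta> \<le> 1" using close \<delta>' \<delta> by auto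
      qed
      show "holder0_norm_I (r - 1) (\<lambda>x. sin (real k * x)) \<le> ennreal (9 * real k powr (r - real 1))"
        using holder0_norm_I_sine_le[OF k1(1) r1] by simp
    qed auto
    show "ennreal (c / 980 * (pi / real N) powr (4 * (r - real l) / 5)) \<le> (SUP k\<in>{2::nat..}.
         error_norm l T U N M (\<lambda>x. 0) (\<lambda>x. 0) (\<lambda>x t. sin (real k * x) * sin (real (k - 1) * t))
         / holder0_norm_Q T (r - 1) (\<lambda>x t. sin (real k * x) * sin (real (k - 1) * t)))"
    proof (rule SUP_upper2[OF k1(3)], rule rat[where C = 245 and p = 1])
      show "ennreal (real k ^ l / 4 * (c / real k ^ 1)) \<le>
          error_norm l T U N M (\<lambda>x. 0) (\<lambda>x. 0) (\<lambda>x t. sin (real k * x) * sin (real (k - 1) * t))"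
        unfolding error_norm_def c_def
      proof (intro ennreal_leI forcing_error_ge[OF w d _ assms(4)] U0[OF stable])
        show "lap_symbol h (real k) \<noteq> B * ((2 - 2 * cos (\<kappa> * \<tau>)) / \<tau>\<^sup>2)"
          "\<bar>real k * forcing_response * (1 - g) - 1 / 2\<bar> \<le> \<delta>"
          "\<bar>- real k * free_response * (1 - g) - 1 / 2\<bar> \<le> \<delta>"
          using close \<delta>' by auto
      qed
      show "holder0_norm_Q T (r - 1) (\<lambda>x t. sin (real k * x) * sin (real (k - 1) * t)) \<le> ennreal (245 * real k powr (r - real 1))"
        using holder0_norm_Q_sine_le[OF k1(4) r1 assms(1)] by simp
    qed auto
  qed
qed

end
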